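(* Let $M$ be a connected complex manifold, $E=E_0\oplus\dots\oplus E_k\to M$ a direct sum of holomorphic vector bundles with the weighted action of $\mathbb C^*$ on $\mathbb P(E)$ given by integers $0=\beta_0<\beta_1<\dots<\beta_k$, and let $s:M\to\mathbb P(E)$ be a holomorphic section whose image is not contained in any of the stable manifolds $S(F_j)$. Fix $0\le i\le k$, let $E_i'=\bigoplus_{j\ne i}E_j$ and $A=s(M)\cap(\mathbb P(E)\setminus\mathbb P(E_i'))$. Then the part of the strict transform $\tilde S$ over $[0:1]$ lying in the open dense subset $S(F_i)\times_{F_i}U(F_i)$ of $C_i^\infty$ coincides with the exceptional divisor of the affine cone of the weighted strict transform of $A$ in the weighted blow-up of $S(F_i)$ inside $\mathbb P(E)\setminus\mathbb P(E_i')$; in other words $$\tilde S_i^\infty\cap\big((\mathbb P(E)\setminus\mathbb P(E_i'))\times_M(\mathbb P(E)\setminus\mathbb P(E_i'))\big)=(EG_1^A)_i .$$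
   Context: The action is $\lambda*[v_0:\dots:v_k]=[\lambda^{\beta_0}v_0:\dots:\lambda^{\beta_k}v_k]$ ($v_j\in E_j$), fiberwise over $M$. $E_{<i},E_{\le i},E_{>i},E_{\ge i}$ denote the obvious partial sums. $F_i=\mathbb P(E_i)$; $S(F_i)=\{v:\lim_{\lambda\to\infty}\lambda*v\in F_i\}=\mathbb P(E_{\le i})\setminus\mathbb P(E_{<i})$ and $U(F_i)=\{v:\lim_{\lambda\to0}\lambda*v\in F_i\}=\mathbb P(E_{\ge i})\setminus\mathbb P(E_{>i})$, both projecting to $F_i$; $C_i^\infty=\overline{S(F_i)\times_{F_i}U(F_i)}=\{([w],[v])\in\mathbb P(E_{\le i})\times_M\mathbb P(E_{\ge i})\mid w_i\wedge v_i=0\}$. $\tilde S$ is the strict transform of $\mathbb P^1\times s(M)$ under the blow-up of $\mathbb P^1\times\mathbb P(E)$ along the sheaf of bihomogeneous ideals $\langle\mu^{\beta_k-\beta_j}\lambda^{\beta_j}w_j,\ j=0,\dots,k\rangle$; equivalently, the closure in $\mathbb P^1\times\mathbb P(E)\times_M\mathbb P(E)$ of $\{([1:\lambda],s(m),\lambda*s(m))\mid\lambda\in\mathbb C^*,m\in M\}$. $\tilde S_i^\infty:=\pi_{2,3}\big((\{[0:1]\}\times C_i^\infty)\cap\tilde S\big)\subset\mathbb P(E)\times_M\mathbb P(E)$, with $\pi_{2,3}$ the projection onto the last two factors. Let $\tau_i\to\mathbb P(E_i)$ be the tautological line bundle, $\pi_i:\mathbb P(E_i)\to M$, $\tilde E^-=\mathrm{Hom}(\tau_i,\pi_i^*E_{<i})$,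 $\tilde E^+=\mathrm{Hom}(\tau_i,\pi_i^*E_{>i})$. Taking graphs gives a $\mathbb C^*$-equivariant biholomorphism (chart) $\tilde E^-\oplus\tilde E^+\cong\mathbb P(E)\setminus\mathbb P(E_i')$, where $\mathbb C^*$ acts on the component in $\mathrm{Hom}(\tau_i,\pi_i^*E_j)$ by $\lambda^{\beta_j-\beta_i}$; it identifies $S(F_i)$ with $\tilde E^-$ and $U(F_i)$ with $\tilde E^+$. The weighted blow-up of $S(F_i)$ is $\{((v_-,v_+),[w])\in(\tilde E^-\oplus\tilde E^+)\times_{\mathbb P(E_i)}\mathbb P^{\beta_{>i}}(\tilde E^+)\mid v_+\in[w]\}$, where $\mathbb P^{\beta_{>i}}(\tilde E^+)=(\tilde E^+\setminus0)/\mathbb C^*$ is the weighted projective bundle with weights $\beta_{i+1}-\beta_i,\dots,\beta_k-\beta_i$. Identify $A$ with a closed analytic subset of $\tilde E^-\oplus\tilde E^+$. Its weighted strict transform is the closure of $\{((v_-,v_+),[v_+]):(v_-,v_+)\in A,\ v_+\neq0\}$, and the (fiberwise) affine cone $(G_1^A)_i$ over it is the closure, in $(\tilde E^-\oplus\tilde E^+)\times_{\mathbb P(E_i)}\tilde E^+\subset(\tilde E^-\oplus\tilde E^+)\times_{\mathbb P(E_i)}(\tilde E^-\oplus\tilde E^+)$, of $$\{(v_-,v_+,\lambda*v_+)\mid(v_-,v_+)\in A,\ \lambda\in\mathbb C^*\}.$$ Via the chart it is viewed in $(\mathbb P(E)\setminus\mathbb P(E_i'))\times_M(\mathbb P(E)\setminus\mathbb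 P(E_i'))$. Its exceptional divisor is $(EG_1^A)_i:=(G_1^A)_i\cap\big(S(F_i)\times_{F_i}U(F_i)\big)$, i.e. the intersection with $\{v_+=0\}$. Equality is equality of analytic subsets. *)

theory Defs
  imports "HOL-Analysis.Analysis"
begin

section \<open>Quotient topologies\<close>

definition quot_topology :: "'a topology \<Rightarrow> ('a \<Rightarrow> 'b) \<Rightarrow> 'b topology" where
  "quot_topology X f =
     topology (\<lambda>U. U \<subseteq> f ` topspace X \<and> openin X {x \<in> topspace X. f x \<in> U})"

lemma openin_quot_topology:
  "openin (quot_topology X f) U \<longleftrightarrow>
     U \<subseteq> f ` topspace X \<and> openin X {x \<in> topspace X. f x \<in> U}"
proof -
  have "istopology (\<lambda>U. U \<subseteq> f ` topspace X \<and> openin X {x \<in> topspace X. f x \<in> U})"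
    unfolding istopology_def
  proof (intro conjI allI impI)
    fix S T
    assume S: "S \<subseteq> f ` topspace X \<and> openin X {x \<in> topspace X. f x \<in> S}"
      and T: "T \<subseteq> f ` topspace X \<and> openin X {x \<in> topspace X. f x \<in> T}"
    then show "S \<inter> T \<subseteq> f ` topspace X" by blast
    have "{x \<in> topspace X. f x \<in> S \<inter> T} =
        {x \<in> topspace X. f x \<in> S} \<inter> {x \<in> topspace X. f x \<in> T}" by blast
    then show "openin X {x \<in> topspace X. f x \<in> S \<inter> T}" using S T by auto
  next
    fix K
    assume K: "\<forall>U\<in>K. U \<subseteq> f ` topspace X \<and> openin X {x \<in> topspace X. f x \<in> U}"
    then show "\<Union>K \<subseteq> f ` topspace X" by blast
    have "{x \<in> topspace X. f x \<in> \<Union>K} = \<Union>((\<lambda>U. {x \<in> topspace X. f x \<in> U}) ` K)" by blast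
    then show "openin X {x \<in> topspace X. f x \<in> \<Union>K}" using K by auto
  qed
  then show ?thesis by (simp add: quot_topology_def)
qed

section \<open>Complex manifolds\<close>

text \<open>Differentiability with complex linear derivative.\<close>
definition holo_Cn :: "(complex ^ 'n \<Rightarrow> complex) \<Rightarrow> (complex ^ 'n) set \<Rightarrow> bool" where
  "holo_Cn f U \<longleftrightarrow> open U \<and>
     (\<forall>x\<in>U. \<exists>D. (f has_derivative D) (at x) \<and> (\<forall>c v. D (c *s v) = c * D v))"

type_synonym ('m, 'n) atlas = "('m set \<times> ('m \<Rightarrow> complex ^ 'n)) set"

definition complex_manifold :: "'m topology \<Rightarrow> ('m, 'n::finite) atlas \<Rightarrow> bool" where
  "complex_manifold M \<A> \<longleftrightarrow>
     Hausdorff_space M \<and> second_countable M \<and>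
     topspace M = (\<Union>(U, \<phi>)\<in>\<A>. U) \<and>
     (\<forall>(U, \<phi>)\<in>\<A>. openin M U \<and> open (\<phi> ` U) \<and>
        homeomorphic_map (subtopology M U) (top_of_set (\<phi> ` U)) \<phi>) \<and>
     (\<forall>(U, \<phi>)\<in>\<A>. \<forall>(V, \<psi>)\<in>\<A>. \<forall>a.
        holo_Cn (\<lambda>x. \<psi> (inv_into U \<phi> x) $ a) (\<phi> ` (U \<inter> V)))"

definition holo_on :: "'m topology \<Rightarrow> ('m, 'n::finite) atlas \<Rightarrow> ('m \<Rightarrow> complex) \<Rightarrow> 'm set \<Rightarrow> bool" where
  "holo_on M \<A> f W \<longleftrightarrow> openin M W \<and>
     (\<forall>(U, \<phi>)\<in>\<A>. holo_Cn (\<lambda>x. f (inv_into U \<phi> x)) (\<phi> ` (U \<inter> W)))"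

section \<open>Holomorphic vector bundles\<close>

text \<open>A local trivialization \<open>(U, h)\<close> consists of an open subset of the base and the fibre
  coordinates \<open>h e \<in> \<complex>\<^sup>r\<close> of the points \<open>e\<close> over \<open>U\<close>; \<open>\<complex>\<^sup>r\<close> is represented by
  the functions with domain \<open>{..<r}\<close> (extended by \<open>undefined\<close>).\<close>
record ('m, 'e) vbundle =
  tot :: "'e topology"
  prj :: "'e \<Rightarrow> 'm"
  fadd :: "'e \<Rightarrow> 'e \<Rightarrow> 'e"
  smult :: "complex \<Rightarrow> 'e \<Rightarrow> 'e"
  zer :: "'m \<Rightarrow> 'e"
  rank :: nat
  trivs :: "('m set \<times> ('e \<Rightarrow> nat \<Rightarrow> complex)) set"

definition Cpow :: "nat \<Rightarrow> (nat \<Rightarrow> complex) topology" where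
  "Cpow r = product_topology (\<lambda>_. euclidean) {..<r}"

definition fibre :: "('m, 'e) vbundle \<Rightarrow> 'm \<Rightarrow> 'e set" where
  "fibre B m = {e \<in> topspace (tot B). prj B e = m}"

text \<open>The vector space axioms in the fibres need not be listed: they follow from the
  trivializations being bijective and linear on every fibre.\<close>
definition holomorphic_bundle ::
    "'m topology \<Rightarrow> ('m, 'n::finite) atlas \<Rightarrow> ('m, 'e) vbundle \<Rightarrow> bool" where
  "holomorphic_bundle M \<A> B \<longleftrightarrow>
     continuous_map (tot B) M (prj B) \<and>
     (\<forall>m\<in>topspace M. zer B m \<in> fibre B m \<and>
        (\<forall>x\<in>fibre B m. (\<forall>y\<in>fibre B m. fadd B x y \<in> fibre B m) \<and>
                          (\<forall>c. smult B c x \<in> fibre B m))) \<and>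
     topspace M = (\<Union>(U, h)\<in>trivs B. U) \<and>
     (\<forall>(U, h)\<in>trivs B.
        openin M U \<and>
        homeomorphic_map (subtopology (tot B) {e. prj B e \<in> U})
          (prod_topology (subtopology M U) (Cpow (rank B))) (\<lambda>e. (prj B e, h e)) \<and>
        (\<forall>m\<in>U. \<forall>p<rank B. h (zer B m) p = 0 \<and>
           (\<forall>x\<in>fibre B m. (\<forall>y\<in>fibre B m. h (fadd B x y) p = h x p + h y p) \<and>
                             (\<forall>c. h (smult B c x) p = c * h x p)))) \<and>
     (\<forall>(U, h)\<in>trivs B. \<forall>(V, h')\<in>trivs B. \<exists>g.
        (\<forall>p<rank B. \<forall>q<rank B. holo_on M \<A> (g p q) (U \<inter> V)) \<and>
        (\<forall>m\<in>U \<inter> V. \<forall>e\<in>fibre B m. \<forall>p<rank B.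
           h' e p = (\<Sum>q<rank B. g p q m * h e q)))"

section \<open>Direct sums and their projectivization\<close>

text \<open>The bundles \<open>E j\<close> share one type of points, but may have different total spaces and ranks.
  For a family \<open>E 0, \<dots>, E k\<close> of bundles, a vector of \<open>E\<^sub>0 \<oplus> \<dots> \<oplus> E\<^sub>k\<close> over \<open>m\<close> is a
  function with domain \<open>{..k}\<close> whose value at \<open>j\<close> lies in the fibre of \<open>E j\<close> over \<open>m\<close>.
  Partial sums of the \<open>E j\<close> are identified with subsets of the full sum.\<close>
definition sum_tot :: "(nat \<Rightarrow> ('m, 'e) vbundle) \<Rightarrow> nat \<Rightarrow> (nat \<Rightarrow> 'e) topology" where
  "sum_tot E k = subtopology (product_topology (\<lambda>j. tot (E j)) {..k})
                   {v. \<exists>m. \<forall>j\<le>k. prj (E j) (v j) = m}"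

definition vbase :: "(nat \<Rightarrow> ('m, 'e) vbundle) \<Rightarrow> (nat \<Rightarrow> 'e) \<Rightarrow> 'm" where
  "vbase E v = prj (E 0) (v 0)"

definition vadd ::
    "(nat \<Rightarrow> ('m, 'e) vbundle) \<Rightarrow> nat \<Rightarrow> (nat \<Rightarrow> 'e) \<Rightarrow> (nat \<Rightarrow> 'e) \<Rightarrow> (nat \<Rightarrow> 'e)" where
  "vadd E k v w = (\<lambda>j\<in>{..k}. fadd (E j) (v j) (w j))"

definition vscale ::
    "(nat \<Rightarrow> ('m, 'e) vbundle) \<Rightarrow> nat \<Rightarrow> complex \<Rightarrow> (nat \<Rightarrow> 'e) \<Rightarrow> (nat \<Rightarrow> 'e)" where
  "vscale E k c v = (\<lambda>j\<in>{..k}. smult (E j) c (v j))"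

definition vsupp :: "(nat \<Rightarrow> ('m, 'e) vbundle) \<Rightarrow> nat \<Rightarrow> (nat \<Rightarrow> 'e) \<Rightarrow> nat set" where
  "vsupp E k v = {j. j \<le> k \<and> v j \<noteq> zer (E j) (vbase E v)}"

definition line :: "(nat \<Rightarrow> ('m, 'e) vbundle) \<Rightarrow> nat \<Rightarrow> (nat \<Rightarrow> 'e) \<Rightarrow> (nat \<Rightarrow> 'e) set" where
  "line E k v = range (\<lambda>c. vscale E k c v)"

definition PE :: "(nat \<Rightarrow> ('m, 'e) vbundle) \<Rightarrow> nat \<Rightarrow> (nat \<Rightarrow> 'e) set topology" where
  "PE E k = quot_topology (subtopology (sum_tot E k) {v. vsupp E k v \<noteq> {}}) (line E k)"

text \<open>The projective subbundle of the partial sum of the \<open>E j\<close>, \<open>j \<in> J\<close>.\<close>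
definition Psub :: "(nat \<Rightarrow> ('m, 'e) vbundle) \<Rightarrow> nat \<Rightarrow> nat set \<Rightarrow> (nat \<Rightarrow> 'e) set set" where
  "Psub E k J = line E k ` {v \<in> topspace (sum_tot E k). vsupp E k v \<noteq> {} \<and> vsupp E k v \<subseteq> J}"

definition pbase :: "(nat \<Rightarrow> ('m, 'e) vbundle) \<Rightarrow> (nat \<Rightarrow> 'e) set \<Rightarrow> 'm" where
  "pbase E x = the_elem (vbase E ` x)"

text \<open>\<open>\<P>(E) \<times>\<^sub>M \<P>(E)\<close>\<close>
definition PP :: "(nat \<Rightarrow> ('m, 'e) vbundle) \<Rightarrow> nat \<Rightarrow>
    ((nat \<Rightarrow> 'e) set \<times> (nat \<Rightarrow> 'e) set) topology" where
  "PP E k = subtopology (prod_topology (PE E k) (PE E k)) {(x, y). pbase E x = pbase E y}"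

text \<open>The two last conditions say that \<open>s\<close> is holomorphic in the affine charts of \<open>\<P>(E)\<close>:
  in the coordinates given by trivializations \<open>T j\<close> of the \<open>E j\<close>, the function \<open>f\<close> is the
  quotient of the homogeneous coordinate \<open>(a, p)\<close> of \<open>s\<close> by the coordinate \<open>(b, q)\<close>, on the
  set \<open>D\<close> where the latter does not vanish.\<close>
definition holomorphic_section ::
    "'m topology \<Rightarrow> ('m, 'n::finite) atlas \<Rightarrow> (nat \<Rightarrow> ('m, 'e) vbundle) \<Rightarrow> nat \<Rightarrow>
     ('m \<Rightarrow> (nat \<Rightarrow> 'e) set) \<Rightarrow> bool" where
  "holomorphic_section M \<A> E k s \<longleftrightarrow>
     continuous_map M (PE E k) s \<and>
     (\<forall>m\<in>topspace M. pbase E (s m) = m) \<and>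
     (\<forall>T. (\<forall>j\<le>k. T j \<in> trivs (E j)) \<longrightarrow>
        (\<forall>b\<le>k. \<forall>q<rank (E b).
           let D = {m \<in> topspace M. (\<forall>j\<le>k. m \<in> fst (T j)) \<and>
                                    (\<exists>v\<in>s m. snd (T b) (v b) q \<noteq> 0)}
           in \<forall>a\<le>k. \<forall>p<rank (E a). \<exists>f. holo_on M \<A> f D \<and>
                (\<forall>m\<in>D. \<forall>v\<in>s m. snd (T a) (v a) p = f m * snd (T b) (v b) q)))"

section \<open>The weighted action and its stable and unstable manifolds\<close>

definition vact :: "(nat \<Rightarrow> ('m, 'e) vbundle) \<Rightarrow> nat \<Rightarrow> (nat \<Rightarrow> int) \<Rightarrow>
    complex \<Rightarrow> (nat \<Rightarrow> 'e) \<Rightarrow> (nat \<Rightarrow> 'e)" where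
  "vact E k \<beta> c v = (\<lambda>j\<in>{..k}. smult (E j) (c powi \<beta> j) (v j))"

definition pact :: "(nat \<Rightarrow> ('m, 'e) vbundle) \<Rightarrow> nat \<Rightarrow> (nat \<Rightarrow> int) \<Rightarrow>
    complex \<Rightarrow> (nat \<Rightarrow> 'e) set \<Rightarrow> (nat \<Rightarrow> 'e) set" where
  "pact E k \<beta> c x = vact E k \<beta> c ` x"

definition lim_infty :: "(nat \<Rightarrow> ('m, 'e) vbundle) \<Rightarrow> nat \<Rightarrow> (nat \<Rightarrow> int) \<Rightarrow>
    (nat \<Rightarrow> 'e) set \<Rightarrow> (nat \<Rightarrow> 'e) set \<Rightarrow> bool" where
  "lim_infty E k \<beta> x z \<longleftrightarrow> limitin (PE E k) (\<lambda>c. pact E k \<beta> c x) z at_infinity"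

definition lim_zero :: "(nat \<Rightarrow> ('m, 'e) vbundle) \<Rightarrow> nat \<Rightarrow> (nat \<Rightarrow> int) \<Rightarrow>
    (nat \<Rightarrow> 'e) set \<Rightarrow> (nat \<Rightarrow> 'e) set \<Rightarrow> bool" where
  "lim_zero E k \<beta> x z \<longleftrightarrow> limitin (PE E k) (\<lambda>c. pact E k \<beta> c x) z (at 0)"

definition stable :: "(nat \<Rightarrow> ('m, 'e) vbundle) \<Rightarrow> nat \<Rightarrow> (nat \<Rightarrow> int) \<Rightarrow> nat \<Rightarrow>
    (nat \<Rightarrow> 'e) set set" where
  "stable E k \<beta> i = {x \<in> topspace (PE E k). \<exists>z\<in>Psub E k {i}. lim_infty E k \<beta> x z}"

definition unstable :: "(nat \<Rightarrow> ('m, 'e) vbundle) \<Rightarrow> nat \<Rightarrow> (nat \<Rightarrow> int) \<Rightarrow> nat \<Rightarrow>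
    (nat \<Rightarrow> 'e) set set" where
  "unstable E k \<beta> i = {y \<in> topspace (PE E k). \<exists>z\<in>Psub E k {i}. lim_zero E k \<beta> y z}"

text \<open>\<open>S(F\<^sub>i) \<times>\<^bsub>F\<^sub>i\<^esub> U(F\<^sub>i)\<close>; the projections to \<open>F\<^sub>i\<close> are the limits.\<close>
definition SU :: "(nat \<Rightarrow> ('m, 'e) vbundle) \<Rightarrow> nat \<Rightarrow> (nat \<Rightarrow> int) \<Rightarrow> nat \<Rightarrow>
    ((nat \<Rightarrow> 'e) set \<times> (nat \<Rightarrow> 'e) set) set" where
  "SU E k \<beta> i = {(x, y) \<in> stable E k \<beta> i \<times> unstable E k \<beta> i.
     \<exists>z\<in>Psub E k {i}. lim_infty E k \<beta> x z \<and> lim_zero E k \<beta> y z}"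

definition C_infty :: "(nat \<Rightarrow> ('m, 'e) vbundle) \<Rightarrow> nat \<Rightarrow> (nat \<Rightarrow> int) \<Rightarrow> nat \<Rightarrow>
    ((nat \<Rightarrow> 'e) set \<times> (nat \<Rightarrow> 'e) set) set" where
  "C_infty E k \<beta> i = PP E k closure_of SU E k \<beta> i"

section \<open>The strict transform\<close>

text \<open>\<open>p1 \<mu> l\<close> is the point \<open>[\<mu> : l]\<close> of the projective line.\<close>
definition p1 :: "complex \<Rightarrow> complex \<Rightarrow> (complex \<times> complex) set" where
  "p1 \<mu> l = range (\<lambda>c. (c * \<mu>, c * l))"

definition P1 :: "(complex \<times> complex) set topology" where
  "P1 = quot_topology (top_of_set (UNIV - {(0, 0)})) (\<lambda>(\<mu>, l). p1 \<mu> l)"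

text \<open>The closure of the graph of the action over \<open>[1 : l]\<close>, \<open>l \<noteq> 0\<close>, restricted to the
  image of \<open>s\<close>. This is the strict transform of \<open>\<P>\<^sup>1 \<times> s(M)\<close> under the blow-up along the
  ideal generated by the \<open>\<mu>^(\<beta> k - \<beta> j) l^(\<beta> j) w\<^sub>j\<close>, since for \<open>\<mu>, l \<noteq> 0\<close> the point
  with these homogeneous coordinates is \<open>(l / \<mu>) * w\<close>.\<close>
definition strict_transform :: "'m topology \<Rightarrow> (nat \<Rightarrow> ('m, 'e) vbundle) \<Rightarrow> nat \<Rightarrow>
    (nat \<Rightarrow> int) \<Rightarrow> ('m \<Rightarrow> (nat \<Rightarrow> 'e) set) \<Rightarrow>
    ((complex \<times> complex) set \<times> (nat \<Rightarrow> 'e) set \<times> (nat \<Rightarrow> 'e) set) set" where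
  "strict_transform M E k \<beta> s =
     prod_topology P1 (PP E k) closure_of
       {(p1 1 l, s m, pact E k \<beta> l (s m)) | l m. l \<noteq> 0 \<and> m \<in> topspace M}"

definition S_infty :: "'m topology \<Rightarrow> (nat \<Rightarrow> ('m, 'e) vbundle) \<Rightarrow> nat \<Rightarrow>
    (nat \<Rightarrow> int) \<Rightarrow> ('m \<Rightarrow> (nat \<Rightarrow> 'e) set) \<Rightarrow> nat \<Rightarrow>
    ((nat \<Rightarrow> 'e) set \<times> (nat \<Rightarrow> 'e) set) set" where
  "S_infty M E k \<beta> s i =
     snd ` (({p1 0 1} \<times> C_infty E k \<beta> i) \<inter> strict_transform M E k \<beta> s)"

section \<open>The chart around \<open>F\<^sub>i\<close> and the affine cone\<close>

text \<open>A point of \<open>Hom(\<tau>\<^sub>i, \<pi>\<^sub>i\<^sup>*E\<^sub>J)\<close> is a pair of a line in \<open>E\<^sub>i\<close> and a linear map \<open>\<phi>\<close>,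
  with domain this line, to the fibre of the partial sum \<open>E\<^sub>J\<close> over the same point of \<open>M\<close>.
  It is determined by \<open>u\<close> and \<open>a = \<phi> u\<close>, for any nonzero \<open>u\<close> in the line. This exhibits
  the Hom bundle as the bundle associated with the principal \<open>\<complex>\<^sup>*\<close>-bundle of nonzero
  vectors of \<open>\<tau>\<^sub>i\<close> (i.e. of \<open>E\<^sub>i\<close>), which fixes its topology.\<close>
type_synonym 'e hom = "(nat \<Rightarrow> 'e) set \<times> ((nat \<Rightarrow> 'e) \<Rightarrow> (nat \<Rightarrow> 'e))"

definition hom_of :: "(nat \<Rightarrow> ('m, 'e) vbundle) \<Rightarrow> nat \<Rightarrow> (nat \<Rightarrow> 'e) \<times> (nat \<Rightarrow> 'e) \<Rightarrow> 'e hom" where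
  "hom_of E k = (\<lambda>(u, a). (line E k u,
     \<lambda>x\<in>line E k u. THE b. \<exists>c. x = vscale E k c u \<and> b = vscale E k c a))"

definition Hom :: "(nat \<Rightarrow> ('m, 'e) vbundle) \<Rightarrow> nat \<Rightarrow> nat \<Rightarrow> nat set \<Rightarrow> 'e hom topology" where
  "Hom E k i J =
     quot_topology
       (subtopology (prod_topology (sum_tot E k) (sum_tot E k))
          {(u, a). vbase E u = vbase E a \<and> vsupp E k u = {i} \<and> vsupp E k a \<subseteq> J})
       (hom_of E k)"

abbreviation Eminus :: "(nat \<Rightarrow> ('m, 'e) vbundle) \<Rightarrow> nat \<Rightarrow> nat \<Rightarrow> 'e hom topology" where
  "Eminus E k i \<equiv> Hom E k i {..<i}"

abbreviation Eplus :: "(nat \<Rightarrow> ('m, 'e) vbundle) \<Rightarrow> nat \<Rightarrow> nat \<Rightarrow> 'e hom topology" where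
  "Eplus E k i \<equiv> Hom E k i {i<..k}"

definition hom_zero :: "(nat \<Rightarrow> ('m, 'e) vbundle) \<Rightarrow> nat \<Rightarrow> (nat \<Rightarrow> 'e) set \<Rightarrow> 'e hom" where
  "hom_zero E k x = (x, \<lambda>u\<in>x. vscale E k 0 u)"

definition hom_act :: "(nat \<Rightarrow> ('m, 'e) vbundle) \<Rightarrow> nat \<Rightarrow> (nat \<Rightarrow> int) \<Rightarrow> nat \<Rightarrow>
    complex \<Rightarrow> 'e hom \<Rightarrow> 'e hom" where
  "hom_act E k \<beta> i c g =
     (fst g, \<lambda>u\<in>fst g. \<lambda>j\<in>{..k}. smult (E j) (c powi (\<beta> j - \<beta> i)) (snd g u j))"

text \<open>\<open>E\<^sup>- \<oplus> E\<^sup>+\<close> (fibre product over \<open>\<P>(E\<^sub>i)\<close>)\<close>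
definition Epm :: "(nat \<Rightarrow> ('m, 'e) vbundle) \<Rightarrow> nat \<Rightarrow> nat \<Rightarrow> ('e hom \<times> 'e hom) topology" where
  "Epm E k i = subtopology (prod_topology (Eminus E k i) (Eplus E k i)) {(f, g). fst f = fst g}"

definition graph :: "(nat \<Rightarrow> ('m, 'e) vbundle) \<Rightarrow> nat \<Rightarrow> 'e hom \<times> 'e hom \<Rightarrow> (nat \<Rightarrow> 'e) set" where
  "graph E k = (\<lambda>(f, g). (\<lambda>u. vadd E k u (vadd E k (snd f u) (snd g u))) ` fst f)"

text \<open>\<open>\<P>(E) - \<P>(E'\<^sub>i)\<close>, the image of the chart\<close>
definition chart_dom :: "(nat \<Rightarrow> ('m, 'e) vbundle) \<Rightarrow> nat \<Rightarrow> nat \<Rightarrow> (nat \<Rightarrow> 'e) set set" where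
  "chart_dom E k i = topspace (PE E k) - Psub E k ({..k} - {i})"

definition affine_cone :: "(nat \<Rightarrow> ('m, 'e) vbundle) \<Rightarrow> nat \<Rightarrow> (nat \<Rightarrow> int) \<Rightarrow> nat \<Rightarrow>
    (nat \<Rightarrow> 'e) set set \<Rightarrow> (('e hom \<times> 'e hom) \<times> 'e hom) set" where
  "affine_cone E k \<beta> i A =
     subtopology (prod_topology (Epm E k i) (Eplus E k i)) {((f, g), h). fst g = fst h}
       closure_of {((f, g), hom_act E k \<beta> i c g) | f g c.
                     (f, g) \<in> topspace (Epm E k i) \<and> graph E k (f, g) \<in> A \<and> c \<noteq> 0}"

text \<open>The affine cone viewed in \<open>\<P>(E) \<times>\<^sub>M \<P>(E)\<close> by means of the chart, the third component
  \<open>h\<close> being the point \<open>(0, h)\<close> of \<open>E\<^sup>- \<oplus> E\<^sup>+\<close>.\<close>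
definition G1 :: "(nat \<Rightarrow> ('m, 'e) vbundle) \<Rightarrow> nat \<Rightarrow> (nat \<Rightarrow> int) \<Rightarrow> nat \<Rightarrow>
    (nat \<Rightarrow> 'e) set set \<Rightarrow> ((nat \<Rightarrow> 'e) set \<times> (nat \<Rightarrow> 'e) set) set" where
  "G1 E k \<beta> i A =
     (\<lambda>((f, g), h). (graph E k (f, g), graph E k (hom_zero E k (fst h), h))) `
       affine_cone E k \<beta> i A"

definition EG1 :: "(nat \<Rightarrow> ('m, 'e) vbundle) \<Rightarrow> nat \<Rightarrow> (nat \<Rightarrow> int) \<Rightarrow> nat \<Rightarrow>
    (nat \<Rightarrow> 'e) set set \<Rightarrow> ((nat \<Rightarrow> 'e) set \<times> (nat \<Rightarrow> 'e) set) set" where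
  "EG1 E k \<beta> i A = G1 E k \<beta> i A \<inter> SU E k \<beta> i"

end

theory Submission
  imports Defs
begin

text \<open>
  In the chart around \<open>F\<^sub>i\<close> both sides are limits of triples \<open>(v\<^sub>-, v\<^sub>+, \<lambda> * v\<^sub>+)\<close> with \<open>(v\<^sub>-, v\<^sub>+)\<close> in the
  section and \<open>v\<^sub>+ \<rightarrow> 0\<close>; the strict transform asks in addition that \<open>\<lambda> \<rightarrow> \<infinity>\<close> and that the
  \<open>\<lambda> * v\<^sub>-\<close> tend to \<open>0\<close>. The weights on \<open>v\<^sub>+\<close> are positive and those on \<open>v\<^sub>-\<close> negative, so
  the second condition follows from the first. The first is automatic if \<open>\<lambda> * v\<^sub>+\<close> has a
  nonzero limit, and otherwise \<open>\<lambda>\<close> can be replaced by factors growing so slowly that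
  \<open>\<lambda> * v\<^sub>+\<close> still tends to \<open>0\<close>. The topologies of \<open>\<P>(E)\<close> and of the Hom bundles are handled
  through the slice on which one fibre coordinate equals \<open>1\<close>.
\<close>

section \<open>Coordinates on the direct sum\<close>

lemma prod_topology_nbhd:
  assumes "openin (prod_topology X Y) W" and "(x, y) \<in> W"
  obtains U V where "openin X U" "x \<in> U" "openin Y V" "y \<in> V" "U \<times> V \<subseteq> W"
  using assms unfolding openin_prod_topology_alt by blast

lemma product_topology_nbhd:
  assumes "openin (product_topology X I) W" and "x \<in> W"
  shows "\<exists>D. (\<forall>i\<in>I. openin (X i) (D i)) \<and> x \<in> Pi\<^sub>E I D \<and> Pi\<^sub>E I D \<subseteq> W"
proof -
  from bspec[OF iffD1[OF openin_product_topology_alt assms(1)] assms(2)] obtain D where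
    "\<forall>i\<in>I. openin (X i) (D i)" "x \<in> Pi\<^sub>E I D" "Pi\<^sub>E I D \<subseteq> W"
    by (elim exE conjE) (rule that)
  then show ?thesis by (intro exI conjI)
qed

lemma bundle_triv:
  assumes "holomorphic_bundle M \<A> B" and "(U, h) \<in> trivs B"
  shows bundle_triv_open: "openin M U"
    and bundle_triv_homeo: "homeomorphic_map (subtopology (tot B) {e. prj B e \<in> U})
          (prod_topology (subtopology M U) (Cpow (rank B))) (\<lambda>e. (prj B e, h e))"
    and bundle_triv_zer: "\<And>m p. m \<in> U \<Longrightarrow> p < rank B \<Longrightarrow> h (zer B m) p = 0"
    and bundle_triv_smult: "\<And>m x c p. m \<in> U \<Longrightarrow> x \<in> fibre B m \<Longrightarrow> p < rank B \<Longrightarrow>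
          h (smult B c x) p = c * h x p"
    and bundle_triv_fadd: "\<And>m x y p. m \<in> U \<Longrightarrow> x \<in> fibre B m \<Longrightarrow> y \<in> fibre B m \<Longrightarrow> p < rank B \<Longrightarrow>
          h (fadd B x y) p = h x p + h y p"
proof -
  have "\<forall>(U, h)\<in>trivs B. openin M U \<and>
      homeomorphic_map (subtopology (tot B) {e. prj B e \<in> U})
        (prod_topology (subtopology M U) (Cpow (rank B))) (\<lambda>e. (prj B e, h e)) \<and>
      (\<forall>m\<in>U. \<forall>p<rank B. h (zer B m) p = 0 \<and>
         (\<forall>x\<in>fibre B m. (\<forall>y\<in>fibre B m. h (fadd B x y) p = h x p + h y p) \<and>
                           (\<forall>c. h (smult B c x) p = c * h x p)))"
    using assms(1) unfolding holomorphic_bundle_def by (elim conjE) assumption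
  note * = bspec[OF this assms(2), unfolded prod.case]
  show "openin M U"
    and "homeomorphic_map (subtopology (tot B) {e. prj B e \<in> U})
          (prod_topology (subtopology M U) (Cpow (rank B))) (\<lambda>e. (prj B e, h e))"
    and "\<And>m p. m \<in> U \<Longrightarrow> p < rank B \<Longrightarrow> h (zer B m) p = 0"
    and "\<And>m x c p. m \<in> U \<Longrightarrow> x \<in> fibre B m \<Longrightarrow> p < rank B \<Longrightarrow> h (smult B c x) p = c * h x p"
    and "\<And>m x y p. m \<in> U \<Longrightarrow> x \<in> fibre B m \<Longrightarrow> y \<in> fibre B m \<Longrightarrow> p < rank B \<Longrightarrow>
          h (fadd B x y) p = h x p + h y p"
    using * by blast+
qed

lemma bundle_triv_inj:
  assumes B: "holomorphic_bundle M \<A> B" and T: "(U, h) \<in> trivs B"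
    and m: "m \<in> U" and e: "e \<in> fibre B m" "e' \<in> fibre B m"
    and eq: "\<And>p. p < rank B \<Longrightarrow> h e p = h e' p"
  shows "e = e'"
proof -
  let ?X = "subtopology (tot B) {e. prj B e \<in> U}"
  let ?Y = "prod_topology (subtopology M U) (Cpow (rank B))"
  note hm = bundle_triv_homeo[OF B T]
  have in_X: "e \<in> topspace ?X" "e' \<in> topspace ?X" using e m by (auto simp: fibre_def)
  have "(\<lambda>e. (prj B e, h e)) ` topspace ?X = topspace ?Y"
    using hm by (rule homeomorphic_imp_surjective_map)
  then have "h e \<in> extensional {..<rank B}" "h e' \<in> extensional {..<rank B}"
    using in_X by (auto simp: Cpow_def PiE_def)
  then have "h e = h e'" using eq by (auto intro: extensionalityI)
  moreover have "prj B e = prj B e'" using e by (simp add: fibre_def)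
  moreover have "inj_on (\<lambda>e. (prj B e, h e)) (topspace ?X)"
    using hm by (rule homeomorphic_imp_injective_map)
  ultimately show ?thesis using in_X by (auto dest: inj_onD)
qed

lemma bundle_triv_nbhd:
  assumes B: "holomorphic_bundle M \<A> B" and T: "(U, h) \<in> trivs B"
    and W: "openin (tot B) W" "e \<in> W" and e: "prj B e \<in> U"
  obtains N \<epsilon> where "openin M N" "prj B e \<in> N" "0 < \<epsilon>"
    "\<And>e'. e' \<in> topspace (tot B) \<Longrightarrow> prj B e' \<in> N \<Longrightarrow>
       (\<forall>p<rank B. norm (h e' p - h e p) < \<epsilon>) \<Longrightarrow> e' \<in> W"
proof -
  let ?X = "subtopology (tot B) {e. prj B e \<in> U}"
  let ?Y = "prod_topology (subtopology M U) (Cpow (rank B))"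
  let ?f = "\<lambda>e. (prj B e, h e)"
  note hm = bundle_triv_homeo[OF B T]
  note sur = homeomorphic_imp_surjective_map[OF hm]
  have "openin ?X (W \<inter> {e. prj B e \<in> U})" using W by (simp add: openin_subtopology_Int)
  then have "openin ?Y (?f ` (W \<inter> {e. prj B e \<in> U}))"
    using homeomorphic_imp_open_map[OF hm] by (simp add: open_map_def)
  moreover have "?f e \<in> ?f ` (W \<inter> {e. prj B e \<in> U})" using W e by blast
  ultimately obtain N C where N: "openin (subtopology M U) N" "prj B e \<in> N"
    and C: "openin (Cpow (rank B)) C" "h e \<in> C"
    and sub: "N \<times> C \<subseteq> ?f ` (W \<inter> {e. prj B e \<in> U})"
    by (rule prod_topology_nbhd) (rule that)
  obtain D where D': "\<forall>p\<in>{..<rank B}. openin euclidean (D p)"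
    and D: "h e \<in> Pi\<^sub>E {..<rank B} D" "Pi\<^sub>E {..<rank B} D \<subseteq> C"
    using product_topology_nbhd[OF C[unfolded Cpow_def]] by (elim exE conjE) (rule that)
  have "\<exists>r. \<forall>p<rank B. r p > 0 \<and> (\<forall>z. norm (z - h e p) < r p \<longrightarrow> z \<in> D p)"
  proof -
    have "\<exists>r>0. \<forall>z. norm (z - h e p) < r \<longrightarrow> z \<in> D p" if "p < rank B" for p
    proof -
      have "open (D p)" "h e p \<in> D p" using bspec[OF D', of p] PiE_mem[OF D(1), of p] that by simp_all
      then show ?thesis unfolding open_dist dist_norm by blast
    qed
    then show ?thesis by metis
  qed
  then obtain r where r: "\<And>p. p < rank B \<Longrightarrow> r p > 0"
    "\<And>p z. p < rank B \<Longrightarrow> norm (z - h e p) < r p \<Longrightarrow> z \<in> D p" by blast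
  define \<epsilon> where "\<epsilon> = Min (insert 1 (r ` {..<rank B}))"
  have \<epsilon>: "\<epsilon> > 0" "\<And>p. p < rank B \<Longrightarrow> \<epsilon> \<le> r p" using r(1) by (auto simp: \<epsilon>_def)
  have "openin M N" using N(1) bundle_triv_open[OF B T] by (simp add: openin_open_subtopology)
  moreover have "e' \<in> W" if e': "e' \<in> topspace (tot B)" "prj B e' \<in> N"
    and n: "\<forall>p<rank B. norm (h e' p - h e p) < \<epsilon>" for e'
  proof -
    have U: "prj B e' \<in> U" using e'(2) openin_subset[OF N(1)] by auto
    have X: "e' \<in> topspace ?X" using e' U by simp
    then have "?f e' \<in> topspace ?Y" using sur by blast
    then have "h e' \<in> extensional {..<rank B}" by (simp add: Cpow_def PiE_def)
    then have "h e' \<in> Pi\<^sub>E {..<rank B} D" using n \<epsilon>(2) r(2) by (force simp: PiE_def)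
    then have "?f e' \<in> ?f ` (W \<inter> {e. prj B e \<in> U})" using e'(2) D(2) sub by blast
    then obtain e'' where e'': "e'' \<in> W" "prj B e'' \<in> U" "?f e'' = ?f e'" by force
    moreover have "e'' \<in> topspace ?X" using e'' openin_subset[OF W(1)] by auto
    ultimately have "e'' = e'"
      using X homeomorphic_imp_injective_map[OF hm] by (meson inj_onD)
    then show ?thesis using e'' by simp
  qed
  ultimately show ?thesis using that N(2) \<epsilon>(1) by blast
qed

lemma bundle_triv_continuous:
  assumes B: "holomorphic_bundle M \<A> B" and T: "(U, h) \<in> trivs B" and p: "p < rank B"
  shows "continuous_map (subtopology (tot B) {e. prj B e \<in> U}) euclidean (\<lambda>e. h e p)"
proof -
  let ?X = "subtopology (tot B) {e. prj B e \<in> U}"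
  have "continuous_map ?X (prod_topology (subtopology M U) (Cpow (rank B))) (\<lambda>e. (prj B e, h e))"
    using bundle_triv_homeo[OF B T] by (rule homeomorphic_imp_continuous_map)
  then have "continuous_map ?X (Cpow (rank B)) h"
    using continuous_map_compose[OF _ continuous_map_snd] by (fastforce simp: o_def)
  then show ?thesis unfolding Cpow_def
    using p by (simp add: continuous_map_componentwise)
qed

locale bundle_family =
  fixes M :: "'m topology" and \<A> :: "('m, 'n::finite) atlas"
    and E :: "nat \<Rightarrow> ('m, 'e) vbundle" and k :: nat
  assumes bundles: "j \<le> k \<Longrightarrow> holomorphic_bundle M \<A> (E j)"
begin

abbreviation V where "V \<equiv> topspace (sum_tot E k)"

definition Ix :: "(nat \<times> nat) set" where "Ix = {(j, p). j \<le> k \<and> p < rank (E j)}"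

lemma finite_Ix: "finite Ix"
proof -
  have "Ix = Sigma {..k} (\<lambda>j. {..<rank (E j)})" by (auto simp: Ix_def)
  then show ?thesis by simp
qed

lemma mem_V: "v \<in> V \<longleftrightarrow> v \<in> extensional {..k} \<and> (\<forall>j\<le>k. v j \<in> fibre (E j) (vbase E v))"
  unfolding sum_tot_def vbase_def fibre_def
  by (auto simp: PiE_def Pi_def)

lemma V_eqI: "v \<in> V \<Longrightarrow> w \<in> V \<Longrightarrow> (\<And>j. j \<le> k \<Longrightarrow> v j = w j) \<Longrightarrow> v = w"
  by (auto simp: mem_V intro: extensionalityI)

lemma fibre_closed:
  assumes "j \<le> k" and "m \<in> topspace M"
  shows fibre_zer: "zer (E j) m \<in> fibre (E j) m"
    and fibre_fadd: "\<And>x y. x \<in> fibre (E j) m \<Longrightarrow> y \<in> fibre (E j) m \<Longrightarrow> fadd (E j) x y \<in> fibre (E j) m"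
    and fibre_smult: "\<And>x c. x \<in> fibre (E j) m \<Longrightarrow> smult (E j) c x \<in> fibre (E j) m"
proof -
  have "\<forall>m\<in>topspace M. zer (E j) m \<in> fibre (E j) m \<and>
      (\<forall>x\<in>fibre (E j) m. (\<forall>y\<in>fibre (E j) m. fadd (E j) x y \<in> fibre (E j) m) \<and>
        (\<forall>c. smult (E j) c x \<in> fibre (E j) m))"
    using bundles[OF assms(1)] unfolding holomorphic_bundle_def by (elim conjE) assumption
  note * = bspec[OF this assms(2)]
  show "zer (E j) m \<in> fibre (E j) m"
    and "\<And>x y. x \<in> fibre (E j) m \<Longrightarrow> y \<in> fibre (E j) m \<Longrightarrow> fadd (E j) x y \<in> fibre (E j) m"
    and "\<And>x c. x \<in> fibre (E j) m \<Longrightarrow> smult (E j) c x \<in> fibre (E j) m"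
    using * by blast+
qed

lemma vbase_in_M: "v \<in> V \<Longrightarrow> vbase E v \<in> topspace M"
proof -
  assume "v \<in> V"
  then have "v 0 \<in> topspace (tot (E 0))" by (auto simp: mem_V fibre_def)
  moreover have "continuous_map (tot (E 0)) M (prj (E 0))"
    using bundles[of 0] by (simp add: holomorphic_bundle_def)
  ultimately show ?thesis by (auto simp: vbase_def continuous_map_def)
qed

lemma fam_in_V:
  assumes "\<And>j. j \<le> k \<Longrightarrow> f j \<in> fibre (E j) m"
  shows "(\<lambda>j\<in>{..k}. f j) \<in> V" and "vbase E (\<lambda>j\<in>{..k}. f j) = m"
proof -
  show b: "vbase E (\<lambda>j\<in>{..k}. f j) = m" using assms[of 0] by (simp add: vbase_def fibre_def)
  show "(\<lambda>j\<in>{..k}. f j) \<in> V" unfolding mem_V b using assms by auto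
qed

lemma V_fibre: "v \<in> V \<Longrightarrow> j \<le> k \<Longrightarrow> v j \<in> fibre (E j) (vbase E v)"
  by (simp add: mem_V)

lemma vscale_V [simp]: assumes "v \<in> V"
  shows "vscale E k c v \<in> V" and "vbase E (vscale E k c v) = vbase E v"
  unfolding vscale_def using assms vbase_in_M
  by (auto intro!: fam_in_V fibre_smult V_fibre)

lemma vact_V [simp]: assumes "v \<in> V"
  shows "vact E k \<beta> c v \<in> V" and "vbase E (vact E k \<beta> c v) = vbase E v"
  unfolding vact_def using assms vbase_in_M
  by (auto intro!: fam_in_V fibre_smult V_fibre)

lemma vadd_V [simp]: assumes "v \<in> V" "w \<in> V" "vbase E w = vbase E v"
  shows "vadd E k v w \<in> V" and "vbase E (vadd E k v w) = vbase E v"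
proof -
  have "w j \<in> fibre (E j) (vbase E v)" if "j \<le> k" for j using assms that by (metis V_fibre)
  then show "vadd E k v w \<in> V" and "vbase E (vadd E k v w) = vbase E v"
    unfolding vadd_def using assms vbase_in_M
    by (auto intro!: fam_in_V fibre_fadd V_fibre)
qed

definition part :: "nat set \<Rightarrow> (nat \<Rightarrow> 'e) \<Rightarrow> nat \<Rightarrow> 'e" where
  "part J v = (\<lambda>j\<in>{..k}. if j \<in> J then v j else zer (E j) (vbase E v))"

lemma part_V [simp]: assumes "v \<in> V"
  shows "part J v \<in> V" and "vbase E (part J v) = vbase E v"
  unfolding part_def using assms vbase_in_M
  by (auto intro!: fam_in_V fibre_zer V_fibre)

definition Tr :: "(nat \<Rightarrow> 'm set \<times> ('e \<Rightarrow> nat \<Rightarrow> complex)) \<Rightarrow> 'm set" where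
  "Tr T = {m \<in> topspace M. \<forall>j\<le>k. T j \<in> trivs (E j) \<and> m \<in> fst (T j)}"

definition co :: "(nat \<Rightarrow> 'm set \<times> ('e \<Rightarrow> nat \<Rightarrow> complex)) \<Rightarrow> nat \<times> nat \<Rightarrow> (nat \<Rightarrow> 'e) \<Rightarrow> complex" where
  "co T q v = snd (T (fst q)) (v (fst q)) (snd q)"

lemma Tr_obtain: assumes "m \<in> topspace M" obtains T where "m \<in> Tr T"
proof -
  have "\<exists>t. t \<in> trivs (E j) \<and> m \<in> fst t" if "j \<le> k" for j
  proof -
    have "topspace M = (\<Union>(U, h)\<in>trivs (E j). U)"
      using bundles[OF that] unfolding holomorphic_bundle_def by (elim conjE) assumption
    then show ?thesis using assms by fastforce
  qed
  then obtain T where "\<And>j. j \<le> k \<Longrightarrow> T j \<in> trivs (E j) \<and> m \<in> fst (T j)" by metis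
  then show ?thesis using assms that by (auto simp: Tr_def)
qed

lemma openin_Tr: "openin M (Tr T)"
proof (cases "\<forall>j\<le>k. T j \<in> trivs (E j)")
  case True
  have "Tr T = topspace M \<inter> (\<Inter>j\<in>{..k}. fst (T j))" using True by (auto simp: Tr_def)
  moreover have "openin M (fst (T j))" if "j \<le> k" for j
    using bundle_triv_open[OF bundles[OF that], of "fst (T j)" "snd (T j)"] True that by simp
  then have "openin M (\<Inter>j\<in>{..k}. fst (T j))" by (intro openin_Inter) auto
  ultimately show ?thesis by auto
next
  case False
  then have "Tr T = {}" by (auto simp: Tr_def)
  then show ?thesis by simp
qed

lemma Tr_triv: "m \<in> Tr T \<Longrightarrow> j \<le> k \<Longrightarrow> (fst (T j), snd (T j)) \<in> trivs (E j) \<and> m \<in> fst (T j)"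
  by (simp add: Tr_def)

lemma co_vscale:
  assumes "v \<in> V" "vbase E v \<in> Tr T" "q \<in> Ix"
  shows "co T q (vscale E k c v) = c * co T q v"
proof -
  obtain j p where q: "q = (j, p)" "j \<le> k" "p < rank (E j)" using assms(3) by (auto simp: Ix_def)
  show ?thesis
    using bundle_triv_smult[OF bundles[OF q(2)] conjunct1[OF Tr_triv[OF assms(2) q(2)]]
        conjunct2[OF Tr_triv[OF assms(2) q(2)]] V_fibre[OF assms(1) q(2)] q(3)] q
    by (simp add: co_def vscale_def)
qed

lemma co_vact:
  assumes "v \<in> V" "vbase E v \<in> Tr T" "q \<in> Ix"
  shows "co T q (vact E k \<beta> c v) = c powi \<beta> (fst q) * co T q v"
proof -
  obtain j p where q: "q = (j, p)" "j \<le> k" "p < rank (E j)" using assms(3) by (auto simp: Ix_def)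
  show ?thesis
    using bundle_triv_smult[OF bundles[OF q(2)] conjunct1[OF Tr_triv[OF assms(2) q(2)]]
        conjunct2[OF Tr_triv[OF assms(2) q(2)]] V_fibre[OF assms(1) q(2)] q(3)] q
    by (simp add: co_def vact_def)
qed

lemma co_vadd:
  assumes "v \<in> V" "w \<in> V" "vbase E w = vbase E v" "vbase E v \<in> Tr T" "q \<in> Ix"
  shows "co T q (vadd E k v w) = co T q v + co T q w"
proof -
  obtain j p where q: "q = (j, p)" "j \<le> k" "p < rank (E j)" using assms(5) by (auto simp: Ix_def)
  show ?thesis
    using bundle_triv_fadd[OF bundles[OF q(2)] conjunct1[OF Tr_triv[OF assms(4) q(2)]]
        conjunct2[OF Tr_triv[OF assms(4) q(2)]] V_fibre[OF assms(1) q(2)]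
        V_fibre[OF assms(2) q(2), unfolded assms(3)] q(3)] q
    by (simp add: co_def vadd_def)
qed

lemma co_part:
  assumes "v \<in> V" "vbase E v \<in> Tr T" "q \<in> Ix"
  shows "co T q (part J v) = (if fst q \<in> J then co T q v else 0)"
proof -
  obtain j p where q: "q = (j, p)" "j \<le> k" "p < rank (E j)" using assms(3) by (auto simp: Ix_def)
  show ?thesis
    using bundle_triv_zer[OF bundles[OF q(2)] conjunct1[OF Tr_triv[OF assms(2) q(2)]]
        conjunct2[OF Tr_triv[OF assms(2) q(2)]] q(3)] q
    by (simp add: co_def part_def)
qed

lemma comp_eq_iff:
  assumes "v \<in> V" "w \<in> V" "vbase E w = vbase E v" "vbase E v \<in> Tr T" "j \<le> k"
  shows "v j = w j \<longleftrightarrow> (\<forall>p<rank (E j). co T (j, p) v = co T (j, p) w)"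
proof
  assume r: "\<forall>p<rank (E j). co T (j, p) v = co T (j, p) w"
  have "w j \<in> fibre (E j) (vbase E v)" using assms by (metis V_fibre)
  then show "v j = w j"
    using bundle_triv_inj[OF bundles[OF assms(5)] conjunct1[OF Tr_triv[OF assms(4,5)]]
        conjunct2[OF Tr_triv[OF assms(4,5)]] V_fibre[OF assms(1,5)]] r
    by (simp add: co_def)
qed (auto simp: co_def)

lemma co_eqI:
  assumes "v \<in> V" "w \<in> V" "vbase E w = vbase E v" "vbase E v \<in> Tr T"
    and "\<And>q. q \<in> Ix \<Longrightarrow> co T q v = co T q w"
  shows "v = w"
  using assms comp_eq_iff by (intro V_eqI) (auto simp: Ix_def)

lemma mem_vsupp_iff:
  assumes "v \<in> V" "vbase E v \<in> Tr T"
  shows "j \<in> vsupp E k v \<longleftrightarrow> j \<le> k \<and> (\<exists>p<rank (E j). co T (j, p) v \<noteq> 0)"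
proof (cases "j \<le> k")
  case True
  have "part {} v j = zer (E j) (vbase E v)" using True by (simp add: part_def)
  then show ?thesis
    using comp_eq_iff[of v "part {} v" T j] assms True
    by (auto simp: vsupp_def co_part Ix_def)
qed (auto simp: vsupp_def)

lemma co_zero: "v \<in> V \<Longrightarrow> vbase E v \<in> Tr T \<Longrightarrow> q \<in> Ix \<Longrightarrow> fst q \<notin> vsupp E k v \<Longrightarrow> co T q v = 0"
  by (cases q) (auto simp: mem_vsupp_iff Ix_def)

lemma continuous_map_vbase: "continuous_map (sum_tot E k) M (vbase E)"
proof -
  have "continuous_map (tot (E 0)) M (prj (E 0))"
    using bundles[of 0] by (simp add: holomorphic_bundle_def)
  moreover have "continuous_map (product_topology (\<lambda>j. tot (E j)) {..k}) (tot (E 0)) (\<lambda>v. v 0)"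
    by (rule continuous_map_product_projection) simp
  ultimately have "continuous_map (product_topology (\<lambda>j. tot (E j)) {..k}) M (prj (E 0) \<circ> (\<lambda>v. v 0))"
    by (metis continuous_map_compose)
  then show ?thesis unfolding sum_tot_def vbase_def o_def by (rule continuous_map_from_subtopology)
qed

lemma continuous_map_co:
  assumes q: "q \<in> Ix" and S: "S \<subseteq> {v. vbase E v \<in> Tr T}"
  shows "continuous_map (subtopology (sum_tot E k) S) euclidean (co T q)"
proof (cases "\<exists>m. m \<in> Tr T")
  case True
  obtain j p where jp: "q = (j, p)" "j \<le> k" "p < rank (E j)" using q by (auto simp: Ix_def)
  from True have T: "(fst (T j), snd (T j)) \<in> trivs (E j)" using jp Tr_triv by blast
  have "continuous_map (product_topology (\<lambda>j. tot (E j)) {..k}) (tot (E j)) (\<lambda>v. v j)"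
    using jp by (intro continuous_map_product_projection) simp
  then have "continuous_map (sum_tot E k) (tot (E j)) (\<lambda>v. v j)"
    unfolding sum_tot_def by (rule continuous_map_from_subtopology)
  then have 1: "continuous_map (subtopology (sum_tot E k) S) (tot (E j)) (\<lambda>v. v j)"
    by (rule continuous_map_from_subtopology)
  have "prj (E j) (v j) \<in> fst (T j)" if "v \<in> V" "v \<in> S" for v
    using V_fibre[OF that(1) jp(2)] S that Tr_triv[of "vbase E v" T j] jp by (auto simp: fibre_def)
  then have "continuous_map (subtopology (sum_tot E k) S)
      (subtopology (tot (E j)) {e. prj (E j) e \<in> fst (T j)}) (\<lambda>v. v j)"
    using 1 by (auto simp: continuous_map_in_subtopology)
  from continuous_map_compose[OF this bundle_triv_continuous[OF bundles[OF jp(2)] T jp(3)]]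
  show ?thesis by (simp add: jp co_def[abs_def] o_def)
next
  case False
  then have "topspace (subtopology (sum_tot E k) S) = {}" using S by auto
  then show ?thesis by (simp add: continuous_map_def)
qed

lemma V_nbhd:
  assumes W: "openin (sum_tot E k) W" "v \<in> W" and T: "vbase E v \<in> Tr T"
  obtains N \<epsilon> where "openin M N" "vbase E v \<in> N" "N \<subseteq> Tr T" "0 < \<epsilon>"
    "\<And>w. w \<in> V \<Longrightarrow> vbase E w \<in> N \<Longrightarrow> \<forall>q\<in>Ix. norm (co T q w - co T q v) < \<epsilon> \<Longrightarrow> w \<in> W"
proof -
  have vV: "v \<in> V" using W openin_subset by blast
  obtain W' where W': "openin (product_topology (\<lambda>j. tot (E j)) {..k}) W'"
    and WW: "W = W' \<inter> {v. \<exists>m. \<forall>j\<le>k. prj (E j) (v j) = m}"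
    using W(1) by (auto simp: sum_tot_def openin_subtopology)
  have "v \<in> W'" using W(2) WW by blast
  from product_topology_nbhd[OF W' this] obtain D where D': "\<forall>j\<in>{..k}. openin (tot (E j)) (D j)"
    and D: "v \<in> Pi\<^sub>E {..k} D" "Pi\<^sub>E {..k} D \<subseteq> W'" by (elim exE conjE) (rule that)
  have "\<exists>N \<epsilon>. openin M N \<and> vbase E v \<in> N \<and> \<epsilon> > 0 \<and>
      (\<forall>e. e \<in> topspace (tot (E j)) \<longrightarrow> prj (E j) e \<in> N \<longrightarrow>
         (\<forall>p<rank (E j). norm (snd (T j) e p - snd (T j) (v j) p) < \<epsilon>) \<longrightarrow> e \<in> D j)" if j: "j \<le> k" for j
  proof -
    have b: "prj (E j) (v j) = vbase E v" using V_fibre[OF vV j] by (simp add: fibre_def)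
    then have "prj (E j) (v j) \<in> fst (T j)" "(fst (T j), snd (T j)) \<in> trivs (E j)" "v j \<in> D j"
      using Tr_triv[OF T j] D(1) j by auto
    from bundle_triv_nbhd[OF bundles[OF j] this(2) _ this(3,1)] D' j
    obtain N \<epsilon> where "openin M N" "prj (E j) (v j) \<in> N" "0 < \<epsilon>"
      "\<And>e'. e' \<in> topspace (tot (E j)) \<Longrightarrow> prj (E j) e' \<in> N \<Longrightarrow>
         \<forall>p<rank (E j). norm (snd (T j) e' p - snd (T j) (v j) p) < \<epsilon> \<Longrightarrow> e' \<in> D j"
      by (metis atMost_iff)
    then show ?thesis unfolding b by blast
  qed
  then obtain N \<epsilon> where N: "\<And>j. j \<le> k \<Longrightarrow> openin M (N j) \<and> vbase E v \<in> N j \<and> \<epsilon> j > (0::real)"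
    "\<And>j e. j \<le> k \<Longrightarrow> e \<in> topspace (tot (E j)) \<Longrightarrow> prj (E j) e \<in> N j \<Longrightarrow>
       (\<forall>p<rank (E j). norm (snd (T j) e p - snd (T j) (v j) p) < \<epsilon> j) \<Longrightarrow> e \<in> D j" by metis
  define N' where "N' = Tr T \<inter> (\<Inter>j\<in>{..k}. N j)"
  define \<epsilon>' where "\<epsilon>' = Min (\<epsilon> ` {..k})"
  have "openin M (\<Inter>j\<in>{..k}. N j)" using N(1) by (intro openin_Inter) auto
  then have "openin M N'" using openin_Tr by (auto simp: N'_def)
  moreover have "vbase E v \<in> N'" using N(1) T by (auto simp: N'_def)
  moreover have "0 < \<epsilon>'" using N(1) by (auto simp: \<epsilon>'_def)
  moreover have "w \<in> W" if w: "w \<in> V" "vbase E w \<in> N'"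
    and n: "\<forall>q\<in>Ix. norm (co T q w - co T q v) < \<epsilon>'" for w
  proof -
    have "w j \<in> D j" if j: "j \<le> k" for j
    proof (rule N(2)[OF j])
      show "w j \<in> topspace (tot (E j))" "prj (E j) (w j) \<in> N j"
        using V_fibre[OF w(1) j] w(2) j by (auto simp: fibre_def N'_def)
      have "\<epsilon>' \<le> \<epsilon> j" using j by (simp add: \<epsilon>'_def)
      then show "\<forall>p<rank (E j). norm (snd (T j) (w j) p - snd (T j) (v j) p) < \<epsilon> j"
        using n j by (force simp: co_def Ix_def)
    qed
    then have "w \<in> Pi\<^sub>E {..k} D" using w(1) by (auto simp: mem_V PiE_def)
    moreover have "\<exists>m. \<forall>j\<le>k. prj (E j) (w j) = m" using w(1) by (auto simp: mem_V fibre_def)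
    ultimately show ?thesis using WW D(2) by blast
  qed
  ultimately show ?thesis using that[of N' \<epsilon>'] by (auto simp: N'_def)
qed

end

section \<open>Affine slices of quotients\<close>

lemma openin_quot_imageI:
  assumes "openin X U" "S \<subseteq> U" "\<And>x. x \<in> topspace X \<Longrightarrow> x \<in> U \<longleftrightarrow> f x \<in> f ` S"
  shows "openin (quot_topology X f) (f ` S)"
proof -
  have U: "U \<subseteq> topspace X" using assms(1) by (rule openin_subset)
  then have "{x \<in> topspace X. f x \<in> f ` S} = U" using assms(3) by blast
  then show ?thesis using assms(1,2) U unfolding openin_quot_topology by auto
qed

lemma topspace_quot_topology: "topspace (quot_topology X f) = f ` topspace X"
proof
  show "topspace (quot_topology X f) \<subseteq> f ` topspace X"
    using openin_quot_topology[of X f "topspace (quot_topology X f)"] by simp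
  have "openin (quot_topology X f) (f ` topspace X)" by (intro openin_quot_imageI) auto
  then show "f ` topspace X \<subseteq> topspace (quot_topology X f)" by (rule openin_subset)
qed

text \<open>Here \<open>f\<close> is the quotient by a \<open>\<complex>\<^sup>*\<close>-action for which the coordinates \<open>c q\<close> are homogeneous of
  degree one, so \<open>c q0 = 1\<close> is a slice and the \<open>c q / c q0\<close> are the affine coordinates.\<close>
lemma openin_quot_slice:
  fixes c :: "'q \<Rightarrow> 'a \<Rightarrow> complex"
  assumes K: "finite K" "q0 \<in> K" and D: "openin X D"
    and cont: "\<And>q. q \<in> K \<Longrightarrow> continuous_map (subtopology X D) euclidean (c q)"
    and eq: "\<And>x y. x \<in> D \<Longrightarrow> y \<in> topspace X \<Longrightarrow> f x = f y \<Longrightarrow>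
               y \<in> D \<and> (\<exists>t. t \<noteq> 0 \<and> (\<forall>q\<in>K. c q y = t * c q x))"
    and sc: "\<And>x t. x \<in> D \<Longrightarrow> t \<noteq> 0 \<Longrightarrow> \<exists>y\<in>D. f y = f x \<and> (\<forall>q\<in>K. c q y = t * c q x)"
  shows "openin (quot_topology X f) (f ` {x \<in> D. c q0 x = 1 \<and> (\<forall>q\<in>K. norm (c q x - z q) < \<epsilon>)})"
    (is "openin _ (f ` ?S)")
proof (rule openin_quot_imageI)
  define G where "G q = {x \<in> D. norm (c q x - z q * c q0 x) < \<epsilon> * norm (c q0 x)}" for q
  define U where "U = (\<Inter>q\<in>K. G q)"
  have top: "topspace (subtopology X D) = D" using openin_subset[OF D] by auto
  have "openin X (G q)" if q: "q \<in> K" for q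
  proof -
    let ?P = "{p::complex \<times> complex. norm (fst p - z q * snd p) < \<epsilon> * norm (snd p)}"
    have "open ?P" by (intro open_Collect_less continuous_intros)
    then have P: "openin (prod_topology euclidean euclidean) ?P" by simp
    have "continuous_map (subtopology X D) (prod_topology euclidean euclidean) (\<lambda>x. (c q x, c q0 x))"
      using cont[OF q] cont[OF K(2)] by (rule continuous_map_pairedI)
    from openin_continuous_map_preimage[OF this P]
    have "openin (subtopology X D) (G q)" unfolding top by (simp add: G_def)
    then show ?thesis using D by (simp add: openin_open_subtopology)
  qed
  then show "openin X U" unfolding U_def using K by (intro openin_INT2) auto
  show "?S \<subseteq> U" by (auto simp: U_def G_def)
  fix x assume x: "x \<in> topspace X"
  show "x \<in> U \<longleftrightarrow> f x \<in> f ` ?S"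
  proof
    assume U: "x \<in> U"
    then have xD: "x \<in> D" using K(2) by (auto simp: U_def G_def)
    have nz: "c q0 x \<noteq> 0"
    proof
      assume "c q0 x = 0"
      then show False using U K(2) by (auto simp: U_def G_def)
    qed
    then obtain y where y: "y \<in> D" "f y = f x" "\<forall>q\<in>K. c q y = inverse (c q0 x) * c q x"
      using sc[OF xD, of "inverse (c q0 x)"] by auto
    have "norm (c q y - z q) < \<epsilon>" if q: "q \<in> K" for q
    proof -
      have "norm (c q x - z q * c q0 x) < \<epsilon> * norm (c q0 x)" using U q by (auto simp: U_def G_def)
      moreover have "c q y = c q x / c q0 x" using y(3) q by (simp add: divide_inverse mult.commute)
      then have "c q y - z q = (c q x - z q * c q0 x) / c q0 x"
        using nz by (simp add: diff_divide_distrib)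
      ultimately show ?thesis using nz by (simp add: norm_divide pos_divide_less_eq)
    qed
    moreover have "c q0 y = 1" using y(3) K(2) nz by simp
    ultimately have "y \<in> ?S" using y(1) by simp
    then have "f y \<in> f ` ?S" by (rule imageI)
    then show "f x \<in> f ` ?S" unfolding y(2) .
  next
    assume "f x \<in> f ` ?S"
    then obtain y where y: "y \<in> D" "c q0 y = 1" "\<forall>q\<in>K. norm (c q y - z q) < \<epsilon>" "f y = f x" by auto
    from eq[OF y(1) x y(4)] obtain t where t: "x \<in> D" "t \<noteq> 0" "\<forall>q\<in>K. c q x = t * c q y" by blast
    have "norm (c q x - z q * c q0 x) < \<epsilon> * norm (c q0 x)" if q: "q \<in> K" for q
    proof -
      have "c q x - z q * c q0 x = t * (c q y - z q)" using t(3) q K(2) y(2) by (simp add: algebra_simps)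
      moreover have "c q0 x = t" using t(3) K(2) y(2) by simp
      ultimately show ?thesis using y(3) q t(2) by (simp add: norm_mult)
    qed
    then show "x \<in> U" using t(1) by (simp add: U_def G_def)
  qed
qed

lemma p1_eqD:
  assumes "p1 \<mu> l = p1 \<mu>' l'"
  obtains c where "\<mu>' = c * \<mu>" "l' = c * l"
proof -
  have "(1 * \<mu>', 1 * l') \<in> p1 \<mu>' l'" unfolding p1_def by (rule rangeI)
  then show ?thesis using assms that by (auto simp: p1_def)
qed

lemma P1_large_open:
  fixes R :: real
  obtains Q where "openin P1 Q" "p1 0 1 \<in> Q" "\<And>l. p1 1 l \<in> Q \<Longrightarrow> R < norm l"
proof -
  define S :: "(complex \<times> complex) set" where "S = {p. \<bar>R\<bar> * norm (fst p) < norm (snd p)}"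
  let ?X = "top_of_set (UNIV - {(0::complex, 0::complex)})"
  have "open S" unfolding S_def by (intro open_Collect_less continuous_intros)
  moreover have "S \<subseteq> UNIV - {(0, 0)}" by (auto simp: S_def)
  ultimately have "openin ?X S" by (metis openin_open_eq open_UNIV open_delete)
  moreover have "p \<in> S \<longleftrightarrow> (\<lambda>(\<mu>, l). p1 \<mu> l) p \<in> (\<lambda>(\<mu>, l). p1 \<mu> l) ` S" if "p \<in> topspace ?X" for p
  proof
    assume "(\<lambda>(\<mu>, l). p1 \<mu> l) p \<in> (\<lambda>(\<mu>, l). p1 \<mu> l) ` S"
    then obtain \<mu> l where S: "(\<mu>, l) \<in> S" and e: "p1 \<mu> l = p1 (fst p) (snd p)"
      by (auto simp: case_prod_beta)
    from p1_eqD[OF e] obtain c where c: "fst p = c * \<mu>" "snd p = c * l" .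
    have "p \<noteq> (0, 0)" using that by auto
    then have "c \<noteq> 0" using c by (auto simp: prod_eq_iff)
    then show "p \<in> S" using S by (simp add: S_def c norm_mult)
  qed simp
  ultimately have "openin P1 ((\<lambda>(\<mu>, l). p1 \<mu> l) ` S)" unfolding P1_def
    by (intro openin_quot_imageI) auto
  moreover have "(0, 1) \<in> S" by (simp add: S_def)
  then have "p1 0 1 \<in> (\<lambda>(\<mu>, l). p1 \<mu> l) ` S" by force
  moreover have "R < norm l" if l: "p1 1 l \<in> (\<lambda>(\<mu>, l). p1 \<mu> l) ` S" for l
  proof -
    obtain \<mu> l' where S: "(\<mu>, l') \<in> S" and e: "p1 \<mu> l' = p1 1 l" using l by auto
    from p1_eqD[OF e] obtain c where c: "1 = c * \<mu>" "l = c * l'" .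
    then have "c \<noteq> 0" by auto
    then have "norm c * (\<bar>R\<bar> * norm \<mu>) < norm c * norm l'" using S by (simp add: S_def)
    moreover have "norm c * norm \<mu> = 1" using c(1) by (metis norm_mult norm_one)
    ultimately show ?thesis by (simp add: c(2) norm_mult mult.left_commute)
  qed
  ultimately show ?thesis by (rule that)
qed

lemma P1_nbhd:
  assumes "openin P1 Q" "p1 0 1 \<in> Q"
  obtains R where "\<And>l. R < norm l \<Longrightarrow> p1 1 l \<in> Q"
proof -
  let ?X = "top_of_set (UNIV - {(0::complex, 0::complex)})"
  let ?S = "{p \<in> topspace ?X. (\<lambda>(\<mu>, l). p1 \<mu> l) p \<in> Q}"
  have "openin ?X ?S" using assms(1) by (simp add: P1_def openin_quot_topology)
  then have "open ?S" by (rule openin_open_trans) (simp add: open_delete)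
  moreover have "(0, 1) \<in> ?S" using assms(2) by simp
  ultimately obtain e where e: "e > 0" "\<And>p. dist p (0, 1) < e \<Longrightarrow> p \<in> ?S"
    unfolding open_dist by blast
  have "p1 1 l \<in> Q" if l: "inverse e < norm l" for l
  proof -
    have l0: "norm l > 0" using l e(1) by (meson inverse_positive_iff_positive less_trans)
    have "inverse (norm l) < inverse (inverse e)"
      using l e(1) by (intro less_imp_inverse_less) auto
    then have "dist (inverse l, 1) (0::complex, 1::complex) < e"
      by (simp add: dist_Pair_Pair dist_norm norm_inverse)
    then have "p1 (inverse l) 1 \<in> Q" using e(2) by fastforce
    moreover have "p1 (inverse l) 1 = p1 1 l"
    proof -
      have "p1 (inverse l) 1 = (\<lambda>c. (c * 1, c * l)) ` range (\<lambda>c. c * inverse l)"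
      proof -
        have "(\<lambda>c. (c * inverse l, c * 1)) = (\<lambda>c. (c * inverse l * 1, c * inverse l * l))"
          using l0 by (simp add: fun_eq_iff)
        then show ?thesis unfolding p1_def image_image by (rule arg_cong)
      qed
      moreover have "surj (\<lambda>c. c * inverse l)" using l0 by (intro surjI[of _ "\<lambda>c. c * l"]) auto
      ultimately show ?thesis unfolding p1_def by simp
    qed
    ultimately show ?thesis by simp
  qed
  then show ?thesis by (rule that)
qed

context bundle_family begin

lemma vscale_one: "v \<in> V \<Longrightarrow> vscale E k 1 v = v"
proof -
  assume v: "v \<in> V"
  obtain T where T: "vbase E v \<in> Tr T" using Tr_obtain vbase_in_M[OF v] by blast
  show ?thesis using v T by (intro co_eqI[of _ _ T]) (auto simp: co_vscale)
qed

lemma vscale_vscale: "v \<in> V \<Longrightarrow> vscale E k c (vscale E k d v) = vscale E k (c * d) v"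
proof -
  assume v: "v \<in> V"
  obtain T where T: "vbase E v \<in> Tr T" using Tr_obtain vbase_in_M[OF v] by blast
  show ?thesis using v T by (intro co_eqI[of _ _ T]) (auto simp: co_vscale)
qed

lemma vact_vscale: "v \<in> V \<Longrightarrow> vact E k \<beta> c (vscale E k d v) = vscale E k d (vact E k \<beta> c v)"
proof -
  assume v: "v \<in> V"
  obtain T where T: "vbase E v \<in> Tr T" using Tr_obtain vbase_in_M[OF v] by blast
  show ?thesis using v T by (intro co_eqI[of _ _ T]) (auto simp: co_vscale co_vact)
qed

lemma vscale_vadd: "v \<in> V \<Longrightarrow> w \<in> V \<Longrightarrow> vbase E w = vbase E v \<Longrightarrow>
   vscale E k c (vadd E k v w) = vadd E k (vscale E k c v) (vscale E k c w)"
proof -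
  assume v: "v \<in> V" "w \<in> V" "vbase E w = vbase E v"
  obtain T where T: "vbase E v \<in> Tr T" using Tr_obtain vbase_in_M[OF v(1)] by blast
  show ?thesis using v T
    by (intro co_eqI[of _ _ T]) (auto simp: co_vscale co_vadd algebra_simps)
qed

lemma vsupp_vscale: "v \<in> V \<Longrightarrow> c \<noteq> 0 \<Longrightarrow> vsupp E k (vscale E k c v) = vsupp E k v"
proof -
  assume v: "v \<in> V" and c: "c \<noteq> 0"
  obtain T where T: "vbase E v \<in> Tr T" using Tr_obtain vbase_in_M[OF v] by blast
  show ?thesis using v T c by (auto simp: mem_vsupp_iff[of _ T] co_vscale Ix_def cong: conj_cong)
qed

lemma vsupp_vscale_zero: "v \<in> V \<Longrightarrow> vsupp E k (vscale E k 0 v) = {}"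
proof -
  assume v: "v \<in> V"
  obtain T where T: "vbase E v \<in> Tr T" using Tr_obtain vbase_in_M[OF v] by blast
  show ?thesis using v T by (auto simp: mem_vsupp_iff[of _ T] co_vscale Ix_def cong: conj_cong)
qed

lemma vsupp_vact: "v \<in> V \<Longrightarrow> c \<noteq> 0 \<Longrightarrow> vsupp E k (vact E k \<beta> c v) = vsupp E k v"
proof -
  assume v: "v \<in> V" and c: "c \<noteq> 0"
  obtain T where T: "vbase E v \<in> Tr T" using Tr_obtain vbase_in_M[OF v] by blast
  show ?thesis using v T c by (auto simp: mem_vsupp_iff[of _ T] co_vact Ix_def cong: conj_cong)
qed

lemma vsupp_part: "v \<in> V \<Longrightarrow> vsupp E k (part J v) = vsupp E k v \<inter> J"
proof -
  assume v: "v \<in> V"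
  obtain T where T: "vbase E v \<in> Tr T" using Tr_obtain vbase_in_M[OF v] by blast
  show ?thesis using v T by (auto simp: mem_vsupp_iff[of _ T] co_part Ix_def cong: conj_cong split: if_splits)
qed

lemma self_in_line: "v \<in> V \<Longrightarrow> v \<in> line E k v"
  unfolding line_def using vscale_one by (metis rangeI)

lemma line_vscale: assumes "v \<in> V" "t \<noteq> 0" shows "line E k (vscale E k t v) = line E k v"
proof -
  have "(\<lambda>c. vscale E k c (vscale E k t v)) = (\<lambda>c. vscale E k c v) \<circ> (\<lambda>c. c * t)"
    using assms by (auto simp: vscale_vscale)
  moreover have "surj (\<lambda>c. c * t)" using assms(2) by (intro surjI[of _ "\<lambda>c. c / t"]) auto
  ultimately show ?thesis unfolding line_def by (metis image_comp)
qed

lemma line_eqD: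
  assumes "v \<in> V" "w \<in> V" "vsupp E k w \<noteq> {}" "line E k v = line E k w"
  obtains t where "t \<noteq> 0" "w = vscale E k t v"
proof -
  have "w \<in> line E k v" using self_in_line assms by simp
  then obtain t where t: "w = vscale E k t v" by (auto simp: line_def)
  then have "t \<noteq> 0" using assms vsupp_vscale_zero by blast
  then show ?thesis using t by (rule that)
qed

lemma line_eq_vsupp: "v \<in> V \<Longrightarrow> w \<in> V \<Longrightarrow> vsupp E k w \<noteq> {} \<Longrightarrow> line E k v = line E k w \<Longrightarrow>
    vsupp E k v = vsupp E k w"
  by (metis line_eqD vsupp_vscale)

lemma pbase_line: "v \<in> V \<Longrightarrow> pbase E (line E k v) = vbase E v"
proof -
  assume v: "v \<in> V"
  then have "vbase E ` line E k v = {vbase E v}" by (simp add: line_def image_image)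
  then show ?thesis by (simp add: pbase_def)
qed

lemma pact_line: "v \<in> V \<Longrightarrow> pact E k \<beta> c (line E k v) = line E k (vact E k \<beta> c v)"
  by (auto simp: pact_def line_def image_image vact_vscale)

lemma topspace_PE: "topspace (PE E k) = line E k ` {v \<in> V. vsupp E k v \<noteq> {}}"
  unfolding PE_def topspace_quot_topology by (auto simp: image_def)

lemma line_in_PE: "v \<in> V \<Longrightarrow> vsupp E k v \<noteq> {} \<Longrightarrow> line E k v \<in> topspace (PE E k)"
  by (auto simp: topspace_PE)

lemma line_in_Psub:
  assumes "v \<in> V" "vsupp E k v \<noteq> {}"
  shows "line E k v \<in> Psub E k J \<longleftrightarrow> vsupp E k v \<subseteq> J"
proof
  assume "line E k v \<in> Psub E k J"
  then obtain w where "w \<in> V" "vsupp E k w \<noteq> {}" "vsupp E k w \<subseteq> J" "line E k v = line E k w"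
    by (auto simp: Psub_def)
  then show "vsupp E k v \<subseteq> J" using line_eq_vsupp[OF assms(1)] by simp
qed (use assms in \<open>auto simp: Psub_def\<close>)

lemma line_in_chart_dom:
  assumes "v \<in> V" "vsupp E k v \<noteq> {}"
  shows "line E k v \<in> chart_dom E k i \<longleftrightarrow> i \<in> vsupp E k v"
proof -
  have "vsupp E k v \<subseteq> {..k}" by (auto simp: vsupp_def)
  then show ?thesis using assms by (auto simp: chart_dom_def line_in_Psub line_in_PE)
qed

lemma normalize:
  assumes "v \<in> V" "vbase E v \<in> Tr T" "q \<in> Ix" "co T q v \<noteq> 0"
  obtains v' c where "v' = vscale E k c v" "c \<noteq> 0" "v' \<in> V" "line E k v' = line E k v"
    "vbase E v' = vbase E v" "vsupp E k v' = vsupp E k v" "co T q v' = 1"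
proof -
  have "inverse (co T q v) \<noteq> 0" using assms by simp
  then show ?thesis
    using that[of "vscale E k (inverse (co T q v)) v" "inverse (co T q v)"] assms
    by (simp add: line_vscale vsupp_vscale co_vscale)
qed

definition slice where
  "slice T q0 N z \<epsilon> = {w \<in> V. vbase E w \<in> N \<and> co T q0 w = 1 \<and> (\<forall>q\<in>Ix. norm (co T q w - z q) < \<epsilon>)}"

lemma nonzero_vsupp: "v \<in> V \<Longrightarrow> vbase E v \<in> Tr T \<Longrightarrow> q \<in> Ix \<Longrightarrow> co T q v \<noteq> 0 \<Longrightarrow> fst q \<in> vsupp E k v"
  using co_zero by blast

lemma openin_vbase: "openin M N \<Longrightarrow> openin (sum_tot E k) {v \<in> V. vbase E v \<in> N}"
  using continuous_map_vbase by (rule openin_continuous_map_preimage)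

lemma slice_open:
  assumes N: "openin M N" "N \<subseteq> Tr T" and q0: "q0 \<in> Ix"
  shows "openin (PE E k) (line E k ` slice T q0 N z \<epsilon>)"
proof -
  let ?S = "{v. vsupp E k v \<noteq> {}}"
  define D where "D = {v \<in> V. vbase E v \<in> N} \<inter> ?S"
  have "openin (PE E k) (line E k ` {w \<in> D. co T q0 w = 1 \<and> (\<forall>q\<in>Ix. norm (co T q w - z q) < \<epsilon>)})"
    unfolding PE_def
  proof (rule openin_quot_slice)
    show "finite Ix" "q0 \<in> Ix" by (rule finite_Ix) (rule q0)
    show "openin (subtopology (sum_tot E k) ?S) D"
      unfolding D_def using openin_vbase[OF N(1)] by (rule openin_subtopology_Int)
    fix q assume q: "q \<in> Ix"
    have "?S \<inter> D \<subseteq> {v. vbase E v \<in> Tr T}" using N by (auto simp: D_def)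
    from continuous_map_co[OF q this]
    show "continuous_map (subtopology (subtopology (sum_tot E k) ?S) D) euclidean (co T q)"
      by (simp add: subtopology_subtopology)
  next
    fix x y assume x: "x \<in> D" and y: "y \<in> topspace (subtopology (sum_tot E k) ?S)"
      and e: "line E k x = line E k y"
    have "x \<in> V" "y \<in> V" "vsupp E k y \<noteq> {}" using x y by (auto simp: D_def)
    from line_eqD[OF this e] obtain t where t: "t \<noteq> 0" "y = vscale E k t x" .
    then show "y \<in> D \<and> (\<exists>t. t \<noteq> 0 \<and> (\<forall>q\<in>Ix. co T q y = t * co T q x))"
      using x N by (auto simp: D_def vsupp_vscale co_vscale subset_iff intro!: exI[of _ t])
  next
    fix x t assume x: "x \<in> D" and t: "(t::complex) \<noteq> 0"
    show "\<exists>y\<in>D. line E k y = line E k x \<and> (\<forall>q\<in>Ix. co T q y = t * co T q x)"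
      using x t N by (intro bexI[of _ "vscale E k t x"])
        (auto simp: D_def vsupp_vscale co_vscale line_vscale subset_iff)
  qed
  moreover have "{w \<in> D. co T q0 w = 1 \<and> (\<forall>q\<in>Ix. norm (co T q w - z q) < \<epsilon>)} = slice T q0 N z \<epsilon>"
  proof -
    have "vsupp E k w \<noteq> {}" if "w \<in> V" "vbase E w \<in> N" "co T q0 w = 1" for w
      using nonzero_vsupp[of w T q0] that N(2) q0 by auto
    then show ?thesis by (auto simp: D_def slice_def)
  qed
  ultimately show ?thesis by simp
qed

lemma slice_nbhd:
  assumes W: "openin (PE E k) W" "line E k v \<in> W" and v: "v \<in> V" "vsupp E k v \<noteq> {}"
    and T: "vbase E v \<in> Tr T"
  obtains N \<epsilon> where "openin M N" "vbase E v \<in> N" "N \<subseteq> Tr T" "0 < \<epsilon>"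
    "\<And>w. w \<in> V \<Longrightarrow> vbase E w \<in> N \<Longrightarrow> vsupp E k w \<noteq> {} \<Longrightarrow>
       \<forall>q\<in>Ix. norm (co T q w - co T q v) < \<epsilon> \<Longrightarrow> line E k w \<in> W"
proof -
  let ?S = "{v. vsupp E k v \<noteq> {}}"
  have "openin (subtopology (sum_tot E k) ?S) {x \<in> topspace (subtopology (sum_tot E k) ?S). line E k x \<in> W}"
    using W(1) by (simp add: PE_def openin_quot_topology)
  then obtain W' where W': "openin (sum_tot E k) W'"
    "{x \<in> topspace (subtopology (sum_tot E k) ?S). line E k x \<in> W} = W' \<inter> ?S"
    unfolding openin_subtopology by blast
  have "v \<in> W'" using W'(2) v W(2) by auto
  from V_nbhd[OF W'(1) this T] obtain N \<epsilon> where N: "openin M N" "vbase E v \<in> N" "N \<subseteq> Tr T" "0 < \<epsilon>"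
    "\<And>w. w \<in> V \<Longrightarrow> vbase E w \<in> N \<Longrightarrow> \<forall>q\<in>Ix. norm (co T q w - co T q v) < \<epsilon> \<Longrightarrow> w \<in> W'" by metis
  have "line E k w \<in> W" if "w \<in> V" "vbase E w \<in> N" "vsupp E k w \<noteq> {}"
    "\<forall>q\<in>Ix. norm (co T q w - co T q v) < \<epsilon>" for w
    using N(5)[OF that(1,2,4)] that(3) W'(2) by blast
  then show ?thesis using that N(1-4) by blast
qed

abbreviation HX where
  "HX i J \<equiv> subtopology (prod_topology (sum_tot E k) (sum_tot E k))
          {(u, a). vbase E u = vbase E a \<and> vsupp E k u = {i} \<and> vsupp E k a \<subseteq> J}"

lemma mem_HX: "(u, a) \<in> topspace (HX i J) \<longleftrightarrow>
    u \<in> V \<and> a \<in> V \<and> vbase E a = vbase E u \<and> vsupp E k u = {i} \<and> vsupp E k a \<subseteq> J"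
  by auto

lemma topspace_Hom: "topspace (Hom E k i J) = hom_of E k ` topspace (HX i J)"
  unfolding Hom_def topspace_quot_topology ..

lemma fst_hom_of [simp]: "fst (hom_of E k (u, a)) = line E k u"
  by (simp add: hom_of_def)

lemma vscale_inj: "u \<in> V \<Longrightarrow> vsupp E k u \<noteq> {} \<Longrightarrow> vscale E k c u = vscale E k d u \<Longrightarrow> c = d"
proof -
  assume u: "u \<in> V" "vsupp E k u \<noteq> {}" "vscale E k c u = vscale E k d u"
  obtain T where T: "vbase E u \<in> Tr T" using Tr_obtain vbase_in_M[OF u(1)] by blast
  obtain j where "j \<in> vsupp E k u" using u(2) by blast
  then obtain p where p: "(j, p) \<in> Ix" "co T (j, p) u \<noteq> 0"
    using mem_vsupp_iff[OF u(1) T] by (auto simp: Ix_def)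
  have "c * co T (j, p) u = d * co T (j, p) u"
    using u(3) co_vscale[OF u(1) T p(1), of c] co_vscale[OF u(1) T p(1), of d] by metis
  then show "c = d" using p(2) by simp
qed

lemma snd_hom_of:
  assumes "u \<in> V" "vsupp E k u \<noteq> {}"
  shows "snd (hom_of E k (u, a)) (vscale E k c u) = vscale E k c a"
proof -
  have "vscale E k c u \<in> line E k u" by (simp add: line_def)
  moreover have "(THE b. \<exists>d. vscale E k c u = vscale E k d u \<and> b = vscale E k d a) = vscale E k c a"
    using vscale_inj[OF assms] by (intro the_equality) auto
  ultimately show ?thesis by (simp add: hom_of_def)
qed

lemma hom_of_vscale:
  assumes "u \<in> V" "a \<in> V" "vsupp E k u \<noteq> {}" "t \<noteq> 0"
  shows "hom_of E k (vscale E k t u, vscale E k t a) = hom_of E k (u, a)"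
proof -
  have 1: "line E k (vscale E k t u) = line E k u" using assms by (simp add: line_vscale)
  have "snd (hom_of E k (vscale E k t u, vscale E k t a)) x = snd (hom_of E k (u, a)) x" for x
  proof (cases "x \<in> line E k u")
    case True
    then obtain c where x: "x = vscale E k c u" by (auto simp: line_def)
    then have "x = vscale E k (c / t) (vscale E k t u)" using assms by (simp add: vscale_vscale)
    then have "snd (hom_of E k (vscale E k t u, vscale E k t a)) x = vscale E k (c / t) (vscale E k t a)"
      using assms snd_hom_of[of "vscale E k t u" "vscale E k t a" "c / t"] by (simp add: vsupp_vscale)
    also have "\<dots> = snd (hom_of E k (u, a)) x" using assms x by (simp add: vscale_vscale snd_hom_of)
    finally show ?thesis .
  qed (simp add: hom_of_def 1)
  then show ?thesis by (intro prod_eqI) (auto simp: 1)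
qed

lemma hom_of_eqD:
  assumes "u \<in> V" "a \<in> V" "u' \<in> V" "a' \<in> V" "vsupp E k u \<noteq> {}" "vsupp E k u' \<noteq> {}"
    and eq: "hom_of E k (u, a) = hom_of E k (u', a')"
  obtains t where "t \<noteq> 0" "u' = vscale E k t u" "a' = vscale E k t a"
proof -
  have "line E k u = line E k u'" using eq by (metis fst_hom_of)
  then obtain t where t: "t \<noteq> 0" "u' = vscale E k t u" using line_eqD assms by metis
  have "a' = snd (hom_of E k (u', a')) (vscale E k 1 u')"
    using assms(3,4,6) snd_hom_of[of u' a' 1] by (simp add: vscale_one)
  also have "\<dots> = snd (hom_of E k (u, a)) (vscale E k t u)" using eq t assms by (simp add: vscale_one)
  also have "\<dots> = vscale E k t a" using assms(1,5) by (rule snd_hom_of)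
  finally show ?thesis using that t by blast
qed

text \<open>The coordinates of \<open>u + a\<close>; they determine \<open>u\<close> and \<open>a\<close>, whose supports are disjoint if
  \<open>i \<notin> J\<close>.\<close>
definition hco where "hco T q = (\<lambda>(u, a). co T q u + co T q a)"

definition hslice where
  "hslice i J T q0 N z \<epsilon> = {(u, a). (u, a) \<in> topspace (HX i J) \<and> vbase E u \<in> N \<and>
     hco T q0 (u, a) = 1 \<and> (\<forall>q\<in>Ix. norm (hco T q (u, a) - z q) < \<epsilon>)}"

lemma HX_vscale: "(u, a) \<in> topspace (HX i J) \<Longrightarrow> t \<noteq> 0 \<Longrightarrow>
    (vscale E k t u, vscale E k t a) \<in> topspace (HX i J)"
  unfolding mem_HX by (simp add: vsupp_vscale)

lemma hco_vscale: "(u, a) \<in> topspace (HX i J) \<Longrightarrow> vbase E u \<in> Tr T \<Longrightarrow> q \<in> Ix \<Longrightarrow>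
    hco T q (vscale E k t u, vscale E k t a) = t * hco T q (u, a)"
  unfolding mem_HX hco_def by (simp add: co_vscale algebra_simps)

lemma hslice_open:
  assumes N: "openin M N" "N \<subseteq> Tr T" and q0: "q0 \<in> Ix"
  shows "openin (Hom E k i J) (hom_of E k ` hslice i J T q0 N z \<epsilon>)"
proof -
  let ?X = "prod_topology (sum_tot E k) (sum_tot E k)"
  let ?S = "{(u, a). vbase E u = vbase E a \<and> vsupp E k u = {i} \<and> vsupp E k a \<subseteq> J}"
  define D where "D = ({v \<in> V. vbase E v \<in> N} \<times> V) \<inter> ?S"
  have DX: "D \<subseteq> topspace (HX i J)" by (auto simp: D_def)
  have DT: "vbase E u \<in> Tr T" if "(u, a) \<in> D" for u a using that N by (auto simp: D_def)
  have "openin (Hom E k i J) (hom_of E k ` {w \<in> D. hco T q0 w = 1 \<and> (\<forall>q\<in>Ix. norm (hco T q w - z q) < \<epsilon>)})"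
    unfolding Hom_def
  proof (rule openin_quot_slice)
    show "finite Ix" "q0 \<in> Ix" by (rule finite_Ix) (rule q0)
    have "openin ?X ({v \<in> V. vbase E v \<in> N} \<times> V)"
      using openin_vbase[OF N(1)] by (simp add: openin_prod_Times_iff)
    then show "openin (HX i J) D"
      unfolding D_def by (rule openin_subtopology_Int)
    fix q assume q: "q \<in> Ix"
    let ?Y = "subtopology (sum_tot E k) {v \<in> V. vbase E v \<in> N}"
    let ?Z = "subtopology (HX i J) D"
    have Y: "continuous_map ?Y euclidean (co T q)"
      by (rule continuous_map_co[OF q]) (use N in auto)
    have "continuous_map ?Z ?Y fst" "continuous_map ?Z ?Y snd"
      unfolding continuous_map_in_subtopology
      by (auto simp: D_def intro!: continuous_map_from_subtopology continuous_map_fst continuous_map_snd)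
    from this[THEN continuous_map_compose, OF Y]
    have "continuous_map ?Z euclidean (\<lambda>x. (co T q \<circ> fst) x + (co T q \<circ> snd) x)"
      by (rule continuous_map_add)
    then show "continuous_map ?Z euclidean (hco T q)"
      by (simp add: hco_def case_prod_beta' o_def)
  next
    fix x y assume x: "x \<in> D" and y: "y \<in> topspace (HX i J)"
      and e: "hom_of E k x = hom_of E k y"
    obtain u a u' a' where [simp]: "x = (u, a)" "y = (u', a')" by (meson surj_pair)
    have "u \<in> V" "a \<in> V" "u' \<in> V" "a' \<in> V" "vsupp E k u \<noteq> {}" "vsupp E k u' \<noteq> {}"
      using x y by (auto simp: D_def)
    from hom_of_eqD[OF this] e obtain t where t: "t \<noteq> 0" "u' = vscale E k t u" "a' = vscale E k t a" by auto
    have "vbase E u' \<in> N" using x t by (auto simp: D_def)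
    then have "y \<in> D" using y by (auto simp: D_def)
    moreover have "(u, a) \<in> topspace (HX i J)" "vbase E u \<in> Tr T" using x DX DT by auto
    from hco_vscale[OF this] have "\<forall>q\<in>Ix. hco T q y = t * hco T q x" using t by simp
    ultimately show "y \<in> D \<and> (\<exists>t. t \<noteq> 0 \<and> (\<forall>q\<in>Ix. hco T q y = t * hco T q x))"
      using t by blast
  next
    fix x t assume x: "x \<in> D" and t: "(t::complex) \<noteq> 0"
    obtain u a where [simp]: "x = (u, a)" by (meson surj_pair)
    have ua: "(u, a) \<in> topspace (HX i J)" using x DX by auto
    have 1: "(vscale E k t u, vscale E k t a) \<in> D"
      using HX_vscale[OF ua t] x by (auto simp: D_def)
    have 2: "hom_of E k (vscale E k t u, vscale E k t a) = hom_of E k (u, a)"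
      using ua t unfolding mem_HX by (intro hom_of_vscale) auto
    show "\<exists>y\<in>D. hom_of E k y = hom_of E k x \<and> (\<forall>q\<in>Ix. hco T q y = t * hco T q x)"
      using 1 2 hco_vscale[OF ua] DT[of u a] x by (intro bexI[OF _ 1]) auto
  qed
  moreover have "{w \<in> D. hco T q0 w = 1 \<and> (\<forall>q\<in>Ix. norm (hco T q w - z q) < \<epsilon>)} = hslice i J T q0 N z \<epsilon>"
    by (auto simp: D_def hslice_def)
  ultimately show ?thesis by simp
qed

lemma hco_split:
  assumes "(u, a) \<in> topspace (HX i J)" "vbase E u \<in> Tr T" "q \<in> Ix" "i \<notin> J"
  shows "co T q u = (if fst q = i then hco T q (u, a) else 0)"
    and "co T q a = (if fst q = i then 0 else hco T q (u, a))"
proof -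
  have "fst q \<noteq> i \<Longrightarrow> co T q u = 0" "fst q = i \<Longrightarrow> co T q a = 0"
    using assms unfolding mem_HX by (auto intro!: co_zero)
  then show "co T q u = (if fst q = i then hco T q (u, a) else 0)"
    and "co T q a = (if fst q = i then 0 else hco T q (u, a))" by (auto simp: hco_def)
qed

lemma hslice_nbhd:
  assumes W: "openin (Hom E k i J) W" "hom_of E k (u, a) \<in> W" and u: "(u, a) \<in> topspace (HX i J)"
    and T: "vbase E u \<in> Tr T" and iJ: "i \<notin> J"
  obtains N \<epsilon> where "openin M N" "vbase E u \<in> N" "N \<subseteq> Tr T" "0 < \<epsilon>"
    "\<And>u' a'. (u', a') \<in> topspace (HX i J) \<Longrightarrow> vbase E u' \<in> N \<Longrightarrow>
       \<forall>q\<in>Ix. norm (hco T q (u', a') - hco T q (u, a)) < \<epsilon> \<Longrightarrow> hom_of E k (u', a') \<in> W"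
proof -
  let ?X = "prod_topology (sum_tot E k) (sum_tot E k)"
  let ?S = "{(u, a). vbase E u = vbase E a \<and> vsupp E k u = {i} \<and> vsupp E k a \<subseteq> J}"
  have uV: "u \<in> V" "a \<in> V" "vbase E a = vbase E u" using u by auto
  have "openin (HX i J) {x \<in> topspace (HX i J). hom_of E k x \<in> W}"
    using W(1) unfolding Hom_def openin_quot_topology by simp
  then obtain W' where W': "openin ?X W'" "{x \<in> topspace (HX i J). hom_of E k x \<in> W} = W' \<inter> ?S"
    unfolding openin_subtopology by blast
  have "(u, a) \<in> W'" using W'(2) u W(2) by blast
  with W'(1) obtain A B where A: "openin (sum_tot E k) A" "u \<in> A" and B: "openin (sum_tot E k) B" "a \<in> B"
    and AB: "A \<times> B \<subseteq> W'"
    by (rule prod_topology_nbhd) (rule that)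
  obtain N1 \<epsilon>1 where N1: "openin M N1" "vbase E u \<in> N1" "N1 \<subseteq> Tr T" "0 < \<epsilon>1"
    "\<And>w. w \<in> V \<Longrightarrow> vbase E w \<in> N1 \<Longrightarrow> \<forall>q\<in>Ix. norm (co T q w - co T q u) < \<epsilon>1 \<Longrightarrow> w \<in> A"
    using V_nbhd[OF A T] by metis
  obtain N2 \<epsilon>2 where N2: "openin M N2" "vbase E u \<in> N2" "N2 \<subseteq> Tr T" "0 < \<epsilon>2"
    "\<And>w. w \<in> V \<Longrightarrow> vbase E w \<in> N2 \<Longrightarrow> \<forall>q\<in>Ix. norm (co T q w - co T q a) < \<epsilon>2 \<Longrightarrow> w \<in> B"
    using V_nbhd[OF B] T uV by metis
  have "hom_of E k (u', a') \<in> W" if ua: "(u', a') \<in> topspace (HX i J)" and b: "vbase E u' \<in> N1 \<inter> N2"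
    and n: "\<forall>q\<in>Ix. norm (hco T q (u', a') - hco T q (u, a)) < min \<epsilon>1 \<epsilon>2" for u' a'
  proof -
    have T': "vbase E u' \<in> Tr T" using b N1(3) by auto
    have uV': "u' \<in> V" "a' \<in> V" "vbase E a' = vbase E u'" using ua by auto
    have "norm (co T q u' - co T q u) < \<epsilon>1" "norm (co T q a' - co T q a) < \<epsilon>2" if q: "q \<in> Ix" for q
      using bspec[OF n q] hco_split[OF ua T' q iJ] hco_split[OF u T q iJ] N1(4) N2(4)
      by (auto simp: min_def split: if_splits)
    then have "u' \<in> A" "a' \<in> B" using N1(5) N2(5) uV' b by auto
    then have "(u', a') \<in> W' \<inter> ?S" using AB ua by auto
    then show ?thesis using W'(2) by blast
  qed
  moreover have "openin M (N1 \<inter> N2)" using N1 N2 by auto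
  ultimately show ?thesis using that[of "N1 \<inter> N2" "min \<epsilon>1 \<epsilon>2"] N1(2,3,4) N2(2,4) by auto
qed

end

section \<open>Limits of the action\<close>

lemma LIMSEQ_of_bound:
  fixes X :: "nat \<Rightarrow> complex"
  assumes "\<And>n. norm (X n - L) < inverse (real (Suc n))"
  shows "X \<longlonglongrightarrow> L"
proof (rule LIM_zero_cancel)
  have "\<forall>\<^sub>F n in sequentially. norm (X n - L) \<le> inverse (real (Suc n))"
    by (intro always_eventually allI less_imp_le assms)
  then show "(\<lambda>n. X n - L) \<longlonglongrightarrow> 0"
    using LIMSEQ_inverse_real_of_nat by (rule Lim_null_comparison)
qed

lemma powi_tendsto_at_infinity: "n < 0 \<Longrightarrow> ((\<lambda>c::complex. c powi n) \<longlongrightarrow> 0) at_infinity"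
proof -
  assume n: "n < 0"
  have "((\<lambda>c::complex. inverse c ^ nat (- n)) \<longlongrightarrow> 0 ^ nat (- n)) at_infinity"
    by (intro tendsto_power tendsto_inverse_0)
  moreover have "(\<lambda>c::complex. c powi n) = (\<lambda>c. inverse c ^ nat (- n))"
    using n by (auto simp: power_int_def)
  moreover have "(0::complex) ^ nat (- n) = 0" using n by (simp add: power_0_left)
  ultimately show ?thesis by simp
qed

lemma powi_tendsto_at_0: "n > 0 \<Longrightarrow> ((\<lambda>c::complex. c powi n) \<longlongrightarrow> 0) (at 0)"
proof -
  assume n: "n > 0"
  have "((\<lambda>c::complex. c ^ nat n) \<longlongrightarrow> 0 ^ nat n) (at 0)"
    by (intro tendsto_power tendsto_ident_at)
  moreover have "(\<lambda>c::complex. c powi n) = (\<lambda>c. c ^ nat n)"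
    using n by (auto simp: power_int_def)
  moreover have "(0::complex) ^ nat n = 0" using n by (simp add: power_0_left)
  ultimately show ?thesis by simp
qed

lemma powi_diff_mult: "c \<noteq> 0 \<Longrightarrow> c powi (m - n) * x = c powi (- n) * (c powi m * (x::complex))"
  by (simp add: power_int_diff power_int_minus divide_inverse)

text \<open>If some \<open>Y q\<close> with \<open>i < fst q\<close> is nonzero, a small \<open>W q\<close> forces \<open>c\<close> to be large and one takes
  \<open>l = c\<close>; otherwise a fixed large \<open>l\<close> does, since the \<open>W q\<close> may be as small as one likes.\<close>
lemma large_scaling:
  fixes X Y :: "nat \<times> nat \<Rightarrow> complex" and e :: "nat \<Rightarrow> int" and R \<epsilon> :: real
  assumes I: "finite I"
    and e: "\<And>q. q \<in> I \<Longrightarrow> fst q < i \<Longrightarrow> e (fst q) < 0" "e i = 0"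
      "\<And>q. q \<in> I \<Longrightarrow> i < fst q \<Longrightarrow> 0 < e (fst q)"
    and X: "\<And>q. q \<in> I \<Longrightarrow> i < fst q \<Longrightarrow> X q = 0"
    and Y: "\<And>q. q \<in> I \<Longrightarrow> fst q < i \<Longrightarrow> Y q = 0"
    and XY: "\<And>q. q \<in> I \<Longrightarrow> fst q = i \<Longrightarrow> X q = Y q"
    and \<epsilon>: "0 < \<epsilon>"
  obtains \<delta> where "0 < \<delta>"
    "\<And>c W. c \<noteq> 0 \<Longrightarrow> \<forall>q\<in>I. norm (W q - X q) < \<delta> \<Longrightarrow>
       \<forall>q\<in>I. i < fst q \<longrightarrow> norm (c powi e (fst q) * W q - Y q) < \<delta> \<Longrightarrow>
       \<exists>l. l \<noteq> 0 \<and> R < norm l \<and>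
         (\<forall>q\<in>I. norm (W q - X q) < \<epsilon> \<and> norm (l powi e (fst q) * W q - Y q) < \<epsilon>)"
proof -
  define B where "B = 1 + (\<Sum>q\<in>I. norm (X q))"
  define R' where "R' = max 1 (max R (B / \<epsilon>))"
  have XB: "norm (X q) + 1 \<le> B" if "q \<in> I" for q
    using member_le_sum[OF that _ I, of "\<lambda>q. norm (X q)"] by (simp add: B_def)
  have R': "1 \<le> R'" "R \<le> R'" "B / \<epsilon> \<le> R'" by (auto simp: R'_def)
  have fin: "\<exists>l. l \<noteq> 0 \<and> R < norm l \<and>
         (\<forall>q\<in>I. norm (W q - X q) < \<epsilon> \<and> norm (l powi e (fst q) * W q - Y q) < \<epsilon>)"
    if l: "R' < norm l" and W: "\<forall>q\<in>I. norm (W q - X q) < min 1 \<epsilon>"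
      and gt: "\<forall>q\<in>I. i < fst q \<longrightarrow> norm (l powi e (fst q) * W q - Y q) < \<epsilon>" for l W
  proof (intro exI[of _ l] conjI ballI)
    show "l \<noteq> 0" "R < norm l" using l R' by auto
    fix q assume q: "q \<in> I"
    show "norm (W q - X q) < \<epsilon>" using W q by simp
    consider "fst q < i" | "fst q = i" | "i < fst q" by linarith
    then show "norm (l powi e (fst q) * W q - Y q) < \<epsilon>"
    proof cases
      case 1
      have l1: "1 \<le> norm l" using l R' by simp
      have "norm l powi e (fst q) \<le> norm l powi (- 1)"
        using e(1)[OF q 1] l1 by (intro power_int_increasing) auto
      then have 2: "norm (l powi e (fst q)) \<le> inverse (norm l)" by (simp add: norm_power_int power_int_minus)
      have "norm (W q) \<le> norm (W q - X q) + norm (X q)"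
        using norm_triangle_ineq[of "W q - X q" "X q"] by simp
      moreover have "norm (W q - X q) < 1" using W q by simp
      ultimately have "norm (W q) \<le> B" using XB[OF q] by linarith
      then have "norm (l powi e (fst q) * W q) \<le> inverse (norm l) * B"
        unfolding norm_mult using 2 by (intro mult_mono) auto
      also have "\<dots> < \<epsilon>"
      proof -
        have "B / \<epsilon> < norm l" using l R' by simp
        then have "B < \<epsilon> * norm l" using \<epsilon> by (simp add: divide_less_eq mult.commute)
        then have "inverse (norm l) * B < inverse (norm l) * (\<epsilon> * norm l)"
          using l1 by (intro mult_strict_left_mono) auto
        also have "inverse (norm l) * (\<epsilon> * norm l) = \<epsilon>"
        proof -
          have "norm l \<noteq> 0" using l1 by linarith
          then show ?thesis by (simp add: field_simps)
        qed
        finally show ?thesis .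
      qed
      finally show ?thesis using Y[OF q 1] by simp
    next
      case 2
      have "norm (W q - X q) < \<epsilon>" using W q by simp
      then show ?thesis using XY[OF q 2] e(2) 2 by simp
    next
      case 3
      then show ?thesis using gt q by blast
    qed
  qed
  show ?thesis
  proof (cases "\<forall>q\<in>I. i < fst q \<longrightarrow> Y q = 0")
    case True
    define l where "l = complex_of_real (R' + 1)"
    define K where "K = 1 + (\<Sum>q\<in>I. norm (l powi e (fst q)))"
    have K: "norm (l powi e (fst q)) < K" if "q \<in> I" for q
      using member_le_sum[OF that _ I, of "\<lambda>q. norm (l powi e (fst q))"] by (simp add: K_def)
    have K0: "0 < K" unfolding K_def by (simp add: add_pos_nonneg sum_nonneg)
    have l: "R' < norm l" unfolding l_def norm_of_real using R' by simp
    show ?thesis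
    proof (rule that)
      show "0 < min (min 1 \<epsilon>) (\<epsilon> / K)" using \<epsilon> K0 by simp
      fix c and W :: "nat \<times> nat \<Rightarrow> complex"
      assume W: "\<forall>q\<in>I. norm (W q - X q) < min (min 1 \<epsilon>) (\<epsilon> / K)"
      have "norm (l powi e (fst q) * W q - Y q) < \<epsilon>" if q: "q \<in> I" "i < fst q" for q
      proof -
        have "norm (W q) < \<epsilon> / K" using bspec[OF W q(1)] X[OF q] by simp
        then have "K * norm (W q) < \<epsilon>" using K0 by (simp add: less_divide_eq mult.commute)
        moreover have "norm (l powi e (fst q)) * norm (W q) \<le> K * norm (W q)"
          using K[OF q(1)] by (intro mult_right_mono) auto
        ultimately show ?thesis using True q by (simp add: norm_mult)
      qed
      then show "\<exists>l. l \<noteq> 0 \<and> R < norm l \<and>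
         (\<forall>q\<in>I. norm (W q - X q) < \<epsilon> \<and> norm (l powi e (fst q) * W q - Y q) < \<epsilon>)"
        using W by (intro fin[OF l]) auto
    qed
  next
    case False
    then obtain r where r: "r \<in> I" "i < fst r" "Y r \<noteq> 0" by blast
    define P where "P = R' powi e (fst r)"
    have P: "0 < P" unfolding P_def using R' by (intro zero_less_power_int) simp
    define \<delta> where "\<delta> = min (min 1 \<epsilon>) (min (norm (Y r) / 2) (norm (Y r) / (2 * P)))"
    show ?thesis
    proof (rule that)
      show "0 < \<delta>" using \<epsilon> P r by (simp add: \<delta>_def)
      fix c and W :: "nat \<times> nat \<Rightarrow> complex"
      assume c: "c \<noteq> 0" and W: "\<forall>q\<in>I. norm (W q - X q) < \<delta>"
        and cW: "\<forall>q\<in>I. i < fst q \<longrightarrow> norm (c powi e (fst q) * W q - Y q) < \<delta>"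
      have "R' < norm c"
      proof (rule ccontr)
        assume "\<not> R' < norm c"
        then have "norm c powi e (fst r) \<le> P"
          unfolding P_def using e(3)[OF r(1,2)] by (intro power_int_mono) auto
        then have "norm (c powi e (fst r)) \<le> P" by (simp add: norm_power_int)
        moreover have "norm (W r) \<le> norm (Y r) / (2 * P)"
          using bspec[OF W r(1)] X[OF r(1,2)] by (simp add: \<delta>_def)
        ultimately have "norm (c powi e (fst r) * W r) \<le> P * (norm (Y r) / (2 * P))"
          unfolding norm_mult using P by (intro mult_mono) auto
        also have "\<dots> = norm (Y r) / 2" using P by simp
        finally have "norm (c powi e (fst r) * W r) \<le> norm (Y r) / 2" .
        moreover have "norm (c powi e (fst r) * W r - Y r) < norm (Y r) / 2"
          using cW r by (auto simp: \<delta>_def)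
        moreover have "norm (Y r) \<le> norm (c powi e (fst r) * W r) + norm (c powi e (fst r) * W r - Y r)"
          using norm_triangle_ineq4[of "c powi e (fst r) * W r" "c powi e (fst r) * W r - Y r"] by simp
        ultimately show False by linarith
      qed
      then show "\<exists>l. l \<noteq> 0 \<and> R < norm l \<and>
         (\<forall>q\<in>I. norm (W q - X q) < \<epsilon> \<and> norm (l powi e (fst q) * W q - Y q) < \<epsilon>)"
        using W cW by (intro fin) (auto simp: \<delta>_def)
    qed
  qed
qed

context bundle_family begin

lemma vsupp_obtain:
  assumes "v \<in> V" "vbase E v \<in> Tr T" "i \<in> vsupp E k v"
  obtains q where "q \<in> Ix" "fst q = i" "co T q v \<noteq> 0"
  using assms mem_vsupp_iff[OF assms(1,2), of i] by (fastforce simp: Ix_def)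

lemma limitin_line_iff:
  assumes M: "Hausdorff_space M"
    and F: "F \<noteq> bot" "\<forall>\<^sub>F c in F. c \<noteq> 0"
    and good: "\<And>j. j \<le> k \<Longrightarrow> j \<in> J \<Longrightarrow> ((\<lambda>c. c powi (\<beta> j - \<beta> i)) \<longlongrightarrow> 0) F"
    and bad: "\<And>j. j \<le> k \<Longrightarrow> j \<notin> insert i J \<Longrightarrow> ((\<lambda>c. c powi (\<beta> i - \<beta> j)) \<longlongrightarrow> 0) F"
    and v: "v \<in> V" "vsupp E k v \<noteq> {}" and z: "z \<in> Psub E k {i}"
  shows "limitin (PE E k) (\<lambda>c. pact E k \<beta> c (line E k v)) z F \<longleftrightarrow>
    i \<in> vsupp E k v \<and> vsupp E k v \<subseteq> insert i J \<and> z = line E k (part {i} v)"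
proof
  assume lim: "limitin (PE E k) (\<lambda>c. pact E k \<beta> c (line E k v)) z F"
  obtain u0 where u0: "u0 \<in> V" "vsupp E k u0 \<noteq> {}" "vsupp E k u0 \<subseteq> {i}" "z = line E k u0"
    using z by (auto simp: Psub_def)
  then have i: "i \<in> vsupp E k u0" by blast
  obtain T where T0: "vbase E u0 \<in> Tr T" using Tr_obtain vbase_in_M[OF u0(1)] by blast
  obtain q0 where q0: "q0 \<in> Ix" "fst q0 = i" "co T q0 u0 \<noteq> 0" using vsupp_obtain[OF u0(1) T0 i] by metis
  obtain u where u: "u \<in> V" "line E k u = line E k u0" "vbase E u = vbase E u0"
    "vsupp E k u = vsupp E k u0" "co T q0 u = 1" using normalize[OF u0(1) T0 q0(1,3)] by metis
  have T: "vbase E u \<in> Tr T" using T0 u by simp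
  have ev: "\<forall>\<^sub>F c in F. c \<noteq> 0 \<and> (\<exists>t. t \<noteq> 0 \<and> vscale E k t (vact E k \<beta> c v) \<in> slice T q0 N (\<lambda>q. co T q u) \<epsilon>)"
    if N: "openin M N" "vbase E u \<in> N" "N \<subseteq> Tr T" and \<epsilon>: "0 < \<epsilon>" for N \<epsilon>
  proof -
    have "openin (PE E k) (line E k ` slice T q0 N (\<lambda>q. co T q u) \<epsilon>)" using N q0 by (intro slice_open)
    moreover have "u \<in> slice T q0 N (\<lambda>q. co T q u) \<epsilon>" using u N \<epsilon> by (auto simp: slice_def)
    then have "z \<in> line E k ` slice T q0 N (\<lambda>q. co T q u) \<epsilon>" using u0 u by (metis imageI)
    ultimately have "\<forall>\<^sub>F c in F. line E k (vact E k \<beta> c v) \<in> line E k ` slice T q0 N (\<lambda>q. co T q u) \<epsilon>"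
      using lim v by (simp add: limitin_def pact_line)
    then show ?thesis using F(2)
    proof eventually_elim
      case (elim c)
      then obtain w where w: "w \<in> slice T q0 N (\<lambda>q. co T q u) \<epsilon>"
        "line E k (vact E k \<beta> c v) = line E k w" by auto
      then have "w \<in> V" "vsupp E k w \<noteq> {}"
        using nonzero_vsupp[of w T q0] q0(1) N(3) by (auto simp: slice_def)
      from line_eqD[OF _ this w(2)] obtain t where "t \<noteq> 0" "w = vscale E k t (vact E k \<beta> c v)"
        using v by auto
      then show ?case using elim w by blast
    qed
  qed
  have b: "vbase E v = vbase E u"
  proof (rule ccontr)
    assume ne: "vbase E v \<noteq> vbase E u"
    from M obtain N N' where N: "openin M N" "openin M N'" "vbase E u \<in> N" "vbase E v \<in> N'" "disjnt N N'"
      unfolding Hausdorff_space_def using ne vbase_in_M[OF v(1)] vbase_in_M[OF u(1)] by metis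
    have N2: "openin M (N \<inter> Tr T)" using N openin_Tr by blast
    have "vbase E u \<in> N \<inter> Tr T" "N \<inter> Tr T \<subseteq> Tr T" using N T by auto
    from eventually_happens'[OF F(1) ev[OF N2 this zero_less_one]] have "vbase E v \<in> N"
      using v by (auto simp: slice_def)
    then show False using N by (auto simp: disjnt_def)
  qed
  then have Tv: "vbase E v \<in> Tr T" using T by simp
  have ev2: "\<forall>\<^sub>F c in F. c \<noteq> 0 \<and> co T q0 v \<noteq> 0 \<and>
      (\<forall>q\<in>Ix. norm (c powi (\<beta> (fst q) - \<beta> i) * (co T q v / co T q0 v) - co T q u) < \<epsilon>)"
    if \<epsilon>: "0 < \<epsilon>" for \<epsilon>
    using ev[OF openin_Tr T subset_refl \<epsilon>]
  proof eventually_elim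
    case (elim c)
    then obtain t where c: "c \<noteq> 0" "t \<noteq> 0" and
      w: "vscale E k t (vact E k \<beta> c v) \<in> slice T q0 (Tr T) (\<lambda>q. co T q u) \<epsilon>" by blast
    have cq: "co T q (vscale E k t (vact E k \<beta> c v)) = t * (c powi \<beta> (fst q) * co T q v)" if "q \<in> Ix" for q
      using v Tv that by (simp add: co_vscale co_vact)
    have 1: "t * (c powi \<beta> i * co T q0 v) = 1" using w cq[OF q0(1)] q0(2) by (simp add: slice_def)
    then have nz: "co T q0 v \<noteq> 0" by auto
    have "t * (c powi \<beta> (fst q) * co T q v) = c powi (\<beta> (fst q) - \<beta> i) * (co T q v / co T q0 v)" for q
    proof -
      have "t = 1 / (c powi \<beta> i * co T q0 v)" using 1 nz c by (simp add: field_simps)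
      then show ?thesis using c by (simp add: power_int_diff)
    qed
    then show ?case using w cq nz c by (simp add: slice_def)
  qed
  from eventually_happens'[OF F(1) ev2[OF zero_less_one]] have nz: "co T q0 v \<noteq> 0" by blast
  have tend: "((\<lambda>c. c powi (\<beta> (fst q) - \<beta> i) * (co T q v / co T q0 v)) \<longlongrightarrow> co T q u) F"
    if q: "q \<in> Ix" for q
  proof (rule tendstoI)
    fix \<epsilon> :: real assume "0 < \<epsilon>"
    from ev2[OF this] show "\<forall>\<^sub>F c in F. dist (c powi (\<beta> (fst q) - \<beta> i) * (co T q v / co T q0 v)) (co T q u) < \<epsilon>"
      by (rule eventually_mono) (use q in \<open>auto simp: dist_norm\<close>)
  qed
  have eq_i: "co T q v = co T q0 v * co T q u" if q: "q \<in> Ix" "fst q = i" for q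
  proof -
    have "((\<lambda>c::complex. co T q v / co T q0 v) \<longlongrightarrow> co T q u) F" using tend[OF q(1)] q(2) by simp
    then have "co T q v / co T q0 v = co T q u" using F(1) by (simp add: tendsto_const_iff)
    then show ?thesis using nz by (simp add: field_simps)
  qed
  have eq_0: "co T q v = 0" if q: "q \<in> Ix" "fst q \<notin> insert i J" for q
  proof -
    let ?x = "co T q v / co T q0 v"
    have "((\<lambda>c. c powi (\<beta> i - \<beta> (fst q)) * (c powi (\<beta> (fst q) - \<beta> i) * ?x)) \<longlongrightarrow> 0 * co T q u) F"
      using q by (intro tendsto_mult tend bad) (auto simp: Ix_def)
    then have "((\<lambda>c::complex. ?x) \<longlongrightarrow> 0 * co T q u) F"
    proof (rule Lim_transform_eventually)
      show "\<forall>\<^sub>F c in F. c powi (\<beta> i - \<beta> (fst q)) * (c powi (\<beta> (fst q) - \<beta> i) * ?x) = ?x"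
        using F(2) by eventually_elim (simp add: power_int_diff)
    qed
    then show ?thesis using F(1) nz by (simp add: tendsto_const_iff)
  qed
  have "i \<in> vsupp E k v" using nonzero_vsupp[OF v(1) Tv q0(1) nz] q0(2) by simp
  moreover have "vsupp E k v \<subseteq> insert i J"
  proof
    fix j assume "j \<in> vsupp E k v"
    from vsupp_obtain[OF v(1) Tv this] show "j \<in> insert i J" using eq_0 by metis
  qed
  moreover have "part {i} v = vscale E k (co T q0 v) u"
  proof (rule co_eqI)
    fix q assume q: "q \<in> Ix"
    show "co T q (part {i} v) = co T q (vscale E k (co T q0 v) u)"
    proof (cases "fst q = i")
      case True
      then show ?thesis using eq_i[OF q True] v Tv u T q by (simp add: co_part co_vscale)
    next
      case False
      then have "co T q u = 0" using co_zero[OF u(1) T q] u(4) u0(3) by auto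
      then show ?thesis using False v Tv u T q by (simp add: co_part co_vscale)
    qed
  qed (use v u b Tv in auto)
  then have "z = line E k (part {i} v)" using line_vscale[OF u(1) nz] u u0 by simp
  ultimately show "i \<in> vsupp E k v \<and> vsupp E k v \<subseteq> insert i J \<and> z = line E k (part {i} v)" by blast
next
  assume r: "i \<in> vsupp E k v \<and> vsupp E k v \<subseteq> insert i J \<and> z = line E k (part {i} v)"
  let ?u = "part {i} v"
  have u: "?u \<in> V" "vsupp E k ?u \<noteq> {}" "vbase E ?u = vbase E v" using v r by (auto simp: vsupp_part)
  obtain T where Tv: "vbase E v \<in> Tr T" using Tr_obtain vbase_in_M[OF v(1)] by blast
  then have T: "vbase E ?u \<in> Tr T" using u by simp
  show "limitin (PE E k) (\<lambda>c. pact E k \<beta> c (line E k v)) z F"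
    unfolding limitin_def
  proof (intro conjI allI impI)
    show "z \<in> topspace (PE E k)" using r line_in_PE[OF u(1,2)] by simp
    fix W assume W: "openin (PE E k) W \<and> z \<in> W"
    then have W: "openin (PE E k) W" "line E k ?u \<in> W" using r by auto
    obtain N \<epsilon> where N: "openin M N" "vbase E ?u \<in> N" "N \<subseteq> Tr T" "0 < \<epsilon>"
      "\<And>w. w \<in> V \<Longrightarrow> vbase E w \<in> N \<Longrightarrow> vsupp E k w \<noteq> {} \<Longrightarrow>
       \<forall>q\<in>Ix. norm (co T q w - co T q ?u) < \<epsilon> \<Longrightarrow> line E k w \<in> W"
      using slice_nbhd[OF W u(1,2) T] by metis
    have "\<forall>\<^sub>F c in F. norm (c powi (\<beta> (fst q) - \<beta> i) * co T q v - co T q ?u) < \<epsilon>" if q: "q \<in> Ix" for q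
    proof -
      have "((\<lambda>c. c powi (\<beta> (fst q) - \<beta> i) * co T q v) \<longlongrightarrow> co T q ?u) F"
      proof -
        consider "fst q = i" | "fst q \<noteq> i" "fst q \<in> J" | "fst q \<noteq> i" "co T q v = 0"
          using co_zero[OF v(1) Tv q] r by blast
        then show ?thesis
        proof cases
          case 2
          have "((\<lambda>c. c powi (\<beta> (fst q) - \<beta> i) * co T q v) \<longlongrightarrow> 0 * co T q v) F"
            using good[of "fst q"] 2 q by (intro tendsto_mult tendsto_const) (auto simp: Ix_def)
          then show ?thesis using 2 v Tv q by (simp add: co_part)
        qed (use v Tv q in \<open>auto simp: co_part\<close>)
      qed
      from tendstoD[OF this N(4)] show ?thesis by (simp add: dist_norm)
    qed
    then have "\<forall>\<^sub>F c in F. \<forall>q\<in>Ix. norm (c powi (\<beta> (fst q) - \<beta> i) * co T q v - co T q ?u) < \<epsilon>"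
      using finite_Ix by (simp add: eventually_ball_finite)
    then show "\<forall>\<^sub>F c in F. pact E k \<beta> c (line E k v) \<in> W" using F(2)
    proof eventually_elim
      case (elim c)
      let ?w = "vscale E k (c powi (- \<beta> i)) (vact E k \<beta> c v)"
      have "line E k ?w \<in> W"
      proof (rule N(5))
        show "?w \<in> V" "vbase E ?w \<in> N" "vsupp E k ?w \<noteq> {}"
          using v u N elim by (auto simp: vsupp_vscale vsupp_vact)
        show "\<forall>q\<in>Ix. norm (co T q ?w - co T q ?u) < \<epsilon>"
          using elim v Tv by (simp add: co_vscale co_vact powi_diff_mult)
      qed
      then show ?case using v elim by (simp add: pact_line line_vscale)
    qed
  qed
qed

lemma lim_infty_line_iff:
  assumes M: "Hausdorff_space M" and \<beta>: "strict_mono_on {..k} \<beta>" and i: "i \<le> k"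
    and v: "v \<in> V" "vsupp E k v \<noteq> {}" and z: "z \<in> Psub E k {i}"
  shows "lim_infty E k \<beta> (line E k v) z \<longleftrightarrow>
    i \<in> vsupp E k v \<and> vsupp E k v \<subseteq> {..i} \<and> z = line E k (part {i} v)"
proof -
  have "insert i {..<i} = {..i}" by auto
  moreover have "lim_infty E k \<beta> (line E k v) z \<longleftrightarrow>
    i \<in> vsupp E k v \<and> vsupp E k v \<subseteq> insert i {..<i} \<and> z = line E k (part {i} v)"
    unfolding lim_infty_def
  proof (rule limitin_line_iff[OF M _ _ _ _ v z])
    show "at_infinity \<noteq> (bot :: complex filter)" by (rule trivial_limit_at_infinity)
    show "\<forall>\<^sub>F c::complex in at_infinity. c \<noteq> 0"
      unfolding eventually_at_infinity by (intro exI[of _ 1]) auto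
    show "((\<lambda>c::complex. c powi (\<beta> j - \<beta> i)) \<longlongrightarrow> 0) at_infinity" if "j \<le> k" "j \<in> {..<i}" for j
    proof -
      have "\<beta> j < \<beta> i" by (rule strict_mono_onD[OF \<beta>]) (use that i in auto)
      then show ?thesis by (simp add: powi_tendsto_at_infinity)
    qed
    show "((\<lambda>c::complex. c powi (\<beta> i - \<beta> j)) \<longlongrightarrow> 0) at_infinity" if "j \<le> k" "j \<notin> insert i {..<i}" for j
    proof -
      have "\<beta> i < \<beta> j" by (rule strict_mono_onD[OF \<beta>]) (use that i in auto)
      then show ?thesis by (simp add: powi_tendsto_at_infinity)
    qed
  qed
  ultimately show ?thesis by simp
qed

lemma lim_zero_line_iff:
  assumes M: "Hausdorff_space M" and \<beta>: "strict_mono_on {..k} \<beta>" and i: "i \<le> k"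
    and v: "v \<in> V" "vsupp E k v \<noteq> {}" and z: "z \<in> Psub E k {i}"
  shows "lim_zero E k \<beta> (line E k v) z \<longleftrightarrow>
    i \<in> vsupp E k v \<and> vsupp E k v \<subseteq> {i..} \<and> z = line E k (part {i} v)"
proof -
  have "insert i {i<..} = {i..}" by auto
  moreover have "lim_zero E k \<beta> (line E k v) z \<longleftrightarrow>
    i \<in> vsupp E k v \<and> vsupp E k v \<subseteq> insert i {i<..} \<and> z = line E k (part {i} v)"
    unfolding lim_zero_def
  proof (rule limitin_line_iff[OF M _ _ _ _ v z])
    show "at 0 \<noteq> (bot :: complex filter)" by simp
    show "\<forall>\<^sub>F c::complex in at 0. c \<noteq> 0" by (simp add: eventually_at_filter)
    show "((\<lambda>c::complex. c powi (\<beta> j - \<beta> i)) \<longlongrightarrow> 0) (at 0)" if "j \<le> k" "j \<in> {i<..}" for j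
    proof -
      have "\<beta> i < \<beta> j" by (rule strict_mono_onD[OF \<beta>]) (use that i in auto)
      then show ?thesis by (simp add: powi_tendsto_at_0)
    qed
    show "((\<lambda>c::complex. c powi (\<beta> i - \<beta> j)) \<longlongrightarrow> 0) (at 0)" if "j \<le> k" "j \<notin> insert i {i<..}" for j
    proof -
      have "\<beta> j < \<beta> i" by (rule strict_mono_onD[OF \<beta>]) (use that i in auto)
      then show ?thesis by (simp add: powi_tendsto_at_0)
    qed
  qed
  ultimately show ?thesis by simp
qed

definition SUrep where
  "SUrep i v v' \<longleftrightarrow> v \<in> V \<and> v' \<in> V \<and> vbase E v' = vbase E v \<and> v i = v' i \<and>
     i \<in> vsupp E k v \<and> vsupp E k v \<subseteq> {..i} \<and> i \<in> vsupp E k v' \<and> vsupp E k v' \<subseteq> {i..}"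

lemma SU_iff:
  assumes M: "Hausdorff_space M" and \<beta>: "strict_mono_on {..k} \<beta>" and i: "i \<le> k"
  shows "(x, y) \<in> SU E k \<beta> i \<longleftrightarrow> (\<exists>v v'. SUrep i v v' \<and> x = line E k v \<and> y = line E k v')"
proof
  assume "(x, y) \<in> SU E k \<beta> i"
  then obtain z where xy: "x \<in> topspace (PE E k)" "y \<in> topspace (PE E k)"
    and z: "z \<in> Psub E k {i}" "lim_infty E k \<beta> x z" "lim_zero E k \<beta> y z"
    by (auto simp: SU_def stable_def unstable_def)
  obtain v where v: "v \<in> V" "vsupp E k v \<noteq> {}" "x = line E k v" using xy by (auto simp: topspace_PE)
  obtain w where w: "w \<in> V" "vsupp E k w \<noteq> {}" "y = line E k w" using xy by (auto simp: topspace_PE)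
  have v2: "i \<in> vsupp E k v" "vsupp E k v \<subseteq> {..i}" "z = line E k (part {i} v)"
    using z v lim_infty_line_iff[OF M \<beta> i v(1,2) z(1)] by auto
  have w2: "i \<in> vsupp E k w" "vsupp E k w \<subseteq> {i..}" "z = line E k (part {i} w)"
    using z w lim_zero_line_iff[OF M \<beta> i w(1,2) z(1)] by auto
  have pV: "part {i} w \<in> V" "part {i} v \<in> V" "vsupp E k (part {i} v) \<noteq> {}"
    using v w v2 by (auto simp: vsupp_part)
  have le: "line E k (part {i} w) = line E k (part {i} v)" using v2 w2 by simp
  from line_eqD[OF pV le] obtain t where t: "t \<noteq> 0" "part {i} v = vscale E k t (part {i} w)" .
  have "vbase E (part {i} v) = vbase E (part {i} w)" using t pV by simp
  then have b: "vbase E v = vbase E w" using v w by simp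
  have "v i = part {i} v i" using i by (simp add: part_def)
  also have "\<dots> = vscale E k t w i" unfolding t(2) using i by (simp add: part_def vscale_def)
  finally have "SUrep i v (vscale E k t w)"
    using v w v2 w2 b t by (auto simp: SUrep_def vsupp_vscale)
  then show "\<exists>v v'. SUrep i v v' \<and> x = line E k v \<and> y = line E k v'"
    using v w t line_vscale by metis
next
  assume "\<exists>v v'. SUrep i v v' \<and> x = line E k v \<and> y = line E k v'"
  then obtain v v' where r: "SUrep i v v'" and xy: "x = line E k v" "y = line E k v'" by blast
  have v: "v \<in> V" "v' \<in> V" "vsupp E k v \<noteq> {}" "vsupp E k v' \<noteq> {}"
    using r by (auto simp: SUrep_def)
  have p: "part {i} v = part {i} v'" using r by (auto simp: SUrep_def part_def)
  let ?z = "line E k (part {i} v)"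
  have z: "?z \<in> Psub E k {i}" using v r
    by (subst line_in_Psub) (auto simp: vsupp_part SUrep_def)
  have "lim_infty E k \<beta> x ?z" "lim_zero E k \<beta> y ?z"
    using lim_infty_line_iff[OF M \<beta> i v(1,3) z] lim_zero_line_iff[OF M \<beta> i v(2,4) z] r p xy
    by (auto simp: SUrep_def)
  then show "(x, y) \<in> SU E k \<beta> i"
    using z xy v line_in_PE by (auto simp: SU_def stable_def unstable_def)
qed

lemma SUrep_co: "SUrep i v v' \<Longrightarrow> vbase E v \<in> Tr T \<Longrightarrow> q \<in> Ix \<Longrightarrow> fst q = i \<Longrightarrow> co T q v' = co T q v"
  by (simp add: SUrep_def co_def)

lemma PP_box_open:
  assumes "openin (PE E k) A" "openin (PE E k) B"
  shows "openin (PP E k) ((A \<times> B) \<inter> {(x, y). pbase E x = pbase E y})"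
  unfolding PP_def using assms by (intro openin_subtopology_Int) (simp add: openin_prod_Times_iff)

lemma mem_PP: "v \<in> V \<Longrightarrow> v' \<in> V \<Longrightarrow> vsupp E k v \<noteq> {} \<Longrightarrow> vsupp E k v' \<noteq> {} \<Longrightarrow>
   (line E k v, line E k v') \<in> topspace (PP E k) \<longleftrightarrow> vbase E v = vbase E v'"
  by (auto simp: PP_def pbase_line line_in_PE)

lemma SU_subset_PP:
  assumes M: "Hausdorff_space M" and \<beta>: "strict_mono_on {..k} \<beta>" and i: "i \<le> k"
  shows "SU E k \<beta> i \<subseteq> topspace (PP E k)"
proof clarify
  fix x y assume "(x, y) \<in> SU E k \<beta> i"
  then obtain v v' where r: "SUrep i v v'" "x = line E k v" "y = line E k v'"
    using SU_iff[OF M \<beta> i] by blast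
  then show "(x, y) \<in> topspace (PP E k)" using mem_PP[of v v'] by (auto simp: SUrep_def)
qed

lemma SU_subset_chart:
  assumes M: "Hausdorff_space M" and \<beta>: "strict_mono_on {..k} \<beta>" and i: "i \<le> k"
    and xy: "(x, y) \<in> SU E k \<beta> i"
  shows "x \<in> chart_dom E k i" "y \<in> chart_dom E k i"
proof -
  obtain v v' where r: "SUrep i v v'" "x = line E k v" "y = line E k v'"
    using SU_iff[OF M \<beta> i] xy by blast
  have "vsupp E k v \<noteq> {}" "vsupp E k v' \<noteq> {}" using r by (auto simp: SUrep_def)
  then show "x \<in> chart_dom E k i" "y \<in> chart_dom E k i"
    using r line_in_chart_dom[of v i] line_in_chart_dom[of v' i] by (auto simp: SUrep_def)
qed

lemma openin_chart_dom: "openin (PE E k) (chart_dom E k i)"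
proof (subst openin_subopen, intro ballI)
  fix x assume x: "x \<in> chart_dom E k i"
  then have "x \<in> topspace (PE E k)" by (simp add: chart_dom_def)
  then obtain v where v: "v \<in> V" "vsupp E k v \<noteq> {}" "x = line E k v" by (auto simp: topspace_PE)
  then have i: "i \<in> vsupp E k v" using x line_in_chart_dom by blast
  obtain T where T: "vbase E v \<in> Tr T" using Tr_obtain vbase_in_M[OF v(1)] by blast
  obtain q0 where q0: "q0 \<in> Ix" "fst q0 = i" "co T q0 v \<noteq> 0" using vsupp_obtain[OF v(1) T i] by metis
  obtain u where u: "u \<in> V" "line E k u = line E k v" "vbase E u = vbase E v" "co T q0 u = 1"
    using normalize[OF v(1) T q0(1,3)] by metis
  let ?S = "line E k ` slice T q0 (Tr T) (\<lambda>q. co T q u) 1"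
  have "openin (PE E k) ?S" using q0 by (intro slice_open openin_Tr) auto
  moreover have "u \<in> slice T q0 (Tr T) (\<lambda>q. co T q u) 1" using u T by (simp add: slice_def)
  then have "x \<in> ?S" using u v by (metis imageI)
  moreover have "?S \<subseteq> chart_dom E k i"
  proof
    fix y assume "y \<in> ?S"
    then obtain w where w: "w \<in> V" "vbase E w \<in> Tr T" "co T q0 w = 1" "y = line E k w"
      by (auto simp: slice_def)
    then have "i \<in> vsupp E k w" using nonzero_vsupp[of w T q0] q0 by simp
    then show "y \<in> chart_dom E k i" using line_in_chart_dom[of w i] w by auto
  qed
  ultimately show "\<exists>S. openin (PE E k) S \<and> x \<in> S \<and> S \<subseteq> chart_dom E k i" by blast
qed

lemma C_infty_chart:
  assumes M: "Hausdorff_space M" and \<beta>: "strict_mono_on {..k} \<beta>" and i: "i \<le> k"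
    and cl: "(x, y) \<in> C_infty E k \<beta> i" and x: "x \<in> chart_dom E k i" and y: "y \<in> chart_dom E k i"
  shows "(x, y) \<in> SU E k \<beta> i"
proof -
  have xy: "(x, y) \<in> topspace (PP E k)" using cl by (simp add: C_infty_def in_closure_of)
  have "x \<in> topspace (PE E k)" "y \<in> topspace (PE E k)" using x y by (auto simp: chart_dom_def)
  then obtain v0 v0' where v0: "v0 \<in> V" "vsupp E k v0 \<noteq> {}" "x = line E k v0"
    and v0': "v0' \<in> V" "vsupp E k v0' \<noteq> {}" "y = line E k v0'" by (auto simp: topspace_PE)
  have b0: "vbase E v0' = vbase E v0" using mem_PP[of v0 v0'] xy v0 v0' by simp
  have i0: "i \<in> vsupp E k v0" "i \<in> vsupp E k v0'"
    using x y v0 v0' line_in_chart_dom by blast+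
  obtain T where T: "vbase E v0 \<in> Tr T" using Tr_obtain vbase_in_M[OF v0(1)] by blast
  have T': "vbase E v0' \<in> Tr T" using T b0 by simp
  obtain q0 where q0: "q0 \<in> Ix" "fst q0 = i" "co T q0 v0 \<noteq> 0" using vsupp_obtain[OF v0(1) T i0(1)] by metis
  obtain q1 where q1: "q1 \<in> Ix" "fst q1 = i" "co T q1 v0' \<noteq> 0" using vsupp_obtain[OF v0'(1) T' i0(2)] by metis
  obtain v where v: "v \<in> V" "line E k v = x" "vbase E v = vbase E v0" "vsupp E k v = vsupp E k v0"
    "co T q0 v = 1" using normalize[OF v0(1) T q0(1,3)] v0 by metis
  obtain v' where v': "v' \<in> V" "line E k v' = y" "vbase E v' = vbase E v0'" "vsupp E k v' = vsupp E k v0'"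
    "co T q1 v' = 1" using normalize[OF v0'(1) T' q1(1,3)] v0' by metis
  define near where "near n w w' \<longleftrightarrow>
    (\<forall>q\<in>Ix. norm (co T q w - co T q v) < inverse (real (Suc n))) \<and>
    (\<forall>q\<in>Ix. norm (co T q w' - co T q v') < inverse (real (Suc n))) \<and>
    (\<forall>q\<in>Ix. i < fst q \<longrightarrow> co T q w = 0) \<and> (\<forall>q\<in>Ix. fst q < i \<longrightarrow> co T q w' = 0) \<and>
    (\<forall>q\<in>Ix. fst q = i \<longrightarrow> co T q w' = co T q w * co T q0 w')" for n w w'
  have "\<exists>w w'. near n w w'" for n
  proof -
    let ?A = "slice T q0 (Tr T) (\<lambda>q. co T q v) (inverse (real (Suc n)))"
    let ?B = "slice T q1 (Tr T) (\<lambda>q. co T q v') (inverse (real (Suc n)))"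
    let ?O = "(line E k ` ?A) \<times> (line E k ` ?B) \<inter> {(x, y). pbase E x = pbase E y}"
    have "openin (PP E k) ?O" using q0 q1 by (intro PP_box_open slice_open openin_Tr) auto
    moreover have "v \<in> ?A" "v' \<in> ?B" using v v' T T' by (auto simp: slice_def)
    then have "(x, y) \<in> ?O" using v v' xy by (auto simp: PP_def)
    moreover have "\<forall>Q. (x, y) \<in> Q \<and> openin (PP E k) Q \<longrightarrow> (\<exists>p. p \<in> SU E k \<beta> i \<and> p \<in> Q)"
      using cl unfolding C_infty_def in_closure_of by (rule conjunct2)
    ultimately obtain p where p: "p \<in> SU E k \<beta> i" "p \<in> ?O" by meson
    then obtain w w' where w: "w \<in> ?A" "w' \<in> ?B" and pw: "p = (line E k w, line E k w')" by auto
    obtain r r' where r: "SUrep i r r'" "line E k r = line E k w" "line E k r' = line E k w'"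
      using p(1) pw SU_iff[OF M \<beta> i] by metis
    have wT: "w \<in> V" "vbase E w \<in> Tr T" "co T q0 w = 1" "w' \<in> V" "vbase E w' \<in> Tr T" "co T q1 w' = 1"
      using w by (auto simp: slice_def)
    then have wnz: "vsupp E k w \<noteq> {}" "vsupp E k w' \<noteq> {}"
      using nonzero_vsupp[of w T q0] nonzero_vsupp[of w' T q1] q0 q1 by auto
    have rV: "r \<in> V" "r' \<in> V" using r by (auto simp: SUrep_def)
    obtain t where t: "t \<noteq> 0" "w = vscale E k t r" using line_eqD[OF rV(1) wT(1) wnz(1) r(2)] .
    obtain t' where t': "t' \<noteq> 0" "w' = vscale E k t' r'" using line_eqD[OF rV(2) wT(4) wnz(2) r(3)] .
    have rT: "vbase E r \<in> Tr T" "vbase E r' \<in> Tr T" using wT t t' rV by auto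
    have cw: "co T q w = t * co T q r" "co T q w' = t' * co T q r'" if "q \<in> Ix" for q
      using t t' rV rT that by (auto simp: co_vscale)
    have c0: "i < fst q \<Longrightarrow> co T q r = 0" "fst q < i \<Longrightarrow> co T q r' = 0" if "q \<in> Ix" for q
      using r(1) co_zero[OF rV(1) rT(1) that] co_zero[OF rV(2) rT(2) that] by (force simp: SUrep_def)+
    have "co T q w' = co T q w * co T q0 w'" if q: "q \<in> Ix" "fst q = i" for q
    proof -
      have "t * co T q0 r = 1" using wT cw[OF q0(1)] by simp
      then have "t' * co T q r = t * co T q r * (t' * co T q0 r)" by (simp add: algebra_simps)
      then show ?thesis
        using cw[OF q(1)] cw[OF q0(1)] SUrep_co[OF r(1) rT(1)] q q0 by simp
    qed
    then have "near n w w'" using w cw c0 unfolding near_def by (auto simp: slice_def)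
    then show ?thesis by blast
  qed
  then obtain w w' where n: "\<And>n. near n (w n) (w' n)" by metis
  have lim: "(\<lambda>n. co T q (w n)) \<longlonglongrightarrow> co T q v" "(\<lambda>n. co T q (w' n)) \<longlonglongrightarrow> co T q v'" if "q \<in> Ix" for q
    using n that by (intro LIMSEQ_of_bound; force simp: near_def)+
  have gt: "co T q v = 0" if q: "q \<in> Ix" "i < fst q" for q
  proof -
    have "(\<lambda>n. co T q (w n)) = (\<lambda>n. 0)" using n q by (auto simp: near_def)
    then show ?thesis using lim(1)[OF q(1)] by (simp add: LIMSEQ_const_iff)
  qed
  have lt: "co T q v' = 0" if q: "q \<in> Ix" "fst q < i" for q
  proof -
    have "(\<lambda>n. co T q (w' n)) = (\<lambda>n. 0)" using n q by (auto simp: near_def)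
    then show ?thesis using lim(2)[OF q(1)] by (simp add: LIMSEQ_const_iff)
  qed
  have eq: "co T q v' = co T q v * co T q0 v'" if q: "q \<in> Ix" "fst q = i" for q
  proof -
    have "(\<lambda>n. co T q (w' n)) = (\<lambda>n. co T q (w n) * co T q0 (w' n))" using n q by (auto simp: near_def)
    then have "(\<lambda>n. co T q (w' n)) \<longlonglongrightarrow> co T q v * co T q0 v'"
      using tendsto_mult[OF lim(1)[OF q(1)] lim(2)[OF q0(1)]] by simp
    then show ?thesis using lim(2)[OF q(1)] LIMSEQ_unique by blast
  qed
  have nz: "co T q0 v' \<noteq> 0" using eq[OF q1(1,2)] v'(5) by auto
  let ?v = "vscale E k (inverse (co T q0 v')) v'"
  have vT: "vbase E v \<in> Tr T" "vbase E v' \<in> Tr T" using T T' v v' by auto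
  have "v i = ?v i"
  proof (subst comp_eq_iff[where T = T])
    show "\<forall>p<rank (E i). co T (i, p) v = co T (i, p) ?v"
    proof (intro allI impI)
      fix p assume "p < rank (E i)"
      then have q: "(i, p) \<in> Ix" using i by (simp add: Ix_def)
      show "co T (i, p) v = co T (i, p) ?v"
        using eq[OF q] nz co_vscale[OF v'(1) vT(2) q] by simp
    qed
  qed (use v v' vT b0 i in auto)
  moreover have "vsupp E k v \<subseteq> {..i}"
  proof
    fix j assume "j \<in> vsupp E k v"
    from vsupp_obtain[OF v(1) vT(1) this] show "j \<in> {..i}" using gt by (metis atMost_iff not_le)
  qed
  moreover have "vsupp E k v' \<subseteq> {i..}"
  proof
    fix j assume "j \<in> vsupp E k v'"
    from vsupp_obtain[OF v'(1) vT(2) this] show "j \<in> {i..}" using lt by (metis atLeast_iff not_le)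
  qed
  ultimately have "SUrep i v ?v"
    using v v' b0 i0 nz by (auto simp: SUrep_def vsupp_vscale)
  moreover have "line E k ?v = y" using line_vscale[OF v'(1)] nz v' by simp
  ultimately show ?thesis using SU_iff[OF M \<beta> i] v(2) by blast
qed


section \<open>The cone and the strict transform\<close>

lemma hom_obtain:
  assumes g: "g \<in> topspace (Hom E k i J)" and u: "u \<in> V" "vsupp E k u = {i}" "fst g = line E k u"
  obtains b where "g = hom_of E k (u, b)" "(u, b) \<in> topspace (HX i J)"
proof -
  obtain p where p: "p \<in> topspace (HX i J)" "g = hom_of E k p"
    using g unfolding topspace_Hom by blast
  obtain u' b' where p': "p = (u', b')" by (meson surj_pair)
  have ub: "(u', b') \<in> topspace (HX i J)" "g = hom_of E k (u', b')" using p p' by simp_all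
  then have uV: "u' \<in> V" "b' \<in> V" "vsupp E k u' = {i}" unfolding mem_HX by auto
  have e: "line E k u' = line E k u" using u(3) ub(2) by simp
  have ne: "vsupp E k u \<noteq> {}" using u by simp
  from line_eqD[OF uV(1) u(1) ne e] obtain t where t: "t \<noteq> 0" "u = vscale E k t u'" .
  have "hom_of E k (vscale E k t u', vscale E k t b') = hom_of E k (u', b')"
    by (rule hom_of_vscale) (use uV t in auto)
  then have "g = hom_of E k (u, vscale E k t b')" using ub t by simp
  moreover have "(u, vscale E k t b') \<in> topspace (HX i J)" using HX_vscale[OF ub(1) t(1)] t(2) by simp
  ultimately show ?thesis by (rule that)
qed

lemma graph_hom_of:
  assumes "u \<in> V" "a \<in> V" "b \<in> V" "vbase E a = vbase E u" "vbase E b = vbase E u" "vsupp E k u \<noteq> {}"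
  shows "graph E k (hom_of E k (u, a), hom_of E k (u, b)) = line E k (vadd E k u (vadd E k a b))"
proof -
  have "vadd E k (vscale E k c u) (vadd E k (snd (hom_of E k (u, a)) (vscale E k c u))
          (snd (hom_of E k (u, b)) (vscale E k c u))) = vscale E k c (vadd E k u (vadd E k a b))" for c
    using assms by (simp add: snd_hom_of vscale_vadd)
  then show ?thesis unfolding graph_def by (simp add: line_def image_image)
qed

lemma hom_zero_line:
  assumes "u \<in> V" "vsupp E k u \<noteq> {}"
  shows "hom_zero E k (line E k u) = hom_of E k (u, vscale E k 0 u)"
proof (rule prod_eqI)
  show "snd (hom_zero E k (line E k u)) = snd (hom_of E k (u, vscale E k 0 u))"
  proof
    fix x
    show "snd (hom_zero E k (line E k u)) x = snd (hom_of E k (u, vscale E k 0 u)) x"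
    proof (cases "x \<in> line E k u")
      case True
      then obtain c where "x = vscale E k c u" by (auto simp: line_def)
      then show ?thesis using True assms by (simp add: hom_zero_def snd_hom_of vscale_vscale)
    qed (simp add: hom_zero_def hom_of_def)
  qed
qed (simp add: hom_zero_def)

lemma hom_act_hom_of:
  assumes "u \<in> V" "a \<in> V" "vsupp E k u \<noteq> {}"
  shows "hom_act E k \<beta> i c (hom_of E k (u, a)) = hom_of E k (u, vact E k (\<lambda>j. \<beta> j - \<beta> i) c a)"
proof (rule prod_eqI)
  show "snd (hom_act E k \<beta> i c (hom_of E k (u, a))) =
      snd (hom_of E k (u, vact E k (\<lambda>j. \<beta> j - \<beta> i) c a))"
  proof
    fix x
    show "snd (hom_act E k \<beta> i c (hom_of E k (u, a))) x =
      snd (hom_of E k (u, vact E k (\<lambda>j. \<beta> j - \<beta> i) c a)) x"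
    proof (cases "x \<in> line E k u")
      case True
      then obtain d where x: "x = vscale E k d u" by (auto simp: line_def)
      have "snd (hom_act E k \<beta> i c (hom_of E k (u, a))) x = vact E k (\<lambda>j. \<beta> j - \<beta> i) c (vscale E k d a)"
        using True assms snd_hom_of[OF assms(1,3)] by (simp add: hom_act_def x vact_def)
      then show ?thesis using assms by (simp add: x snd_hom_of vact_vscale)
    qed (simp add: hom_act_def hom_of_def)
  qed
qed (simp add: hom_act_def)

lemma hom_of_eq_normalized:
  assumes "(u, a) \<in> topspace (HX i J)" "(u', a') \<in> topspace (HX i J')"
    and T: "vbase E u \<in> Tr T" and q0: "q0 \<in> Ix" "co T q0 u = 1" "co T q0 u' = 1"
  shows "line E k u = line E k u' \<Longrightarrow> u' = u"
    and "hom_of E k (u, a) = hom_of E k (u', a') \<Longrightarrow> u' = u \<and> a' = a"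
proof -
  have V: "u \<in> V" "a \<in> V" "u' \<in> V" "a' \<in> V" "vsupp E k u \<noteq> {}" "vsupp E k u' \<noteq> {}"
    using assms(1,2) unfolding mem_HX by auto
  have *: "u' = u" "t = 1" if "u' = vscale E k t u" for t
  proof -
    show "t = 1" using that q0 co_vscale[OF V(1) T q0(1), of t] by simp
    then show "u' = u" using that V by (simp add: vscale_one)
  qed
  show "u' = u" if "line E k u = line E k u'"
    using line_eqD[OF V(1,3,6) that] *(1) by metis
  show "u' = u \<and> a' = a" if h: "hom_of E k (u, a) = hom_of E k (u', a')"
  proof -
    obtain t where t: "u' = vscale E k t u" "a' = vscale E k t a" using hom_of_eqD[OF V h] .
    then show ?thesis using *[OF t(1)] V by (simp add: vscale_one)
  qed
qed

lemma part_sum: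
  assumes w: "w \<in> V"
  shows "vadd E k (part {i} w) (vadd E k (part {..<i} w) (part {i<..} w)) = w"
proof -
  obtain T where T: "vbase E w \<in> Tr T" using Tr_obtain vbase_in_M[OF w] by blast
  show ?thesis
  proof (rule co_eqI[of _ _ T])
    fix q assume q: "q \<in> Ix"
    show "co T q (vadd E k (part {i} w) (vadd E k (part {..<i} w) (part {i<..} w))) = co T q w"
      using w T q by (auto simp: co_vadd co_part)
  qed (use w T in auto)
qed

lemma SUrep_vscale:
  assumes "SUrep i v v'" "t \<noteq> 0" "i \<le> k"
  shows "SUrep i (vscale E k t v) (vscale E k t v')"
  using assms by (auto simp: SUrep_def vsupp_vscale) (simp add: vscale_def)

lemma vsupp_le: "vsupp E k v \<subseteq> {..k}"
  by (auto simp: vsupp_def)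

lemma strict_transform_subset_cone:
  assumes M: "Hausdorff_space M" and \<beta>: "strict_mono_on {..k} \<beta>" and i: "i \<le> k"
    and A: "A = s ` topspace M \<inter> chart_dom E k i"
    and SU: "(x, y) \<in> SU E k \<beta> i" and st: "(p1 0 1, (x, y)) \<in> strict_transform M E k \<beta> s"
  shows "(x, y) \<in> G1 E k \<beta> i A"
proof -
  obtain v0 v0' where r0: "SUrep i v0 v0'" "x = line E k v0" "y = line E k v0'"
    using SU SU_iff[OF M \<beta> i] by blast
  then have v0: "v0 \<in> V" "v0' \<in> V" "i \<in> vsupp E k v0" by (auto simp: SUrep_def)
  obtain T where T0: "vbase E v0 \<in> Tr T" using Tr_obtain vbase_in_M[OF v0(1)] by blast
  obtain q0 where q0: "q0 \<in> Ix" "fst q0 = i" "co T q0 v0 \<noteq> 0" using vsupp_obtain[OF v0(1) T0 v0(3)] .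
  obtain v t where vt: "v = vscale E k t v0" "t \<noteq> 0" "v \<in> V" "line E k v = line E k v0"
    "vbase E v = vbase E v0" "co T q0 v = 1"
    using normalize[OF v0(1) T0 q0(1,3)] by metis
  define v' where "v' = vscale E k t v0'"
  have r: "SUrep i v v'" unfolding v'_def vt(1) using r0(1) vt(2) i by (rule SUrep_vscale)
  have xy: "x = line E k v" "y = line E k v'"
    using r0 vt v0 line_vscale by (simp_all add: v'_def)
  have v: "v \<in> V" "v' \<in> V" "vbase E v' = vbase E v" "i \<in> vsupp E k v" "vsupp E k v \<subseteq> {..i}"
    "i \<in> vsupp E k v'" "vsupp E k v' \<subseteq> {i..}" "v i = v' i"
    using r unfolding SUrep_def by auto
  have T: "vbase E v \<in> Tr T" "vbase E v' \<in> Tr T" using T0 vt v by auto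
  have q0v': "co T q0 v' = 1" using SUrep_co[OF r T(1) q0(1,2)] vt by simp
  define u where "u = part {i} v"
  define a where "a = part {..<i} v"
  define b where "b = vscale E k 0 u"
  define d where "d = part {i<..} v'"
  have uV: "u \<in> V" "a \<in> V" "b \<in> V" "d \<in> V" "vbase E u = vbase E v" "vbase E a = vbase E v"
    "vbase E b = vbase E v" "vbase E d = vbase E v" "vsupp E k u = {i}" "vsupp E k b = {}"
    using v by (auto simp: u_def a_def b_def d_def vsupp_part vsupp_vscale_zero)
  have hu: "(u, a) \<in> topspace (HX i {..<i})" "(u, b) \<in> topspace (HX i {i<..k})"
    "(u, d) \<in> topspace (HX i {i<..k})"
    unfolding mem_HX using uV v vsupp_le[of v'] by (auto simp: a_def d_def vsupp_part)
  have hT: "vbase E u \<in> Tr T" using uV T by simp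
  have cu: "co T q u = (if fst q = i then co T q v else 0)" "co T q a = (if fst q < i then co T q v else 0)"
    "co T q b = 0" "co T q d = (if i < fst q then co T q v' else 0)" if q: "q \<in> Ix" for q
    using v T uV q by (simp_all add: u_def a_def b_def d_def co_part co_vscale)
  have c0: "i < fst q \<Longrightarrow> co T q v = 0" "fst q < i \<Longrightarrow> co T q v' = 0" if q: "q \<in> Ix" for q
    by (rule co_zero[OF v(1) T(1) q], use v(5) in force)
       (rule co_zero[OF v(2) T(2) q], use v(7) in force)
  have gx: "graph E k (hom_of E k (u, a), hom_of E k (u, b)) = x"
  proof -
    have "vadd E k u (vadd E k a b) = v"
    proof (rule co_eqI[of _ _ T])
      fix q assume q: "q \<in> Ix"
      have "co T q (vadd E k u (vadd E k a b)) = co T q u + (co T q a + co T q b)"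
        using uV T q by (simp add: co_vadd)
      then show "co T q (vadd E k u (vadd E k a b)) = co T q v"
        using cu[OF q] c0[OF q] by (cases "fst q" i rule: linorder_cases) auto
    qed (use v T uV in auto)
    then show ?thesis using graph_hom_of uV xy by simp
  qed
  have gy: "graph E k (hom_zero E k (line E k u), hom_of E k (u, d)) = y"
  proof -
    have "vadd E k u (vadd E k b d) = v'"
    proof (rule co_eqI[of _ _ T])
      fix q assume q: "q \<in> Ix"
      have "co T q (vadd E k u (vadd E k b d)) = co T q u + (co T q b + co T q d)"
        using uV T q by (simp add: co_vadd)
      then show "co T q (vadd E k u (vadd E k b d)) = co T q v'"
        using cu[OF q] c0[OF q] SUrep_co[OF r T(1) q] by (cases "fst q" i rule: linorder_cases) auto
    qed (use v T uV in auto)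
    then show ?thesis using graph_hom_of uV xy by (simp add: hom_zero_line b_def)
  qed
  let ?F = "{(f, g). fst f = fst g} :: ('e hom \<times> 'e hom) set"
  let ?Z = "subtopology (prod_topology (Epm E k i) (Eplus E k i)) {((f, g), h). fst g = fst h}"
  let ?S = "{((f, g), hom_act E k \<beta> i c g) | f g c.
                     (f, g) \<in> topspace (Epm E k i) \<and> graph E k (f, g) \<in> A \<and> c \<noteq> 0}"
  have tops: "hom_of E k (u, a) \<in> topspace (Eminus E k i)" "hom_of E k (u, b) \<in> topspace (Eplus E k i)"
    "hom_of E k (u, d) \<in> topspace (Eplus E k i)"
    unfolding topspace_Hom using hu by blast+
  have "((hom_of E k (u, a), hom_of E k (u, b)), hom_of E k (u, d)) \<in> ?Z closure_of ?S"
    unfolding in_closure_of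
  proof (intro conjI allI impI)
    show "((hom_of E k (u, a), hom_of E k (u, b)), hom_of E k (u, d)) \<in> topspace ?Z"
      using tops by (simp add: Epm_def)
    fix W assume W: "((hom_of E k (u, a), hom_of E k (u, b)), hom_of E k (u, d)) \<in> W \<and> openin ?Z W"
    then obtain W1 where W1: "openin (prod_topology (Epm E k i) (Eplus E k i)) W1"
      "W = W1 \<inter> {((f, g), h). fst g = fst h}" unfolding openin_subtopology by blast
    have "((hom_of E k (u, a), hom_of E k (u, b)), hom_of E k (u, d)) \<in> W1" using W W1 by blast
    with W1(1) obtain W2 Wh where W2: "openin (Epm E k i) W2" "(hom_of E k (u, a), hom_of E k (u, b)) \<in> W2"
      and Wh: "openin (Eplus E k i) Wh" "hom_of E k (u, d) \<in> Wh" and sub1: "W2 \<times> Wh \<subseteq> W1"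
      by (rule prod_topology_nbhd) (rule that)
    obtain W3 where W3: "openin (prod_topology (Eminus E k i) (Eplus E k i)) W3" "W2 = W3 \<inter> ?F"
      using W2(1) unfolding Epm_def openin_subtopology by blast
    have "(hom_of E k (u, a), hom_of E k (u, b)) \<in> W3" using W2 W3 by blast
    with W3(1) obtain Wf Wg where Wf: "openin (Eminus E k i) Wf" "hom_of E k (u, a) \<in> Wf"
      and Wg: "openin (Eplus E k i) Wg" "hom_of E k (u, b) \<in> Wg" and sub2: "Wf \<times> Wg \<subseteq> W3"
      by (rule prod_topology_nbhd) (rule that)
    have ni: "i \<notin> {..<i}" "i \<notin> {i<..k}" by auto
    obtain Nf \<epsilon>f where Nf: "openin M Nf" "vbase E u \<in> Nf" "Nf \<subseteq> Tr T" "0 < \<epsilon>f"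
      "\<And>u' a'. (u', a') \<in> topspace (HX i {..<i}) \<Longrightarrow> vbase E u' \<in> Nf \<Longrightarrow>
       \<forall>q\<in>Ix. norm (hco T q (u', a') - hco T q (u, a)) < \<epsilon>f \<Longrightarrow> hom_of E k (u', a') \<in> Wf"
      by (rule hslice_nbhd[OF Wf hu(1) hT ni(1)]) (rule that)
    obtain Ng \<epsilon>g where Ng: "openin M Ng" "vbase E u \<in> Ng" "Ng \<subseteq> Tr T" "0 < \<epsilon>g"
      "\<And>u' a'. (u', a') \<in> topspace (HX i {i<..k}) \<Longrightarrow> vbase E u' \<in> Ng \<Longrightarrow>
       \<forall>q\<in>Ix. norm (hco T q (u', a') - hco T q (u, b)) < \<epsilon>g \<Longrightarrow> hom_of E k (u', a') \<in> Wg"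
      by (rule hslice_nbhd[OF Wg hu(2) hT ni(2)]) (rule that)
    obtain Nh \<epsilon>h where Nh: "openin M Nh" "vbase E u \<in> Nh" "Nh \<subseteq> Tr T" "0 < \<epsilon>h"
      "\<And>u' a'. (u', a') \<in> topspace (HX i {i<..k}) \<Longrightarrow> vbase E u' \<in> Nh \<Longrightarrow>
       \<forall>q\<in>Ix. norm (hco T q (u', a') - hco T q (u, d)) < \<epsilon>h \<Longrightarrow> hom_of E k (u', a') \<in> Wh"
      by (rule hslice_nbhd[OF Wh hu(3) hT ni(2)]) (rule that)
    define N where "N = Nf \<inter> Ng \<inter> Nh"
    define \<epsilon> where "\<epsilon> = min \<epsilon>f (min \<epsilon>g \<epsilon>h)"
    have N: "openin M N" "vbase E u \<in> N" "N \<subseteq> Tr T" "0 < \<epsilon>"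
      using Nf Ng Nh by (auto simp: N_def \<epsilon>_def)
    let ?A = "slice T q0 N (\<lambda>q. co T q v) \<epsilon>" and ?B = "slice T q0 N (\<lambda>q. co T q v') \<epsilon>"
    let ?O = "((line E k ` ?A) \<times> (line E k ` ?B)) \<inter> {(x, y). pbase E x = pbase E y}"
    have "openin (PP E k) ?O" using N q0 by (intro PP_box_open slice_open) auto
    then have "openin (prod_topology P1 (PP E k)) (topspace P1 \<times> ?O)" by (simp add: openin_prod_Times_iff)
    moreover have "v \<in> ?A" "v' \<in> ?B" using v vt q0v' N uV by (auto simp: slice_def)
    then have "(x, y) \<in> ?O" using v xy by (auto simp: pbase_line)
    moreover have "p1 0 1 \<in> topspace P1" using st by (simp add: strict_transform_def in_closure_of)
    ultimately have "\<exists>p. p \<in> {(p1 1 l, s m, pact E k \<beta> l (s m)) | l m. l \<noteq> 0 \<and> m \<in> topspace M} \<and>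
        p \<in> topspace P1 \<times> ?O"
      using st unfolding strict_transform_def in_closure_of by (meson mem_Times_iff SigmaI)
    then obtain P where P: "P \<in> {(p1 1 l, s m, pact E k \<beta> l (s m)) | l m. l \<noteq> 0 \<and> m \<in> topspace M}"
      "P \<in> topspace P1 \<times> ?O" by blast
    from P(1) obtain l m where P_eq: "P = (p1 1 l, s m, pact E k \<beta> l (s m))"
      and l: "l \<noteq> 0" and m: "m \<in> topspace M" by blast
    have sm: "s m \<in> line E k ` ?A" "pact E k \<beta> l (s m) \<in> line E k ` ?B"
      using P(2) unfolding P_eq by (simp_all only: mem_Sigma_iff Int_iff)
    then obtain w w' where w: "w \<in> ?A" "s m = line E k w" and w': "w' \<in> ?B" "pact E k \<beta> l (s m) = line E k w'"
      by blast
    have wV: "w \<in> V" "vbase E w \<in> N" "co T q0 w = 1" "w' \<in> V" "vbase E w' \<in> N" "co T q0 w' = 1"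
      and nr: "\<forall>q\<in>Ix. norm (co T q w - co T q v) < \<epsilon>" "\<forall>q\<in>Ix. norm (co T q w' - co T q v') < \<epsilon>"
      using w w' by (auto simp: slice_def)
    have wT: "vbase E w \<in> Tr T" "vbase E w' \<in> Tr T" using wV N by auto
    have iw: "i \<in> vsupp E k w" "i \<in> vsupp E k w'"
      using nonzero_vsupp[of w T q0] nonzero_vsupp[of w' T q0] wV wT q0 by auto
    then have wnz: "vsupp E k w \<noteq> {}" "vsupp E k w' \<noteq> {}" by auto
    have "line E k (vact E k \<beta> l w) = line E k w'" using w w' wV by (simp add: pact_line)
    then obtain t where t: "t \<noteq> 0" "w' = vscale E k t (vact E k \<beta> l w)"
      using line_eqD[of "vact E k \<beta> l w" w'] wV wnz by auto
    have cw': "co T q w' = l powi (\<beta> (fst q) - \<beta> i) * co T q w" if q: "q \<in> Ix" for q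
    proof -
      have c: "co T q w' = t * (l powi \<beta> (fst q) * co T q w)" if "q \<in> Ix" for q
        using t wV wT that by (simp add: co_vscale co_vact)
      have "t * l powi \<beta> i = 1" using c[OF q0(1)] wV q0 by simp
      then have "t = l powi (- \<beta> i)" using l by (simp add: power_int_minus field_simps)
      then show ?thesis using c[OF q] l by (simp add: powi_diff_mult)
    qed
    define u1 where "u1 = part {i} w"
    define a1 where "a1 = part {..<i} w"
    define b1 where "b1 = part {i<..} w"
    define d1 where "d1 = vact E k (\<lambda>j. \<beta> j - \<beta> i) l b1"
    have V1: "u1 \<in> V" "a1 \<in> V" "b1 \<in> V" "d1 \<in> V" "vbase E u1 = vbase E w" "vbase E a1 = vbase E w"
      "vbase E b1 = vbase E w" "vbase E d1 = vbase E w" "vsupp E k u1 = {i}"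
      using wV iw by (auto simp: u1_def a1_def b1_def d1_def vsupp_part)
    have h1: "(u1, a1) \<in> topspace (HX i {..<i})" "(u1, b1) \<in> topspace (HX i {i<..k})"
      "(u1, d1) \<in> topspace (HX i {i<..k})"
      unfolding mem_HX using V1 wV l vsupp_le[of w]
      by (auto simp: a1_def d1_def b1_def vsupp_part vsupp_vact)
    have "hom_of E k (u1, a1) \<in> Wf"
    proof (rule Nf(5)[OF h1(1)])
      show "\<forall>q\<in>Ix. norm (hco T q (u1, a1) - hco T q (u, a)) < \<epsilon>f"
      proof
        fix q assume q: "q \<in> Ix"
        have "norm (co T q w - co T q v) < \<epsilon>f" using nr(1) q by (auto simp: \<epsilon>_def)
        then show "norm (hco T q (u1, a1) - hco T q (u, a)) < \<epsilon>f"
          using q wT wV v T Nf(4) by (auto simp: hco_def u1_def a1_def u_def a_def co_part)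
      qed
    qed (use wV V1 N_def in auto)
    moreover have "hom_of E k (u1, b1) \<in> Wg"
    proof (rule Ng(5)[OF h1(2)])
      show "\<forall>q\<in>Ix. norm (hco T q (u1, b1) - hco T q (u, b)) < \<epsilon>g"
      proof
        fix q assume q: "q \<in> Ix"
        have "norm (co T q w - co T q v) < \<epsilon>g" using nr(1) q by (auto simp: \<epsilon>_def)
        moreover have "i < fst q \<Longrightarrow> co T q v = 0" using c0(1)[OF q] .
        moreover have "co T q b = 0" using uV T q by (simp add: b_def co_vscale)
        ultimately show "norm (hco T q (u1, b1) - hco T q (u, b)) < \<epsilon>g"
          using q wT wV v T Ng(4) by (auto simp: hco_def u1_def b1_def u_def co_part)
      qed
    qed (use wV V1 N_def in auto)
    moreover have "hom_of E k (u1, d1) \<in> Wh"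
    proof (rule Nh(5)[OF h1(3)])
      show "\<forall>q\<in>Ix. norm (hco T q (u1, d1) - hco T q (u, d)) < \<epsilon>h"
      proof
        fix q assume q: "q \<in> Ix"
        have "norm (co T q w' - co T q v') < \<epsilon>h" using nr(2) q by (auto simp: \<epsilon>_def)
        moreover have "co T q d1 = l powi (\<beta> (fst q) - \<beta> i) * co T q b1"
          using V1 wT q by (simp add: d1_def co_vact)
        moreover have "fst q = i \<Longrightarrow> co T q v' = co T q v" using SUrep_co[OF r T(1) q] .
        ultimately show "norm (hco T q (u1, d1) - hco T q (u, d)) < \<epsilon>h"
          using q wT wV v T Nh(4) cw'[OF q] by (auto simp: hco_def u1_def b1_def u_def d_def co_part)
      qed
    qed (use wV V1 N_def in auto)
    moreover have "hom_act E k \<beta> i l (hom_of E k (u1, b1)) = hom_of E k (u1, d1)"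
      using V1 by (simp add: hom_act_hom_of d1_def)
    moreover have "graph E k (hom_of E k (u1, a1), hom_of E k (u1, b1)) \<in> A"
    proof -
      have "graph E k (hom_of E k (u1, a1), hom_of E k (u1, b1)) = line E k w"
        using graph_hom_of V1 part_sum[OF wV(1)] by (simp add: u1_def a1_def b1_def)
      then show ?thesis using A m w(2) line_in_chart_dom[OF wV(1) wnz(1)] iw by (metis IntI imageI)
    qed
    moreover have "(hom_of E k (u1, a1), hom_of E k (u1, b1)) \<in> topspace (Epm E k i)"
    proof -
      have "hom_of E k (u1, a1) \<in> topspace (Eminus E k i)" "hom_of E k (u1, b1) \<in> topspace (Eplus E k i)"
        unfolding topspace_Hom using h1 by blast+
      then show ?thesis by (simp add: Epm_def)
    qed
    moreover have "(hom_of E k (u1, a1), hom_of E k (u1, b1)) \<in> W2"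
      using calculation(1,2) sub2 unfolding W3(2) by auto
    then have "((hom_of E k (u1, a1), hom_of E k (u1, b1)), hom_of E k (u1, d1)) \<in> W"
      using calculation(3) sub1 unfolding W1(2) by auto
    ultimately show "\<exists>p. p \<in> ?S \<and> p \<in> W"
      using l by (intro exI[of _ "((hom_of E k (u1, a1), hom_of E k (u1, b1)), hom_of E k (u1, d1))"] conjI)
        (rule CollectI, metis, assumption)
  qed
  then have "((hom_of E k (u, a), hom_of E k (u, b)), hom_of E k (u, d)) \<in> affine_cone E k \<beta> i A"
    unfolding affine_cone_def .
  then show ?thesis unfolding G1_def
    by (rule rev_image_eqI) (simp add: gx gy)
qed

lemma cone_subset_strict_transform:
  assumes M: "Hausdorff_space M" and \<beta>: "strict_mono_on {..k} \<beta>" and i: "i \<le> k"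
    and s: "\<And>m. m \<in> topspace M \<Longrightarrow> pbase E (s m) = m"
    and A: "A = s ` topspace M \<inter> chart_dom E k i"
    and SU: "(x, y) \<in> SU E k \<beta> i" and G: "(x, y) \<in> G1 E k \<beta> i A"
  shows "(p1 0 1, (x, y)) \<in> strict_transform M E k \<beta> s"
proof -
  let ?F = "{(f, g). fst f = fst g} :: ('e hom \<times> 'e hom) set"
  let ?H = "{((f, g), h). fst g = fst h} :: (('e hom \<times> 'e hom) \<times> 'e hom) set"
  let ?Z = "subtopology (prod_topology (Epm E k i) (Eplus E k i)) ?H"
  let ?S = "{((f, g), hom_act E k \<beta> i c g) | f g c.
                     (f, g) \<in> topspace (Epm E k i) \<and> graph E k (f, g) \<in> A \<and> c \<noteq> 0}"
  obtain f g h where cone: "((f, g), h) \<in> ?Z closure_of ?S"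
    and xy: "x = graph E k (f, g)" "y = graph E k (hom_zero E k (fst h), h)"
    using G unfolding G1_def affine_cone_def by auto
  then have "((f, g), h) \<in> topspace ?Z" by (simp add: in_closure_of)
  then have fgh: "f \<in> topspace (Eminus E k i)" "g \<in> topspace (Eplus E k i)" "h \<in> topspace (Eplus E k i)"
    "fst f = fst g" "fst g = fst h" by (auto simp: Epm_def)
  obtain p where p: "p \<in> topspace (HX i {..<i})" "f = hom_of E k p"
    using fgh(1) unfolding topspace_Hom by blast
  obtain u0 a0 where p0: "p = (u0, a0)" by (meson surj_pair)
  have u0: "u0 \<in> V" "vsupp E k u0 = {i}" "fst f = line E k u0" using p p0 by auto
  obtain T where T0: "vbase E u0 \<in> Tr T" using Tr_obtain vbase_in_M[OF u0(1)] by blast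
  have "i \<in> vsupp E k u0" using u0 by simp
  from vsupp_obtain[OF u0(1) T0 this] obtain q0 where q0: "q0 \<in> Ix" "fst q0 = i" "co T q0 u0 \<noteq> 0" .
  obtain u where u: "u \<in> V" "line E k u = line E k u0" "vbase E u = vbase E u0" "vsupp E k u = {i}"
    "co T q0 u = 1" using normalize[OF u0(1) T0 q0(1,3)] u0(2) by metis
  have T: "vbase E u \<in> Tr T" using T0 u by simp
  have fu: "fst f = line E k u" "fst g = line E k u" "fst h = line E k u" using fgh u0 u by auto
  obtain a where a: "f = hom_of E k (u, a)" "(u, a) \<in> topspace (HX i {..<i})"
    using hom_obtain[OF fgh(1) u(1,4) fu(1)] .
  obtain b where b: "g = hom_of E k (u, b)" "(u, b) \<in> topspace (HX i {i<..k})"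
    using hom_obtain[OF fgh(2) u(1,4) fu(2)] .
  obtain d where d: "h = hom_of E k (u, d)" "(u, d) \<in> topspace (HX i {i<..k})"
    using hom_obtain[OF fgh(3) u(1,4) fu(3)] .
  have V: "a \<in> V" "b \<in> V" "d \<in> V" "vbase E a = vbase E u" "vbase E b = vbase E u" "vbase E d = vbase E u"
    "vsupp E k a \<subseteq> {..<i}" "vsupp E k b \<subseteq> {i<..k}" "vsupp E k d \<subseteq> {i<..k}"
    using a(2) b(2) d(2) unfolding mem_HX by auto
  define v where "v = vadd E k u (vadd E k a b)"
  define v' where "v' = vadd E k u (vadd E k (vscale E k 0 u) d)"
  have v: "v \<in> V" "v' \<in> V" "vbase E v = vbase E u" "vbase E v' = vbase E u"
    using u V by (auto simp: v_def v'_def)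
  have vT: "vbase E v \<in> Tr T" "vbase E v' \<in> Tr T" using v T by auto
  have xv: "x = line E k v" using graph_hom_of[of u a b] u V by (simp add: xy a b v_def)
  have yv: "y = line E k v'"
  proof -
    have "y = graph E k (hom_zero E k (line E k u), h)" unfolding xy fu(3) ..
    also have "\<dots> = graph E k (hom_of E k (u, vscale E k 0 u), hom_of E k (u, d))"
      using hom_zero_line[OF u(1)] u(4) d(1) by simp
    also have "\<dots> = line E k v'"
      unfolding v'_def using V u(1,4) by (intro graph_hom_of) auto
    finally show ?thesis .
  qed
  have cv: "co T q v = co T q u + (co T q a + co T q b)" "co T q v' = co T q u + co T q d" if "q \<in> Ix" for q
    using u V T that by (auto simp: v_def v'_def co_vadd co_vscale)
  have z: "fst q \<noteq> i \<Longrightarrow> co T q u = 0" "i \<le> fst q \<Longrightarrow> co T q a = 0" "fst q \<le> i \<Longrightarrow> co T q b = 0"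
    "fst q \<le> i \<Longrightarrow> co T q d = 0" if q: "q \<in> Ix" for q
    using co_zero[OF u(1) T q] co_zero[OF V(1) _ q, of T] co_zero[OF V(2) _ q, of T]
      co_zero[OF V(3) _ q, of T] V T u(4) by (force simp del: not_le)+
  have q0v: "co T q0 v = 1" "co T q0 v' = 1" using cv[OF q0(1)] z[OF q0(1)] q0(2) u(5) by auto
  have "i \<in> vsupp E k v" "i \<in> vsupp E k v'"
    using nonzero_vsupp[OF v(1) vT(1) q0(1)] nonzero_vsupp[OF v(2) vT(2) q0(1)] q0v q0(2) by auto
  then have vnz: "vsupp E k v \<noteq> {}" "vsupp E k v' \<noteq> {}" by auto
  have b0: "co T q b = 0" if q: "q \<in> Ix" for q
  proof (cases "fst q \<le> i")
    case True
    then show ?thesis using z[OF q] by simp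
  next
    case False
    obtain r r' where r: "SUrep i r r'" "line E k r = line E k v"
      using SU SU_iff[OF M \<beta> i] xv by metis
    then have "r \<in> V" by (simp add: SUrep_def)
    from line_eq_vsupp[OF this v(1) vnz(1) r(2)] have "vsupp E k r = vsupp E k v" .
    then have "fst q \<notin> vsupp E k v" using r(1) False by (auto simp: SUrep_def)
    then show ?thesis using co_zero[OF v(1) vT(1) q] cv[OF q] z[OF q] False by simp
  qed
  show ?thesis unfolding strict_transform_def in_closure_of
  proof (intro conjI allI impI)
    have "\<exists>Q. openin P1 Q \<and> p1 0 1 \<in> Q" using P1_large_open[of 0] by metis
    then have "p1 0 1 \<in> topspace P1" using openin_subset by blast
    then show "(p1 0 1, x, y) \<in> topspace (prod_topology P1 (PP E k))"
      using SU_subset_PP[OF M \<beta> i] SU by auto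
    fix W assume W: "(p1 0 1, x, y) \<in> W \<and> openin (prod_topology P1 (PP E k)) W"
    then have "openin (prod_topology P1 (PP E k)) W" "(p1 0 1, (x, y)) \<in> W" by auto
    then obtain Q W1 where Q: "openin P1 Q" "p1 0 1 \<in> Q" and W1: "openin (PP E k) W1" "(x, y) \<in> W1"
      and sub1: "Q \<times> W1 \<subseteq> W" by (rule prod_topology_nbhd) (rule that)
    obtain R where R: "\<And>l. R < norm l \<Longrightarrow> p1 1 l \<in> Q" using P1_nbhd[OF Q] by metis
    obtain W2 where W2: "openin (prod_topology (PE E k) (PE E k)) W2" "W1 = W2 \<inter> {(x, y). pbase E x = pbase E y}"
      using W1(1) unfolding PP_def openin_subtopology by blast
    have "(x, y) \<in> W2" using W1 W2 by blast
    with W2(1) obtain Wx Wy where Wx: "openin (PE E k) Wx" "x \<in> Wx" and Wy: "openin (PE E k) Wy" "y \<in> Wy"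
      and sub2: "Wx \<times> Wy \<subseteq> W2" by (rule prod_topology_nbhd) (rule that)
    obtain N1 \<epsilon>1 where N1: "openin M N1" "vbase E v \<in> N1" "N1 \<subseteq> Tr T" "0 < \<epsilon>1"
      "\<And>w. w \<in> V \<Longrightarrow> vbase E w \<in> N1 \<Longrightarrow> vsupp E k w \<noteq> {} \<Longrightarrow>
       \<forall>q\<in>Ix. norm (co T q w - co T q v) < \<epsilon>1 \<Longrightarrow> line E k w \<in> Wx"
      by (rule slice_nbhd[OF Wx(1) Wx(2)[unfolded xv] v(1) vnz(1) vT(1)]) (rule that)
    obtain N2 \<epsilon>2 where N2: "openin M N2" "vbase E v' \<in> N2" "N2 \<subseteq> Tr T" "0 < \<epsilon>2"
      "\<And>w. w \<in> V \<Longrightarrow> vbase E w \<in> N2 \<Longrightarrow> vsupp E k w \<noteq> {} \<Longrightarrow>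
       \<forall>q\<in>Ix. norm (co T q w - co T q v') < \<epsilon>2 \<Longrightarrow> line E k w \<in> Wy"
      by (rule slice_nbhd[OF Wy(1) Wy(2)[unfolded yv] v(2) vnz(2) vT(2)]) (rule that)
    define N where "N = N1 \<inter> N2"
    have N: "openin M N" "vbase E u \<in> N" "N \<subseteq> Tr T" using N1 N2 v by (auto simp: N_def)
    have \<epsilon>: "0 < min \<epsilon>1 \<epsilon>2" using N1 N2 by simp
    obtain \<delta> where \<delta>: "0 < \<delta>"
      "\<And>c W. c \<noteq> 0 \<Longrightarrow> \<forall>q\<in>Ix. norm (W q - co T q v) < \<delta> \<Longrightarrow>
       \<forall>q\<in>Ix. i < fst q \<longrightarrow> norm (c powi (\<beta> (fst q) - \<beta> i) * W q - co T q v') < \<delta> \<Longrightarrow>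
       \<exists>l. l \<noteq> 0 \<and> R < norm l \<and>
         (\<forall>q\<in>Ix. norm (W q - co T q v) < min \<epsilon>1 \<epsilon>2 \<and>
            norm (l powi (\<beta> (fst q) - \<beta> i) * W q - co T q v') < min \<epsilon>1 \<epsilon>2)"
    proof (rule large_scaling[OF finite_Ix, of i "\<lambda>j. \<beta> j - \<beta> i" "\<lambda>q. co T q v" "\<lambda>q. co T q v'" "min \<epsilon>1 \<epsilon>2" R])
      fix q assume q: "q \<in> Ix"
      then have qk: "fst q \<le> k" by (auto simp: Ix_def)
      show "\<beta> (fst q) - \<beta> i < 0" if "fst q < i"
        using strict_mono_onD[OF \<beta>, of "fst q" i] that qk i by simp
      show "0 < \<beta> (fst q) - \<beta> i" if "i < fst q"
        using strict_mono_onD[OF \<beta>, of i "fst q"] that qk i by simp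
      show "co T q v = 0" if "i < fst q" using that cv[OF q] z[OF q] b0[OF q] by simp
      show "co T q v' = 0" if "fst q < i" using that cv[OF q] z[OF q] by simp
      show "co T q v = co T q v'" if "fst q = i" using that cv[OF q] z[OF q] by simp
    qed (use \<epsilon> that in auto)
    let ?Bf = "hom_of E k ` hslice i {..<i} T q0 N (\<lambda>q. hco T q (u, a)) \<delta>"
    let ?Bg = "hom_of E k ` hslice i {i<..k} T q0 N (\<lambda>q. hco T q (u, b)) \<delta>"
    let ?Bh = "hom_of E k ` hslice i {i<..k} T q0 N (\<lambda>q. hco T q (u, d)) \<delta>"
    let ?B = "((?Bf \<times> ?Bg) \<inter> ?F) \<times> ?Bh \<inter> ?H"
    have "openin (Eminus E k i) ?Bf" "openin (Eplus E k i) ?Bg" "openin (Eplus E k i) ?Bh"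
      using N q0 by (auto intro!: hslice_open)
    then have "openin ?Z ?B" unfolding Epm_def
      by (intro openin_subtopology_Int) (simp add: openin_prod_Times_iff openin_subtopology_Int)
    moreover have mem: "(u, a) \<in> hslice i {..<i} T q0 N (\<lambda>q. hco T q (u, a)) \<delta>"
      "(u, b) \<in> hslice i {i<..k} T q0 N (\<lambda>q. hco T q (u, b)) \<delta>"
      "(u, d) \<in> hslice i {i<..k} T q0 N (\<lambda>q. hco T q (u, d)) \<delta>"
      unfolding hslice_def using a(2) b(2) d(2) N \<delta>(1) u(5) z[OF q0(1)] q0(2)
      by (auto simp: hco_def simp del: topspace_subtopology)
    then have "((f, g), h) \<in> ?B" unfolding a b d by (auto simp del: topspace_subtopology)
    ultimately have "\<exists>p. p \<in> ?S \<and> p \<in> ?B"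
      using cone unfolding in_closure_of by meson
    then obtain P where P: "P \<in> ?S" "P \<in> ?B" by blast
    from P(1) obtain f' g' c where P_eq: "P = ((f', g'), hom_act E k \<beta> i c g')"
      and fg: "(f', g') \<in> topspace (Epm E k i)" "graph E k (f', g') \<in> A" "c \<noteq> 0" by blast
    have B: "f' \<in> ?Bf" "g' \<in> ?Bg" "fst f' = fst g'" "hom_act E k \<beta> i c g' \<in> ?Bh"
      using P(2) unfolding P_eq by (simp_all only: mem_Sigma_iff Int_iff mem_Collect_eq prod.case)
    obtain u1 a1 where a1: "(u1, a1) \<in> hslice i {..<i} T q0 N (\<lambda>q. hco T q (u, a)) \<delta>" "f' = hom_of E k (u1, a1)"
      using B(1) by auto
    obtain u2 b2 where b2: "(u2, b2) \<in> hslice i {i<..k} T q0 N (\<lambda>q. hco T q (u, b)) \<delta>" "g' = hom_of E k (u2, b2)"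
      using B(2) by auto
    obtain u3 d3 where d3: "(u3, d3) \<in> hslice i {i<..k} T q0 N (\<lambda>q. hco T q (u, d)) \<delta>"
      "hom_act E k \<beta> i c g' = hom_of E k (u3, d3)"
      using B(4) by auto
    have h1: "(u1, a1) \<in> topspace (HX i {..<i})" "vbase E u1 \<in> N" "hco T q0 (u1, a1) = 1"
      and n1: "\<forall>q\<in>Ix. norm (hco T q (u1, a1) - hco T q (u, a)) < \<delta>"
      using a1(1) unfolding hslice_def by auto
    have h2: "(u2, b2) \<in> topspace (HX i {i<..k})" "vbase E u2 \<in> N" "hco T q0 (u2, b2) = 1"
      and n2: "\<forall>q\<in>Ix. norm (hco T q (u2, b2) - hco T q (u, b)) < \<delta>"
      using b2(1) unfolding hslice_def by auto
    have h3: "(u3, d3) \<in> topspace (HX i {i<..k})" "vbase E u3 \<in> N" "hco T q0 (u3, d3) = 1"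
      and n3: "\<forall>q\<in>Ix. norm (hco T q (u3, d3) - hco T q (u, d)) < \<delta>"
      using d3(1) unfolding hslice_def by auto
    have ni: "i \<notin> {..<i}" "i \<notin> {i<..k}" by auto
    have T1: "vbase E u1 \<in> Tr T" "vbase E u2 \<in> Tr T" "vbase E u3 \<in> Tr T" using h1 h2 h3 N by auto
    have c1: "co T q0 u1 = 1" "co T q0 u2 = 1" "co T q0 u3 = 1"
      using hco_split(1)[OF h1(1) T1(1) q0(1) ni(1)] hco_split(1)[OF h2(1) T1(2) q0(1) ni(2)]
        hco_split(1)[OF h3(1) T1(3) q0(1) ni(2)] h1 h2 h3 q0 by auto
    have "line E k u1 = line E k u2" using B(3) a1 b2 by simp
    then have u21: "u2 = u1" using hom_of_eq_normalized(1)[OF h1(1) h2(1) T1(1) q0(1) c1(1,2)] by simp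
    have V1: "u1 \<in> V" "a1 \<in> V" "b2 \<in> V" "vbase E a1 = vbase E u1" "vbase E b2 = vbase E u1"
      "vsupp E k u1 = {i}" "vsupp E k a1 \<subseteq> {..<i}" "vsupp E k b2 \<subseteq> {i<..k}"
      using h1 h2 u21 unfolding mem_HX by auto
    define b3 where "b3 = vact E k (\<lambda>j. \<beta> j - \<beta> i) c b2"
    have "hom_act E k \<beta> i c g' = hom_of E k (u1, b3)"
      using V1 by (simp add: b2(2) u21 hom_act_hom_of b3_def)
    then have "hom_of E k (u1, b3) = hom_of E k (u3, d3)" using d3(2) by simp
    moreover have "(u1, b3) \<in> topspace (HX i {i<..k})"
      unfolding mem_HX b3_def using V1 fg(3) by (simp add: vsupp_vact)
    ultimately have u31: "u3 = u1" "d3 = b3"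
      using hom_of_eq_normalized(2)[OF _ h3(1) T1(1) q0(1) c1(1,3)] by auto
    define w where "w = vadd E k u1 (vadd E k a1 b2)"
    have w: "w \<in> V" "vbase E w = vbase E u1" using V1 by (auto simp: w_def)
    have wT: "vbase E w \<in> Tr T" using w T1 by simp
    have cw: "co T q w = co T q u1 + (co T q a1 + co T q b2)" if "q \<in> Ix" for q
      using V1 T1 that by (simp add: w_def co_vadd)
    have z1: "fst q \<noteq> i \<Longrightarrow> co T q u1 = 0" "i \<le> fst q \<Longrightarrow> co T q a1 = 0"
      "fst q \<le> i \<Longrightarrow> co T q b2 = 0" if q: "q \<in> Ix" for q
      using co_zero[OF V1(1) T1(1) q] co_zero[OF V1(2) _ q, of T] co_zero[OF V1(3) _ q, of T] V1 T1
      by (force simp del: not_le)+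
    have near1: "norm (co T q w - co T q v) < \<delta>" if q: "q \<in> Ix" for q
    proof (cases "i < fst q")
      case True
      then have "co T q w = hco T q (u1, b2)" "co T q v = hco T q (u, b)"
        using cw[OF q] cv(1)[OF q] z(1,2)[OF q] z1[OF q] by (simp_all add: hco_def)
      then show ?thesis using n2 q u21 by auto
    next
      case False
      then have "co T q w = hco T q (u1, a1)" "co T q v = hco T q (u, a)"
        using cw[OF q] cv(1)[OF q] z(3)[OF q] z1(3)[OF q] by (simp_all add: hco_def)
      then show ?thesis using n1 q by auto
    qed
    have near2: "norm (c powi (\<beta> (fst q) - \<beta> i) * co T q w - co T q v') < \<delta>"
      if q: "q \<in> Ix" "i < fst q" for q
    proof -
      have "co T q w = co T q b2" using cw[OF q(1)] z1(1,2)[OF q(1)] q(2) by simp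
      moreover have "co T q b3 = c powi (\<beta> (fst q) - \<beta> i) * co T q b2"
        using V1 T1 q by (simp add: b3_def co_vact)
      moreover have "co T q b3 = hco T q (u1, b3)" using z1(1)[OF q(1)] q(2) by (simp add: hco_def)
      moreover have "co T q v' = hco T q (u, d)" using cv[OF q(1)] by (simp add: hco_def)
      ultimately have "c powi (\<beta> (fst q) - \<beta> i) * co T q w - co T q v' = hco T q (u3, d3) - hco T q (u, d)"
        using u31 by metis
      then show ?thesis using n3 q(1) by metis
    qed
    obtain l where l: "l \<noteq> 0" "R < norm l"
      "\<forall>q\<in>Ix. norm (co T q w - co T q v) < min \<epsilon>1 \<epsilon>2 \<and>
            norm (l powi (\<beta> (fst q) - \<beta> i) * co T q w - co T q v') < min \<epsilon>1 \<epsilon>2"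
      using \<delta>(2)[of c "\<lambda>q. co T q w"] fg(3) near1 near2 by blast
    have "co T q0 w = 1" using cw[OF q0(1)] z1[OF q0(1)] c1 q0(2) by simp
    then have "fst q0 \<in> vsupp E k w" using nonzero_vsupp[OF w(1) wT q0(1)] by simp
    then have wnz: "vsupp E k w \<noteq> {}" by blast
    have "graph E k (f', g') = line E k w"
      using graph_hom_of[of u1 a1 b2] V1 by (simp add: a1(2) b2(2) u21 w_def)
    then obtain m where m: "m \<in> topspace M" "s m = line E k w" using fg(2) A by auto
    have x: "s m \<in> Wx" unfolding m(2)
      by (rule N1(5)) (use w h1 wnz l in \<open>auto simp: N_def\<close>)
    let ?w = "vscale E k (l powi (- \<beta> i)) (vact E k \<beta> l w)"
    have sc: "pact E k \<beta> l (s m) = line E k ?w"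
      using m w l by (simp add: pact_line line_vscale)
    have y: "pact E k \<beta> l (s m) \<in> Wy" unfolding sc
    proof (rule N2(5))
      show "?w \<in> V" "vbase E ?w \<in> N2" "vsupp E k ?w \<noteq> {}"
        using w h1 wnz l by (auto simp: N_def vsupp_vscale vsupp_vact)
      show "\<forall>q\<in>Ix. norm (co T q ?w - co T q v') < \<epsilon>2"
        using l w wT by (simp add: co_vscale co_vact powi_diff_mult)
    qed
    have "pbase E (pact E k \<beta> l (s m)) = vbase E w" unfolding sc using w by (simp add: pbase_line)
    then have "pbase E (s m) = pbase E (pact E k \<beta> l (s m))"
      using m(2) w by (simp only: pbase_line)
    then have "(s m, pact E k \<beta> l (s m)) \<in> W1" using x y sub2 W2(2) by blast
    then have "(p1 1 l, s m, pact E k \<beta> l (s m)) \<in> W" using R[OF l(2)] sub1 by blast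
    then show "\<exists>p. p \<in> {(p1 1 l, s m, pact E k \<beta> l (s m)) |l m. l \<noteq> 0 \<and> m \<in> topspace M} \<and> p \<in> W"
      using l(1) m(1) by blast
  qed
qed

end

theorem theorem9p6:
  fixes M :: "'m topology"
    and \<A> :: "('m, 'n::finite) atlas"
    and E :: "nat \<Rightarrow> ('m, 'e) vbundle"
    and \<beta> :: "nat \<Rightarrow> int"
    and s :: "'m \<Rightarrow> (nat \<Rightarrow> 'e) set"
    and k i :: nat
    and A :: "(nat \<Rightarrow> 'e) set set"
  assumes "complex_manifold M \<A>" and "connected_space M"
    and "\<forall>j\<le>k. holomorphic_bundle M \<A> (E j)"
    and "\<beta> 0 = 0" and "strict_mono_on {..k} \<beta>"
    and "holomorphic_section M \<A> E k s"
    and "\<forall>j\<le>k. \<not> s ` topspace M \<subseteq> stable E k \<beta> j"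
    and "i \<le> k"
    and "A = s ` topspace M \<inter> chart_dom E k i"
  shows "openin (subtopology (PP E k) (C_infty E k \<beta> i)) (SU E k \<beta> i) \<and>
    subtopology (PP E k) (C_infty E k \<beta> i) closure_of SU E k \<beta> i = C_infty E k \<beta> i \<and>
    {p \<in> SU E k \<beta> i. (p1 0 1, p) \<in> strict_transform M E k \<beta> s} = EG1 E k \<beta> i A \<and>
    S_infty M E k \<beta> s i \<inter>
        {(x, y) \<in> topspace (PP E k). x \<in> chart_dom E k i \<and> y \<in> chart_dom E k i} =
      EG1 E k \<beta> i A"
proof -
  interpret bundle_family M \<A> E k
    using assms(3) by unfold_locales blast
  have M: "Hausdorff_space M" using assms(1) unfolding complex_manifold_def by blast
  note \<beta> = assms(5) and i = assms(8) and A = assms(9)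
  let ?C = "C_infty E k \<beta> i" and ?SU = "SU E k \<beta> i"
  let ?O = "(chart_dom E k i \<times> chart_dom E k i) \<inter> {(x, y). pbase E x = pbase E y}"
  have SUP: "?SU \<subseteq> topspace (PP E k)" by (rule SU_subset_PP[OF M \<beta> i])
  have SUC: "?SU \<subseteq> ?C" unfolding C_infty_def using SUP by (rule closure_of_subset)
  have CP: "?C \<subseteq> topspace (PP E k)" unfolding C_infty_def by (rule closure_of_subset_topspace)
  have SU_eq: "?SU = ?C \<inter> ?O"
  proof (intro equalityI subrelI)
    fix x y assume xy: "(x, y) \<in> ?SU"
    then show "(x, y) \<in> ?C \<inter> ?O"
      using SUC SUP SU_subset_chart[OF M \<beta> i xy] by (auto simp: PP_def)
  next
    fix x y assume "(x, y) \<in> ?C \<inter> ?O"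
    then show "(x, y) \<in> ?SU" using C_infty_chart[OF M \<beta> i] by blast
  qed
  have "openin (PP E k) ?O" by (intro PP_box_open openin_chart_dom)
  then have 1: "openin (subtopology (PP E k) ?C) ?SU"
    unfolding openin_subtopology using SU_eq by (metis inf_commute)
  have 2: "subtopology (PP E k) ?C closure_of ?SU = ?C"
    unfolding closure_of_subtopology using SUC by (simp add: Int_absorb1 C_infty_def)
  have s: "pbase E (s m) = m" if "m \<in> topspace M" for m
    using assms(6) that unfolding holomorphic_section_def by blast
  have 3: "{p \<in> ?SU. (p1 0 1, p) \<in> strict_transform M E k \<beta> s} = EG1 E k \<beta> i A"
    unfolding EG1_def
    using strict_transform_subset_cone[OF M \<beta> i A] cone_subset_strict_transform[OF M \<beta> i s A] by auto
  have "S_infty M E k \<beta> s i = {p \<in> ?C. (p1 0 1, p) \<in> strict_transform M E k \<beta> s}"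
    unfolding S_infty_def by force
  moreover have "?C \<inter> {(x, y) \<in> topspace (PP E k). x \<in> chart_dom E k i \<and> y \<in> chart_dom E k i} = ?SU"
  proof -
    have "{(x, y) \<in> topspace (PP E k). x \<in> chart_dom E k i \<and> y \<in> chart_dom E k i} = topspace (PP E k) \<inter> ?O"
      by (auto simp: PP_def)
    then show ?thesis using SU_eq CP by auto
  qed
  ultimately have "S_infty M E k \<beta> s i \<inter>
        {(x, y) \<in> topspace (PP E k). x \<in> chart_dom E k i \<and> y \<in> chart_dom E k i} =
      {p \<in> ?SU. (p1 0 1, p) \<in> strict_transform M E k \<beta> s}" by blast
  with 1 2 3 show ?thesis by simp
qed

end
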